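(* Let $\sigma>0$ and let $(X_t,U_t,V_t)$ be the solution on $\mathbb{R}\times\mathbb{R}^2$ of $$dX_t=\sigma dB_t+(\sin(X_t)U_t-\cos(X_t)V_t)dt,\quad dU_t=\cos(X_t)dt,\quad dV_t=\sin(X_t)dt,$$ with $(X_0,U_0,V_0)=(0,0,0)$ and $B$ a real Brownian motion (equivalently $X_t=\sigma B_t+\int_0^t\int_0^t\sin(X_s-X_r)\,dr\,ds$ type self-repelling diffusion with $U_t=\int_0^t\cos X_s ds$, $V_t=\int_0^t\sin X_sds$). Then almost surely $X_t \bmod 2\pi$ does not converge in $\mathbb{S}^1=\mathbb{R}/2\pi\mathbb{Z}$ (and a fortiori $X_t$ does not converge in $\mathbb{R}$), while $X_t/t\to0$ almost surely as $t\to\infty$.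
   Context: Here $X_t$ is real-valued (the lift to $\mathbb{R}$ of the angle); the drift $\sin(X_t)U_t-\cos(X_t)V_t$ equals $\int_0^t\sin(X_t-X_s)ds$. *)

theory Defs
  imports "HOL-Probability.Probability"
begin

definition brownian_motion :: "'a measure \<Rightarrow> (real \<Rightarrow> 'a \<Rightarrow> real) \<Rightarrow> bool" where
  "brownian_motion M B \<longleftrightarrow>
     prob_space M \<and>
     (\<forall>t\<ge>0. B t \<in> borel_measurable M) \<and>
     (\<forall>\<omega>\<in>space M. B 0 \<omega> = 0) \<and>
     (\<forall>\<omega>\<in>space M. continuous_on {0..} (\<lambda>t. B t \<omega>)) \<and>
     (\<forall>s t. 0 \<le> s \<and> s < t \<longrightarrow>
        distributed M lborel (\<lambda>\<omega>. B t \<omega> - B s \<omega>)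
          (\<lambda>x. ennreal (normal_density 0 (sqrt (t - s)) x))) \<and>
     (\<forall>(n::nat) (ts::nat \<Rightarrow> real). 0 \<le> ts 0 \<and> (\<forall>i<n. ts i < ts (Suc i)) \<longrightarrow>
        prob_space.indep_vars M (\<lambda>_. borel)
          (\<lambda>i \<omega>. B (ts (Suc i)) \<omega> - B (ts i) \<omega>) {..<n})"

end

theory Submission
  imports Defs "HOL-Real_Asymp.Real_Asymp"
begin

text \<open>
  Write \<open>Z = U + \<i> V\<close> for the memory and \<open>D = Im (cis X * cnj Z)\<close> for the drift of the angle.  The
  solution is a functional of the Brownian path, so everything happens on path space.

  Tightness: when \<open>R = \<bar>Z\<bar>\<close> is large, the angle between \<open>X\<close> and \<open>Z\<close> settles near \<open>\<pi>\<close>, where \<open>R\<close>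
  decreases at unit speed.  A bounded test function of that angle turns this into a geometric
  drift condition for \<open>exp (\<epsilon> R)\<close> along times \<open>n T\<close>.  If \<open>cis X\<close> converged, \<open>R\<close> would grow linearly,
  which the resulting uniform moment bounds exclude.

  Law of large numbers: negating the increments of the noise after a time when \<open>D\<close> vanishes
  reflects the future of \<open>X\<close>, hence the drift after a sign change of \<open>D\<close> is uncorrelated with the
  past.  While \<open>R\<close> is bounded, the noise forces a sign change with a probability bounded below, and
  together with the drift condition this makes the correlations of the integrals of \<open>D\<close> over the
  blocks \<open>[n T, (n + 1) T]\<close> decay exponentially.  Second moments along the times \<open>k\<^sup>2 T\<close> then give
  \<open>X t / t \<longlonglongrightarrow> 0\<close>.
\<close>

section \<open>Calculus on grids\<close>

text \<open>Conditioning on the past is expressed by weights: an estimate given the path up to a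
  time \<open>a\<close> is an inequality between integrals against every bounded \<open>w\<close>
  with \<open>known a w\<close>, and is iterated by multiplying the weight by indicators. Stopping
  at a random time becomes a sum over the first grid point with a given property, so that the
  increment rule and the reflection are used at deterministic times only. The zeros of
  \<open>D\<close> are the right places to reflect because the equation is invariant under
  reflection of the plane in a line through the origin: when \<open>D = 0\<close>, the memory
  \<open>Z\<close> lies on the line spanned by \<open>cis X\<close>, and the reflection in that line
  fixes both. Negating the noise then maps the solution to its mirror image, whose drift is
  \<open>- D\<close>. The obstacle is that the drift is unbounded: it is controlled only by
  \<open>R\<close>, which may be as large as the time. Hence the exponential moments, and hence a
  contraction for the absence of sign changes that has to weigh large \<open>R\<close> against the
  chance of a sign change while \<open>R\<close> is moderate.\<close>

lemma norm_cis_diff_le: "norm (cis u - cis v) \<le> \<bar>u - v\<bar>"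
proof -
  obtain w where w: "u - v = 2 * w" by (metis field_sum_of_halves mult_2)
  have "norm (cis u - cis v)^2 = (cos u - cos v)^2 + (sin u - sin v)^2"
    by (simp add: cmod_power2)
  also have "\<dots> = 2 - 2 * cos (u - v)"
    using sin_cos_squared_add[of u] sin_cos_squared_add[of v]
    by (simp add: cos_diff power2_eq_square algebra_simps)
  also have "\<dots> = (2 * sin w)^2"
    unfolding w cos_double_sin by (simp add: power_mult_distrib)
  also have "\<dots> \<le> (u - v)^2"
    unfolding w using abs_sin_x_le_abs_x[of w] by (simp add: abs_le_square_iff[symmetric] abs_mult)
  finally show ?thesis
    using abs_le_square_iff[of "norm (cis u - cis v)" "u - v"] by simp
qed

text \<open>Division by 0 puts every point of the degenerate grid \<open>n = 0\<close> at
  \<open>a\<close>, so for \<open>a \<le> b\<close> the points with index at most \<open>n\<close>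
  lie in \<open>{a..b}\<close> for every \<open>n\<close>.\<close>

definition grid :: "real \<Rightarrow> real \<Rightarrow> nat \<Rightarrow> nat \<Rightarrow> real" where
  "grid a b n j = a + (b - a) * real j / real n"

lemma grid_0[simp]: "grid a b n 0 = a"
  by (simp add: grid_def)

lemma grid_last[simp]: "n > 0 \<Longrightarrow> grid a b n n = b"
  by (simp add: grid_def)

lemma grid_Suc: "grid a b n (Suc j) = grid a b n j + (b - a) / real n"
  by (simp add: grid_def add_divide_distrib distrib_left)

lemma grid_mono: "a \<le> b \<Longrightarrow> i \<le> j \<Longrightarrow> grid a b n i \<le> grid a b n j"
  by (auto simp: grid_def intro!: divide_right_mono mult_left_mono)

lemma grid_mem: "a \<le> b \<Longrightarrow> j \<le> n \<Longrightarrow> grid a b n j \<in> {a..b}"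
  using grid_mono[of a b 0 j n] grid_mono[of a b j n n] by (cases "n = 0") auto

lemma integral_sum_partition:
  fixes f :: "real \<Rightarrow> 'b::banach"
  assumes "\<And>i j. i \<le> j \<Longrightarrow> j \<le> n \<Longrightarrow> g i \<le> g j" and "f integrable_on {g 0..g n}"
  shows "integral {g 0..g n} f = (\<Sum>j<n. integral {g j..g (Suc j)} f)"
  using assms
proof (induction n)
  case (Suc n)
  have "f integrable_on {g 0..g n}"
    by (rule integrable_subinterval_real[OF Suc.prems(2)]) (use Suc.prems(1) in auto)
  then have "integral {g 0..g n} f = (\<Sum>j<n. integral {g j..g (Suc j)} f)"
    by (intro Suc.IH Suc.prems) auto
  moreover have "integral {g 0..g n} f + integral {g n..g (Suc n)} f = integral {g 0..g (Suc n)} f"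
    by (rule Henstock_Kurzweil_Integration.integral_combine) (use Suc.prems in auto)
  ultimately show ?case by simp
qed simp

lemma weighted_riemann_sums:
  fixes p :: "real \<Rightarrow> 'b::euclidean_space" and f :: "real \<Rightarrow> real"
  assumes ab: "a \<le> b" and p: "continuous_on {a..b} p" and f: "continuous_on {a..b} f"
  shows "(\<lambda>n. \<Sum>j<n. integral {grid a b n j..grid a b n (Suc j)} f *\<^sub>R p (grid a b n j))
           \<longlonglongrightarrow> integral {a..b} (\<lambda>s. f s *\<^sub>R p s)"
proof (rule LIMSEQ_I)
  fix e :: real assume e: "e > 0"
  \<comment> \<open>The summand 1 keeps the divisor positive and makes the final inequality
    strict.\<close>
  define K where "K = integral {a..b} (\<lambda>s. \<bar>f s\<bar>) + 1"
  have "integral {a..b} (\<lambda>s. \<bar>f s\<bar>) \<ge> 0"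
    by (intro Henstock_Kurzweil_Integration.integral_nonneg integrable_continuous_interval continuous_intros f) auto
  then have K: "K > 0" by (simp add: K_def)
  have "uniformly_continuous_on {a..b} p"
    by (intro compact_uniformly_continuous p) auto
  then obtain d where d: "d > 0" "\<And>s t. s \<in> {a..b} \<Longrightarrow> t \<in> {a..b} \<Longrightarrow> dist s t < d \<Longrightarrow> dist (p s) (p t) < e / K"
    unfolding uniformly_continuous_on_def using e K by (metis divide_pos_pos)
  obtain N :: nat where N: "N > 0" "(b - a) / N < d"
    by (metis (mono_tags, opaque_lifting) d(1) ab diff_ge_0_iff_ge divide_less_eq ex_less_of_nat_mult
        mult.commute of_nat_0_less_iff order_le_less mult_zero_right linorder_not_less less_numeral_extra(1) of_nat_1 zero_less_one nat_neq_iff mult_eq_0_iff of_nat_0 less_nat_zero_code)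
  show "\<exists>N. \<forall>n\<ge>N. norm ((\<Sum>j<n. integral {grid a b n j..grid a b n (Suc j)} f *\<^sub>R p (grid a b n j))
      - integral {a..b} (\<lambda>s. f s *\<^sub>R p s)) < e"
  proof (intro exI[of _ N] allI impI)
    fix n assume n: "n \<ge> N"
    define g where "g = grid a b n"
    have n0: "n > 0" using n N by simp
    have h: "(b - a) / n < d"
      by (rule le_less_trans[OF _ N(2)]) (use n N ab in \<open>auto intro!: divide_left_mono\<close>)
    have g: "g 0 = a" "g n = b" using n0 by (auto simp: g_def)
    have gm: "i \<le> j \<Longrightarrow> g i \<le> g j" for i j using grid_mono[OF ab] by (auto simp: g_def)
    have sub: "{g j..g (Suc j)} \<subseteq> {a..b}" if "j < n" for j
      using gm[of 0 j] gm[of "Suc j" n] that g by auto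
    have cf: "continuous_on {g j..g (Suc j)} f" and cp: "continuous_on {g j..g (Suc j)} p" if "j < n" for j
      using continuous_on_subset[OF f sub[OF that]] continuous_on_subset[OF p sub[OF that]] by auto
    have "integral {a..b} (\<lambda>s. f s *\<^sub>R p s) = (\<Sum>j<n. integral {g j..g (Suc j)} (\<lambda>s. f s *\<^sub>R p s))"
      unfolding g(1,2)[symmetric]
      by (rule integral_sum_partition) (auto simp: g gm intro!: integrable_continuous_interval continuous_intros f p)
    then have "norm ((\<Sum>j<n. integral {g j..g (Suc j)} f *\<^sub>R p (g j)) - integral {a..b} (\<lambda>s. f s *\<^sub>R p s))
       = norm (\<Sum>j<n. integral {g j..g (Suc j)} f *\<^sub>R p (g j) - integral {g j..g (Suc j)} (\<lambda>s. f s *\<^sub>R p s))"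
      by (simp add: sum_subtractf)
    also have "\<dots> \<le> (\<Sum>j<n. norm (integral {g j..g (Suc j)} f *\<^sub>R p (g j) - integral {g j..g (Suc j)} (\<lambda>s. f s *\<^sub>R p s)))"
      by (rule norm_sum)
    also have "\<dots> \<le> (\<Sum>j<n. integral {g j..g (Suc j)} (\<lambda>s. \<bar>f s\<bar> * (e / K)))"
    proof (intro sum_mono)
      fix j assume j: "j \<in> {..<n}"
      then have j: "j < n" by simp
      have "integral {g j..g (Suc j)} f *\<^sub>R p (g j) = integral {g j..g (Suc j)} (\<lambda>s. f s *\<^sub>R p (g j))"
        by (rule integral_unique[symmetric], rule has_integral_scaleR_left, rule integrable_integral)
           (intro integrable_continuous_interval cf j)
      then have "integral {g j..g (Suc j)} f *\<^sub>R p (g j) - integral {g j..g (Suc j)} (\<lambda>s. f s *\<^sub>R p s)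
         = integral {g j..g (Suc j)} (\<lambda>s. f s *\<^sub>R p (g j)) - integral {g j..g (Suc j)} (\<lambda>s. f s *\<^sub>R p s)"
        by simp
      also have "\<dots> = integral {g j..g (Suc j)} (\<lambda>s. f s *\<^sub>R p (g j) - f s *\<^sub>R p s)"
        by (rule Henstock_Kurzweil_Integration.integral_diff[symmetric])
           (intro integrable_continuous_interval continuous_intros cf cp j)+
      also have "norm \<dots> \<le> integral {g j..g (Suc j)} (\<lambda>s. \<bar>f s\<bar> * (e / K))"
      proof (rule integral_norm_bound_integral)
        show "(\<lambda>s. f s *\<^sub>R p (g j) - f s *\<^sub>R p s) integrable_on {g j..g (Suc j)}"
          "(\<lambda>s. \<bar>f s\<bar> * (e / K)) integrable_on {g j..g (Suc j)}"
          by (intro integrable_continuous_interval continuous_intros cf cp j)+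
      next
        fix s assume s: "s \<in> {g j..g (Suc j)}"
        have "dist (g j) s < d"
          using s h gm[of j "Suc j"] grid_Suc[of a b n j] by (auto simp: dist_real_def g_def)
        then have "norm (p (g j) - p s) \<le> e / K"
          using d(2)[of "g j" s] sub[OF j] s gm[of j "Suc j"] by (force simp: dist_norm)
        then show "norm (f s *\<^sub>R p (g j) - f s *\<^sub>R p s) \<le> \<bar>f s\<bar> * (e / K)"
          unfolding scaleR_diff_right[symmetric] norm_scaleR by (intro mult_left_mono) auto
      qed
      finally show "norm (integral {g j..g (Suc j)} f *\<^sub>R p (g j) - integral {g j..g (Suc j)} (\<lambda>s. f s *\<^sub>R p s))
          \<le> integral {g j..g (Suc j)} (\<lambda>s. \<bar>f s\<bar> * (e / K))" .
    qed
    also have "\<dots> = integral {g 0..g n} (\<lambda>s. \<bar>f s\<bar> * (e / K))"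
      by (rule integral_sum_partition[symmetric])
        (use K in \<open>auto simp: g gm intro!: integrable_continuous_interval continuous_intros f\<close>)
    also have "\<dots> = integral {a..b} (\<lambda>s. \<bar>f s\<bar>) * (e / K)"
      unfolding g by (rule integral_mult_left)
    also have "\<dots> = (K - 1) * (e / K)"
      by (simp add: K_def)
    also have "\<dots> < e"
      using K e by (simp add: field_simps)
    finally show "norm ((\<Sum>j<n. integral {grid a b n j..grid a b n (Suc j)} f *\<^sub>R p (grid a b n j))
      - integral {a..b} (\<lambda>s. f s *\<^sub>R p s)) < e" by (simp add: g_def)
  qed
qed

lemma riemann_sums:
  fixes p :: "real \<Rightarrow> 'b::euclidean_space"
  assumes ab: "a \<le> b" and p: "continuous_on {a..b} p"
  shows "(\<lambda>n. \<Sum>j<n. ((b - a) / n) *\<^sub>R p (grid a b n j)) \<longlonglongrightarrow> integral {a..b} p"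
proof -
  have *: "integral {grid a b n j..grid a b n (Suc j)} (\<lambda>_. 1::real) = (b - a) / n" for n j
    using grid_Suc[of a b n j] grid_mono[OF ab, of j "Suc j" n] by simp
  show ?thesis
    using weighted_riemann_sums[OF ab p continuous_on_const[of _ 1]] unfolding * by simp
qed

text \<open>Being a pointwise limit of Riemann sums, the integral inherits measurability from single
  times, so no joint measurability in time and \<open>\<omega>\<close> enters.\<close>

lemma borel_measurable_integral_path:
  fixes Y :: "real \<Rightarrow> 'a \<Rightarrow> 'b::euclidean_space"
  assumes ab: "a \<le> b" and meas: "\<And>s. s \<in> {a..b} \<Longrightarrow> Y s \<in> borel_measurable N"
    and cont: "\<And>\<omega>. \<omega> \<in> space N \<Longrightarrow> continuous_on {a..b} (\<lambda>s. Y s \<omega>)"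
  shows "(\<lambda>\<omega>. integral {a..b} (\<lambda>s. Y s \<omega>)) \<in> borel_measurable N"
proof (rule borel_measurable_LIMSEQ_metric)
  show "(\<lambda>\<omega>. \<Sum>j<n. ((b - a) / n) *\<^sub>R Y (grid a b n j) \<omega>) \<in> borel_measurable N" for n
    by (intro borel_measurable_sum borel_measurable_scaleR borel_measurable_const meas)
       (use grid_mem[OF ab] in auto)
  show "(\<lambda>n. \<Sum>j<n. ((b - a) / n) *\<^sub>R Y (grid a b n j) \<omega>) \<longlonglongrightarrow> integral {a..b} (\<lambda>s. Y s \<omega>)"
    if "\<omega> \<in> space N" for \<omega>
    by (rule riemann_sums[OF ab cont[OF that]])
qed

text \<open>The maximum of \<open>\<phi>\<close> weighted by
  \<open>exp (- (2 * K * (t - a)))\<close> is compared with itself: at the rate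
  \<open>2 * K\<close>, twice the one in the hypothesis, the integral term gives back at most half
  of the maximum and can be absorbed. The price is the factor 2 and the doubled rate.\<close>

lemma gronwall:
  fixes \<phi> :: "real \<Rightarrow> real"
  assumes cont: "continuous_on {a..T} \<phi>" and K: "K > 0" and c: "c \<ge> 0"
    and le: "\<And>t. t \<in> {a..T} \<Longrightarrow> \<phi> t \<le> c + K * integral {a..t} \<phi>" and t: "t \<in> {a..T}"
  shows "\<phi> t \<le> 2 * c * exp (2 * K * (t - a))"
proof -
  define \<psi> where "\<psi> t = \<phi> t * exp (- (2 * K * (t - a)))" for t
  have "continuous_on {a..T} \<psi>" unfolding \<psi>_def by (intro continuous_intros cont)
  then obtain r where r: "r \<in> {a..T}" "\<And>s. s \<in> {a..T} \<Longrightarrow> \<psi> s \<le> \<psi> r"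
    using continuous_attains_sup[of "{a..T}" \<psi>] t by fastforce
  define E where "E s = exp (2 * K * (s - a))" for s
  have E: "E s > 0" for s by (simp add: E_def)
  have \<phi>\<psi>: "\<phi> s = \<psi> s * E s" for s by (simp add: \<psi>_def E_def flip: exp_add)
  have M: "\<phi> s \<le> \<psi> r * E s" if "s \<in> {a..T}" for s
    using r(2)[OF that] E[of s] by (simp add: \<phi>\<psi>)
  have "\<psi> r \<le> 2 * c"
  proof (cases "\<psi> r \<ge> 0")
    case True
    have hi: "((\<lambda>s. \<psi> r * E s) has_integral \<psi> r * (E r / (2 * K)) - \<psi> r * (E a / (2 * K))) {a..r}"
      using r(1) K by (intro fundamental_theorem_of_calculus)
        (auto intro!: derivative_eq_intros simp: E_def has_real_derivative_iff_has_vector_derivative[symmetric])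
    have "integral {a..r} \<phi> \<le> integral {a..r} (\<lambda>s. \<psi> r * E s)"
    proof (rule integral_le)
      show "\<phi> integrable_on {a..r}"
        by (intro integrable_continuous_interval continuous_on_subset[OF cont]) (use r in auto)
      show "(\<lambda>s. \<psi> r * E s) integrable_on {a..r}" using hi by blast
    qed (use M r in auto)
    also have "\<dots> \<le> \<psi> r * (E r / (2 * K))"
      using integral_unique[OF hi] True K E[of a] by simp
    finally have "K * integral {a..r} \<phi> \<le> \<psi> r * E r / 2"
      using K by (simp add: field_simps)
    then have "\<psi> r * E r \<le> c + \<psi> r * E r / 2" using le[OF r(1)] by (simp add: \<phi>\<psi>)
    moreover have "E r \<ge> 1" using K r by (simp add: E_def)
    ultimately have "\<psi> r * E r \<le> 2 * c * E r" using c mult_left_mono[of 1 "E r" "2*c"] by linarith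
    then show ?thesis using E[of r] by simp
  qed (use c in auto)
  then have "\<psi> r * E t \<le> 2 * c * E t" using E[of t] by simp
  then show ?thesis using M[OF t] unfolding E_def by linarith
qed

section \<open>The integral equation driven by a continuous path\<close>

text \<open>Initial time and initial memory are parameters, since a solution is restarted at
  intermediate times and compared with a mirror image that has a different memory.\<close>

definition mem :: "real \<Rightarrow> complex \<Rightarrow> (real \<Rightarrow> real) \<Rightarrow> real \<Rightarrow> complex" where
  "mem a z x t = z + integral {a..t} (\<lambda>s. cis (x s))"

text \<open>\<open>Im (cis x * cnj z)\<close> is \<open>sin x * Re z - cos x * Im z\<close>, the
  drift of the equation with \<open>z\<close> in the role of \<open>U + \<i> V\<close>.\<close>

definition drift :: "real \<Rightarrow> complex \<Rightarrow> (real \<Rightarrow> real) \<Rightarrow> real \<Rightarrow> real" where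
  "drift a z x t = Im (cis (x t) * cnj (mem a z x t))"

lemma mem_start[simp]: "mem a z x a = z"
  by (simp add: mem_def)

lemma mem_restart:
  assumes "continuous_on {a..T} x" "a \<le> s" "s \<le> t" "t \<le> T"
  shows "mem a z x t = mem s (mem a z x s) x t"
proof -
  have "integral {a..s} (\<lambda>s. cis (x s)) + integral {s..t} (\<lambda>s. cis (x s)) = integral {a..t} (\<lambda>s. cis (x s))"
    by (rule Henstock_Kurzweil_Integration.integral_combine)
       (use assms in \<open>auto intro!: integrable_continuous_interval continuous_intros continuous_on_subset[OF assms(1)]\<close>)
  then show ?thesis by (simp add: mem_def)
qed

lemma drift_restart:
  assumes "continuous_on {a..T} x" "a \<le> s" "s \<le> t" "t \<le> T"
  shows "drift a z x t = drift s (mem a z x s) x t"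
  unfolding drift_def mem_restart[OF assms] ..

lemma norm_mem_diff_start:
  assumes "continuous_on {a..t} x" "a \<le> t"
  shows "norm (mem a z x t - z) \<le> t - a"
proof -
  have "norm (integral {a..t} (\<lambda>s. cis (x s))) \<le> 1 * (t - a)"
    using assms by (intro integral_bound) (auto intro!: continuous_intros)
  then show ?thesis by (simp add: mem_def)
qed

lemma norm_mem_le:
  assumes "continuous_on {a..t} x" "a \<le> t"
  shows "norm (mem a z x t) \<le> norm z + (t - a)"
  using norm_mem_diff_start[OF assms, of z] norm_triangle_sub[of "mem a z x t" z] by linarith

lemma norm_mem_diff:
  assumes "continuous_on {a..T} x" "a \<le> s" "s \<le> t" "t \<le> T"
  shows "norm (mem a z x t - mem a z x s) \<le> t - s"
  unfolding mem_restart[OF assms]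
  by (rule norm_mem_diff_start) (use assms in \<open>auto intro: continuous_on_subset[OF assms(1)]\<close>)

lemma continuous_on_mem[continuous_intros]:
  assumes "continuous_on {a..T} x"
  shows "continuous_on {a..T} (mem a z x)"
  unfolding mem_def
  by (intro continuous_intros indefinite_integral_continuous_1 integrable_continuous_interval assms)

lemma continuous_on_drift[continuous_intros]:
  assumes "continuous_on {a..T} x"
  shows "continuous_on {a..T} (drift a z x)"
  unfolding drift_def by (intro continuous_intros assms)

lemma abs_drift_le_mem: "\<bar>drift a z x t\<bar> \<le> norm (mem a z x t)"
  unfolding drift_def using abs_Im_le_cmod[of "cis (x t) * cnj (mem a z x t)"] by (simp add: norm_mult)

lemma abs_drift_le:
  assumes "continuous_on {a..t} x" "a \<le> t"
  shows "\<bar>drift a z x t\<bar> \<le> norm z + (t - a)"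
  using abs_drift_le_mem norm_mem_le[OF assms] order_trans by blast

lemma abs_Im_cis_cnj_diff_le:
  "\<bar>Im (cis u * cnj p) - Im (cis v * cnj q)\<bar> \<le> \<bar>u - v\<bar> * norm p + norm (p - q)"
proof -
  have "cis u * cnj p - cis v * cnj q = (cis u - cis v) * cnj p + cis v * cnj (p - q)"
    by (simp add: algebra_simps)
  then have "norm (cis u * cnj p - cis v * cnj q) \<le> norm (cis u - cis v) * norm p + norm (p - q)"
    by (metis (no_types, lifting) complex_mod_cnj mult_1 norm_cis norm_mult norm_triangle_ineq)
  also have "\<dots> \<le> \<bar>u - v\<bar> * norm p + norm (p - q)"
    by (intro add_mono mult_right_mono norm_cis_diff_le) auto
  finally show ?thesis
    using abs_Im_le_cmod[of "cis u * cnj p - cis v * cnj q"] by simp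
qed

lemma norm_mem_diff_le:
  assumes x: "continuous_on {a..t} x" and y: "continuous_on {a..t} y"
  shows "norm (mem a z x t - mem a z' y t) \<le> norm (z - z') + integral {a..t} (\<lambda>s. \<bar>x s - y s\<bar>)"
proof -
  have int: "(\<lambda>s. cis (x s)) integrable_on {a..t}" "(\<lambda>s. cis (y s)) integrable_on {a..t}"
    "(\<lambda>s. cis (x s) - cis (y s)) integrable_on {a..t}" "(\<lambda>s. \<bar>x s - y s\<bar>) integrable_on {a..t}"
    by (intro integrable_continuous_interval continuous_intros x y)+
  have "mem a z x t - mem a z' y t = (z - z') + integral {a..t} (\<lambda>s. cis (x s) - cis (y s))"
    using Henstock_Kurzweil_Integration.integral_diff[OF int(1,2)] by (simp add: mem_def)
  also have "norm \<dots> \<le> norm (z - z') + norm (integral {a..t} (\<lambda>s. cis (x s) - cis (y s)))"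
    by (rule norm_triangle_ineq)
  also have "norm (integral {a..t} (\<lambda>s. cis (x s) - cis (y s))) \<le> integral {a..t} (\<lambda>s. \<bar>x s - y s\<bar>)"
    by (rule integral_norm_bound_integral[OF int(3,4)]) (rule norm_cis_diff_le)
  finally show ?thesis by simp
qed

lemma drift_diff_le:
  assumes x: "continuous_on {a..t} x" and y: "continuous_on {a..t} y" and a: "a \<le> t"
  shows "\<bar>drift a z x t - drift a z' y t\<bar>
    \<le> \<bar>x t - y t\<bar> * (norm z + (t - a)) + (norm (z - z') + integral {a..t} (\<lambda>s. \<bar>x s - y s\<bar>))"
  unfolding drift_def
  by (rule order_trans[OF abs_Im_cis_cnj_diff_le])
     (intro add_mono mult_left_mono norm_mem_le norm_mem_diff_le x y a abs_ge_zero)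

definition stab_const :: "real \<Rightarrow> real \<Rightarrow> real" where
  "stab_const r L = 2 * L * exp (2 * (r + 2 * L + 1) * L)"

text \<open>As a function of the position the drift has the length of the memory as a Lipschitz
  constant, and this length grows by at most \<open>T - a\<close>; so Gronwall's inequality applies
  on a bounded interval. The case \<open>z = z'\<close> is uniqueness, the general case compares a
  reflected solution with an exact mirror image.\<close>

lemma flow_stability:
  assumes x: "continuous_on {a..T} x" and y: "continuous_on {a..T} y"
    and xeq: "\<And>t. t \<in> {a..T} \<Longrightarrow> x t = g t + integral {a..t} (drift a z x)"
    and yeq: "\<And>t. t \<in> {a..T} \<Longrightarrow> y t = g t + integral {a..t} (drift a z' y)"
    and t: "t \<in> {a..T}"
  shows "\<bar>x t - y t\<bar> \<le> stab_const (norm z) (T - a) * norm (z - z')"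
proof -
  define \<phi> where "\<phi> t = \<bar>x t - y t\<bar>" for t
  have \<phi>_eq: "\<phi> = (\<lambda>t. \<bar>x t - y t\<bar>)" by (simp add: \<phi>_def fun_eq_iff)
  define L where "L = T - a"
  \<comment> \<open>A part \<open>norm z + L\<close> comes from the positions, another
    \<open>L\<close> from the memories, whose difference is itself an integral of position
    differences; 1 makes \<open>K\<close> positive.\<close>
  define K where "K = norm z + 2 * L + 1"
  have L: "L \<ge> 0" using t by (simp add: L_def)
  have c\<phi>: "continuous_on {a..T} \<phi>" unfolding \<phi>_def by (intro continuous_intros x y)
  have i\<phi>: "\<phi> integrable_on {a..s}" if "s \<le> T" for s
    using that by (intro integrable_continuous_interval continuous_on_subset[OF c\<phi>]) auto
  have "\<phi> t \<le> 2 * (L * norm (z - z')) * exp (2 * K * (t - a))"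
  proof (rule gronwall[OF c\<phi> _ _ _ t])
    show "K > 0" using L by (simp add: K_def add_nonneg_pos)
    show "0 \<le> L * norm (z - z')" using L by simp
    fix s assume s: "s \<in> {a..T}"
    have xs: "continuous_on {a..s} x" and ys: "continuous_on {a..s} y"
      using s by (auto intro: continuous_on_subset[OF x] continuous_on_subset[OF y])
    define J where "J = integral {a..s} \<phi>"
    have int: "drift a z x integrable_on {a..s}" "drift a z' y integrable_on {a..s}"
      by (intro integrable_continuous_interval continuous_intros xs ys)+
    have "x s - y s = integral {a..s} (\<lambda>r. drift a z x r - drift a z' y r)"
      unfolding xeq[OF s] yeq[OF s] using Henstock_Kurzweil_Integration.integral_diff[OF int] by simp
    then have "\<phi> s \<le> norm (integral {a..s} (\<lambda>r. drift a z x r - drift a z' y r))"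
      by (simp add: \<phi>_def)
    also have "\<dots> \<le> integral {a..s} (\<lambda>r. \<phi> r * (norm z + L) + (norm (z - z') + J))"
    proof (rule integral_norm_bound_integral)
      show "(\<lambda>r. drift a z x r - drift a z' y r) integrable_on {a..s}"
        "(\<lambda>r. \<phi> r * (norm z + L) + (norm (z - z') + J)) integrable_on {a..s}"
        unfolding \<phi>_def by (intro integrable_continuous_interval continuous_intros xs ys)+
      fix r assume r: "r \<in> {a..s}"
      have xr: "continuous_on {a..r} x" and yr: "continuous_on {a..r} y"
        using r by (auto intro: continuous_on_subset[OF xs] continuous_on_subset[OF ys])
      have "integral {a..r} \<phi> \<le> J"
        unfolding J_def using r s
        by (intro integral_subset_le i\<phi>) (auto simp: \<phi>_def)
      moreover have "\<phi> r * (norm z + (r - a)) \<le> \<phi> r * (norm z + L)"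
        using r s by (intro mult_left_mono) (auto simp: \<phi>_def L_def)
      moreover have "norm (drift a z x r - drift a z' y r)
          \<le> \<phi> r * (norm z + (r - a)) + (norm (z - z') + integral {a..r} \<phi>)"
        using drift_diff_le[OF xr yr, of z z'] r by (simp add: \<phi>_eq)
      ultimately show "norm (drift a z x r - drift a z' y r)
          \<le> \<phi> r * (norm z + L) + (norm (z - z') + J)" by linarith
    qed
    also have "\<dots> = (norm z + L) * J + (norm (z - z') + J) * (s - a)"
      using s i\<phi>[of s] by (subst Henstock_Kurzweil_Integration.integral_add)
        (auto simp: J_def intro: integrable_on_mult_left)
    also have "\<dots> \<le> (norm z + L) * J + (norm (z - z') + J) * L"
    proof -
      have "J \<ge> 0" unfolding J_def using i\<phi>[of s] s
        by (intro Henstock_Kurzweil_Integration.integral_nonneg) (auto simp: \<phi>_def)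
      then show ?thesis using s by (intro add_left_mono mult_left_mono) (auto simp: L_def)
    qed
    also have "\<dots> \<le> L * norm (z - z') + K * J"
    proof -
      have "J \<ge> 0" unfolding J_def using i\<phi>[of s] s
        by (intro Henstock_Kurzweil_Integration.integral_nonneg) (auto simp: \<phi>_def)
      then show ?thesis by (simp add: K_def algebra_simps)
    qed
    finally show "\<phi> s \<le> L * norm (z - z') + K * integral {a..s} \<phi>" by (simp add: J_def)
  qed
  also have "\<dots> \<le> 2 * (L * norm (z - z')) * exp (2 * K * L)"
  proof -
    have "2 * K * (t - a) \<le> 2 * K * L"
      using L t by (intro mult_left_mono) (auto simp: L_def K_def)
    then show ?thesis using L by (intro mult_left_mono) auto
  qed
  finally show ?thesis
    unfolding stab_const_def \<phi>_def L_def[symmetric] K_def[symmetric] by (simp add: mult_ac)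
qed

section \<open>Picard iteration: existence and uniqueness of the solution\<close>

fun picard :: "(real \<Rightarrow> real) \<Rightarrow> nat \<Rightarrow> real \<Rightarrow> real" where
  "picard g 0 = g"
| "picard g (Suc n) = (\<lambda>t. g t + integral {0..t} (drift 0 0 (picard g n)))"

definition sol :: "(real \<Rightarrow> real) \<Rightarrow> real \<Rightarrow> real" where
  "sol g t = lim (\<lambda>n. picard g n t)"

lemma mem_cong: "(\<And>s. s \<in> {a..t} \<Longrightarrow> x s = y s) \<Longrightarrow> mem a z x t = mem a z y t"
  unfolding mem_def by (auto intro!: integral_cong)

lemma drift_cong: "(\<And>s. s \<in> {a..t} \<Longrightarrow> x s = y s) \<Longrightarrow> a \<le> t \<Longrightarrow> drift a z x t = drift a z y t"
  unfolding drift_def by (subst mem_cong) auto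

lemma picard_cong:
  "(\<And>s. s \<in> {0..t} \<Longrightarrow> g s = h s) \<Longrightarrow> t \<ge> 0 \<Longrightarrow> picard g n t = picard h n t"
proof (induction n arbitrary: t)
  case (Suc n)
  have "integral {0..t} (drift 0 0 (picard g n)) = integral {0..t} (drift 0 0 (picard h n))"
    by (intro integral_cong drift_cong Suc.IH) (use Suc.prems in auto)
  then show ?case using Suc.prems by simp
qed simp

text \<open>This is adaptedness, the source of every \<open>known\<close> statement about the
  solution.\<close>

lemma sol_cong: "(\<And>s. s \<in> {0..t} \<Longrightarrow> g s = h s) \<Longrightarrow> t \<ge> 0 \<Longrightarrow> sol g t = sol h t"
  unfolding sol_def using picard_cong by metis

lemma continuous_on_picard:
  assumes "continuous_on {0..T} g" shows "continuous_on {0..T} (picard g n)"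
proof (induction n)
  case (Suc n)
  then show ?case
    by (auto intro!: continuous_intros assms indefinite_integral_continuous_1 integrable_continuous_interval)
qed (use assms in auto)

text \<open>The constants come from the drift being at most \<open>T\<close> for zero initial
  memory. In the induction step the difference of drifts has two parts, position difference times
  memory length and difference of memories, each at most \<open>T\<close> times the previous bound,
  whence the factor \<open>2 * T\<close>.\<close>

lemma picard_step_bound:
  assumes g: "continuous_on {0..T} g" and t: "t \<in> {0..T}"
  shows "\<bar>picard g (Suc n) t - picard g n t\<bar> \<le> T^2 * (2 * T * t) ^ n / fact n"
  using t
proof (induction n arbitrary: t)
  case 0
  have "norm (integral {0..t} (drift 0 0 g)) \<le> T * (t - 0)"
  proof (rule integral_bound)
    show "continuous_on {0..t} (drift 0 0 g)"
      using 0 by (intro continuous_intros continuous_on_subset[OF g]) auto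
    fix s assume s: "s \<in> {0..t}"
    have "continuous_on {0..s} g" using 0 s by (intro continuous_on_subset[OF g]) auto
    from abs_drift_le[OF this, of 0] show "norm (drift 0 0 g s) \<le> T" using s 0 by auto
  qed (use 0 in auto)
  also have "\<dots> \<le> T^2" using 0 by (auto simp: power2_eq_square intro: mult_left_mono)
  finally show ?case by simp
next
  case (Suc n)
  let ?x = "picard g (Suc n)" and ?y = "picard g n"
  define A where "A = T^2 * (2 * T) ^ n / fact n"
  have T: "T \<ge> 0" and t: "0 \<le> t" "t \<le> T" using Suc.prems by auto
  have A: "A \<ge> 0" using T by (simp add: A_def)
  have x: "continuous_on {0..t} ?x" and y: "continuous_on {0..t} ?y"
    using t by (auto intro: continuous_on_subset[OF continuous_on_picard[OF g]] simp del: picard.simps)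
  have IH: "\<bar>?x s - ?y s\<bar> \<le> A * s ^ n" if "s \<in> {0..t}" for s
    using Suc.IH[of s] that t by (simp add: A_def power_mult_distrib mult_ac del: picard.simps)
  have hi: "((\<lambda>s. 2 * T * (A * s ^ n)) has_integral 2 * T * (A * (t ^ Suc n / (Suc n))) - 2 * T * (A * (0 ^ Suc n / (Suc n)))) {0..t}"
    using t by (intro fundamental_theorem_of_calculus)
      (auto intro!: derivative_eq_intros simp: has_real_derivative_iff_has_vector_derivative[symmetric] simp del: of_nat_Suc power_Suc)
  have int: "drift 0 0 ?x integrable_on {0..t}" "drift 0 0 ?y integrable_on {0..t}"
    by (intro integrable_continuous_interval continuous_intros x y)+
  have "picard g (Suc (Suc n)) t - ?x t = integral {0..t} (drift 0 0 ?x) - integral {0..t} (drift 0 0 ?y)"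
    by simp
  also have "\<dots> = integral {0..t} (\<lambda>s. drift 0 0 ?x s - drift 0 0 ?y s)"
    using Henstock_Kurzweil_Integration.integral_diff[OF int] by simp
  finally have "\<bar>picard g (Suc (Suc n)) t - ?x t\<bar> = norm (integral {0..t} (\<lambda>s. drift 0 0 ?x s - drift 0 0 ?y s))"
    by simp
  also have "\<dots> \<le> integral {0..t} (\<lambda>s. 2 * T * (A * s ^ n))"
  proof (rule integral_norm_bound_integral)
    show "(\<lambda>s. drift 0 0 ?x s - drift 0 0 ?y s) integrable_on {0..t}"
      by (intro integrable_continuous_interval continuous_intros x y)
    show "(\<lambda>s. 2 * T * (A * s ^ n)) integrable_on {0..t}" using hi by blast
    fix s assume s: "s \<in> {0..t}"
    have xs: "continuous_on {0..s} ?x" and ys: "continuous_on {0..s} ?y"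
      using s by (auto intro: continuous_on_subset[OF x] continuous_on_subset[OF y] simp del: picard.simps)
    have "norm (integral {0..s} (\<lambda>r. \<bar>?x r - ?y r\<bar>)) \<le> (A * s ^ n) * (s - 0)"
    proof (rule integral_bound)
      show "continuous_on {0..s} (\<lambda>r. \<bar>?x r - ?y r\<bar>)" by (intro continuous_intros xs ys)
      fix r assume r: "r \<in> {0..s}"
      have "norm \<bar>?x r - ?y r\<bar> \<le> A * r ^ n" using IH[of r] r s by simp
      also have "\<dots> \<le> A * s ^ n" using r A by (intro mult_left_mono power_mono) auto
      finally show "norm \<bar>?x r - ?y r\<bar> \<le> A * s ^ n" .
    qed (use s in auto)
    also have "\<dots> \<le> (A * s ^ n) * T" using s A t by (intro mult_left_mono) auto
    finally have "integral {0..s} (\<lambda>r. \<bar>?x r - ?y r\<bar>) \<le> (A * s ^ n) * T" by (simp del: picard.simps)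
    moreover have "\<bar>?x s - ?y s\<bar> * (norm (0::complex) + (s - 0)) \<le> (A * s ^ n) * T"
      using IH[of s] s t A by (intro mult_mono) auto
    ultimately show "norm (drift 0 0 ?x s - drift 0 0 ?y s) \<le> 2 * T * (A * s ^ n)"
      using drift_diff_le[OF xs ys, of 0 0] s by (simp add: mult_ac del: picard.simps)
  qed
  also have "\<dots> = T^2 * (2 * T * t) ^ Suc n / fact (Suc n)"
    unfolding integral_unique[OF hi] by (simp add: A_def power_mult_distrib field_simps)
  finally show ?case .
qed

lemma uniform_limit_picard:
  assumes g: "continuous_on {0..T} g"
  shows "uniform_limit {0..T} (picard g) (sol g) sequentially"
proof -
  have "uniform_limit {0..T} (\<lambda>n t. \<Sum>i<n. picard g (Suc i) t - picard g i t)
          (\<lambda>t. suminf (\<lambda>i. picard g (Suc i) t - picard g i t)) sequentially"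
  proof (rule Weierstrass_m_test)
    show "norm (picard g (Suc n) t - picard g n t) \<le> T^2 * ((2 * T * T) ^ n / fact n)" if "t \<in> {0..T}" for n t
    proof -
      have "T^2 * (2 * T * t) ^ n / fact n \<le> T^2 * ((2 * T * T) ^ n / fact n)"
        using that by (auto intro!: divide_right_mono mult_left_mono power_mono)
      then show ?thesis using picard_step_bound[OF g that, of n] by simp
    qed
    show "summable (\<lambda>n. T^2 * ((2 * T * T) ^ n / fact n))"
      using summable_exp[of "2 * T * T"] by (intro summable_mult) (simp add: field_simps)
  qed
  then have "uniform_limit {0..T} (\<lambda>n t. g t + (\<Sum>i<n. picard g (Suc i) t - picard g i t))
          (\<lambda>t. g t + suminf (\<lambda>i. picard g (Suc i) t - picard g i t)) sequentially"
    by (intro uniform_limit_intros)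
  moreover have "g t + (\<Sum>i<n. picard g (Suc i) t - picard g i t) = picard g n t" for n t
    using sum_lessThan_telescope[of "\<lambda>i. picard g i t" n] by simp
  ultimately have u: "uniform_limit {0..T} (picard g) (\<lambda>t. g t + suminf (\<lambda>i. picard g (Suc i) t - picard g i t)) sequentially"
    by (simp del: picard.simps)
  moreover have "g t + suminf (\<lambda>i. picard g (Suc i) t - picard g i t) = sol g t" if "t \<in> {0..T}" for t
    unfolding sol_def using tendsto_uniform_limitI[OF u that] by (simp add: limI del: picard.simps)
  ultimately show ?thesis
    by (metis (no_types, lifting) uniform_limit_cong')
qed

lemma continuous_on_sol:
  assumes "continuous_on {0..T} g" shows "continuous_on {0..T} (sol g)"
  by (rule uniform_limit_theorem[OF _ uniform_limit_picard[OF assms]])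
     (auto intro!: always_eventually continuous_on_picard assms)

lemma sol_eq:
  assumes g: "continuous_on {0..T} g" and t: "t \<in> {0..T}"
  shows "sol g t = g t + integral {0..t} (drift 0 0 (sol g))"
proof -
  have u: "uniform_limit {0..t} (\<lambda>n. drift 0 0 (picard g n)) (drift 0 0 (sol g)) sequentially"
  proof (rule uniform_limitI)
    fix e :: real assume e: "e > 0"
    \<comment> \<open>Closeness \<open>d\<close> of the positions gives closeness
      \<open>2 * d * s\<close> of the drifts; \<open>T + 1\<close> replaces \<open>T\<close> to
      avoid dividing by 0.\<close>
    define d where "d = e / (4 * (T + 1))"
    have d: "d > 0" using e t by (simp add: d_def)
    have "\<forall>\<^sub>F n in sequentially. \<forall>s\<in>{0..T}. dist (picard g n s) (sol g s) < d"
      using uniform_limitD[OF uniform_limit_picard[OF g] d] .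
    then show "\<forall>\<^sub>F n in sequentially. \<forall>s\<in>{0..t}. dist (drift 0 0 (picard g n) s) (drift 0 0 (sol g) s) < e"
    proof eventually_elim
      case (elim n)
      show ?case
      proof
        fix s assume s: "s \<in> {0..t}"
        have x: "continuous_on {0..s} (picard g n)" and y: "continuous_on {0..s} (sol g)"
          using s t by (auto intro: continuous_on_subset[OF continuous_on_picard[OF g]] continuous_on_subset[OF continuous_on_sol[OF g]])
        have le: "\<bar>picard g n r - sol g r\<bar> \<le> d" if "r \<in> {0..s}" for r
          using elim that s t by (force simp: dist_real_def)
        have "norm (integral {0..s} (\<lambda>r. \<bar>picard g n r - sol g r\<bar>)) \<le> d * (s - 0)"
          using s le by (intro integral_bound continuous_intros x y) auto
        moreover have "\<bar>picard g n s - sol g s\<bar> * s \<le> d * s"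
          using s le[of s] by (intro mult_right_mono) auto
        ultimately have "\<bar>drift 0 0 (picard g n) s - drift 0 0 (sol g) s\<bar> \<le> 2 * d * s"
          using drift_diff_le[OF x y, of 0 0] s by simp
        also have "\<dots> \<le> 2 * d * (T + 1)" using d s t by (intro mult_left_mono) auto
        also have "\<dots> = e / 2" using t by (simp add: d_def divide_simps)
        also have "\<dots> < e" using e by simp
        finally show "dist (drift 0 0 (picard g n) s) (drift 0 0 (sol g) s) < e" by (simp add: dist_real_def)
      qed
    qed
  qed
  have c: "continuous_on {0..t} (drift 0 0 (picard g n))" for n
    using t by (intro continuous_intros continuous_on_subset[OF continuous_on_picard[OF g]]) auto
  obtain I J where IJ: "\<And>n. (drift 0 0 (picard g n) has_integral I n) {0..t}"
    "(drift 0 0 (sol g) has_integral J) {0..t}" "I \<longlonglongrightarrow> J"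
    using uniform_limit_integral[OF u c] by auto
  have "(\<lambda>n. picard g (Suc n) t) \<longlonglongrightarrow> g t + J"
    using IJ(3) by (auto simp: integral_unique[OF IJ(1)] intro!: tendsto_intros)
  moreover have "(\<lambda>n. picard g (Suc n) t) \<longlonglongrightarrow> sol g t"
    using tendsto_uniform_limitI[OF uniform_limit_picard[OF g] t] by (rule LIMSEQ_Suc)
  ultimately show ?thesis
    using LIMSEQ_unique integral_unique[OF IJ(2)] by metis
qed

lemma sol_unique:
  assumes g: "continuous_on {0..T} g" and x: "continuous_on {0..T} x"
    and eq: "\<And>t. t \<in> {0..T} \<Longrightarrow> x t = g t + integral {0..t} (drift 0 0 x)" and t: "t \<in> {0..T}"
  shows "x t = sol g t"
  using flow_stability[OF x continuous_on_sol[OF g] eq sol_eq[OF g] t] by simp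

section \<open>Path space and reflected paths\<close>

lemma stab_const_mono: "0 \<le> r \<Longrightarrow> r \<le> r' \<Longrightarrow> 0 \<le> L \<Longrightarrow> L \<le> L' \<Longrightarrow> stab_const r L \<le> stab_const r' L'"
  unfolding stab_const_def by (intro mult_mono) (auto intro!: mult_mono)

lemma stab_const_nonneg: "0 \<le> L \<Longrightarrow> 0 \<le> stab_const r L"
  by (simp add: stab_const_def)

text \<open>Indexing by all reals avoids a separate type of nonnegative times. The values at
  negative times are left arbitrary; neither the solution at nonnegative times nor
  \<open>known\<close> looks at them.\<close>

definition paths :: "(real \<Rightarrow> real) measure" where
  "paths = restrict_space (PiM UNIV (\<lambda>_. borel)) {c. continuous_on {0..} c}"

lemma space_paths: "space paths = {c. continuous_on {0..} c}"
  by (simp add: paths_def space_restrict_space space_PiM)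

lemma measurable_eval[measurable]: "(\<lambda>c. c t) \<in> borel_measurable paths"
  unfolding paths_def by (rule measurable_restrict_space1) simp

lemma measurable_pathsI:
  assumes "\<And>t. (\<lambda>\<omega>. f \<omega> t) \<in> borel_measurable M" "\<And>\<omega>. \<omega> \<in> space M \<Longrightarrow> continuous_on {0..} (f \<omega>)"
  shows "f \<in> measurable M paths"
  unfolding paths_def
  by (rule measurable_restrict_space2) (use assms in \<open>auto intro!: measurable_PiM_single' simp: space_PiM\<close>)

definition angle :: "real \<Rightarrow> (real \<Rightarrow> real) \<Rightarrow> real \<Rightarrow> real" where
  "angle \<sigma> c = sol (\<lambda>s. \<sigma> * c s)"

definition memory :: "real \<Rightarrow> (real \<Rightarrow> real) \<Rightarrow> real \<Rightarrow> complex" where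
  "memory \<sigma> c = mem 0 0 (angle \<sigma> c)"

definition force :: "real \<Rightarrow> (real \<Rightarrow> real) \<Rightarrow> real \<Rightarrow> real" where
  "force \<sigma> c = drift 0 0 (angle \<sigma> c)"

lemma continuous_on_path: "c \<in> space paths \<Longrightarrow> 0 \<le> a \<Longrightarrow> continuous_on {a..b} c"
  unfolding space_paths by (auto intro: continuous_on_subset)

lemma continuous_on_scaled_path: "c \<in> space paths \<Longrightarrow> 0 \<le> a \<Longrightarrow> continuous_on {a..b} (\<lambda>s. \<sigma> * c s)"
  by (rule continuous_on_mult_left[OF continuous_on_path])

lemma continuous_on_angle: "c \<in> space paths \<Longrightarrow> 0 \<le> a \<Longrightarrow> continuous_on {a..b} (angle \<sigma> c)"
  unfolding angle_def
  by (rule continuous_on_subset[of "{0..b}"])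
     (auto intro!: continuous_on_sol continuous_on_scaled_path)

lemma continuous_on_force: "c \<in> space paths \<Longrightarrow> 0 \<le> a \<Longrightarrow> continuous_on {a..b} (force \<sigma> c)"
  unfolding force_def
  by (rule continuous_on_subset[of "{0..b}"]) (auto intro!: continuous_intros continuous_on_angle)

lemma force_eq: "force \<sigma> c t = Im (cis (angle \<sigma> c t) * cnj (memory \<sigma> c t))"
  by (simp add: force_def memory_def drift_def)

lemma force_eq_sin_cos: "force \<sigma> c t = sin (angle \<sigma> c t) * Re (memory \<sigma> c t) - cos (angle \<sigma> c t) * Im (memory \<sigma> c t)"
  by (simp add: force_eq)

lemma memory_diff_eq:
  assumes "c \<in> space paths" "0 \<le> s" "s \<le> t"
  shows "memory \<sigma> c t = memory \<sigma> c s + integral {s..t} (\<lambda>r. cis (angle \<sigma> c r))"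
  using mem_restart[of 0 t "angle \<sigma> c" s t 0] continuous_on_angle[OF assms(1), of 0 t] assms
  by (simp add: memory_def) (simp add: mem_def)

lemma norm_memory_diff_le: "c \<in> space paths \<Longrightarrow> 0 \<le> s \<Longrightarrow> s \<le> t \<Longrightarrow> norm (memory \<sigma> c t - memory \<sigma> c s) \<le> t - s"
  unfolding memory_def by (rule norm_mem_diff[of 0 t]) (auto intro: continuous_on_angle)

lemma norm_memory_le: "c \<in> space paths \<Longrightarrow> 0 \<le> t \<Longrightarrow> norm (memory \<sigma> c t) \<le> t"
  using norm_memory_diff_le[of c 0 t \<sigma>] by (simp add: memory_def)

lemma abs_force_le_norm_memory: "\<bar>force \<sigma> c t\<bar> \<le> norm (memory \<sigma> c t)"
  unfolding force_def memory_def by (rule abs_drift_le_mem)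

lemma angle_restart:
  assumes c: "c \<in> space paths" and a: "0 \<le> a" "a \<le> t"
  shows "angle \<sigma> c t = angle \<sigma> c a + \<sigma> * (c t - c a) + integral {a..t} (force \<sigma> c)"
proof -
  have g: "continuous_on {0..t} (\<lambda>s. \<sigma> * c s)"
    by (intro continuous_on_scaled_path c) simp
  have "integral {0..a} (force \<sigma> c) + integral {a..t} (force \<sigma> c) = integral {0..t} (force \<sigma> c)"
    using a by (intro Henstock_Kurzweil_Integration.integral_combine integrable_continuous_interval continuous_on_force c) auto
  moreover have "angle \<sigma> c t = \<sigma> * c t + integral {0..t} (force \<sigma> c)"
    unfolding angle_def force_def using sol_eq[OF g, of t] a by simp
  moreover have "angle \<sigma> c a = \<sigma> * c a + integral {0..a} (force \<sigma> c)"
    unfolding angle_def force_def using sol_eq[OF g, of a] a by simp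
  ultimately show ?thesis by (simp add: algebra_simps)
qed

lemma measurable_picard:
  "t \<ge> 0 \<Longrightarrow> (\<lambda>c. picard (\<lambda>s. \<sigma> * c s) n t) \<in> borel_measurable paths"
proof (induction n arbitrary: t)
  case (Suc n)
  let ?p = "\<lambda>c. picard (\<lambda>s. \<sigma> * c s) n"
  have cont: "continuous_on {0..t} (?p c)" if "c \<in> space paths" for c t
    by (intro continuous_on_picard continuous_on_scaled_path that) simp
  have mem: "(\<lambda>c. mem 0 0 (?p c) s) \<in> borel_measurable paths" if "s \<ge> 0" for s
    unfolding mem_def
    by (intro borel_measurable_add borel_measurable_const borel_measurable_integral_path)
       (use that Suc.IH in \<open>auto simp: cis_conv_exp intro!: continuous_intros cont borel_measurable_continuous_on[where f = exp]\<close>)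
  have "(\<lambda>c. drift 0 0 (?p c) s) \<in> borel_measurable paths" if "s \<ge> 0" for s
    using Suc.IH[OF that] mem[OF that] unfolding drift_def by (simp add: cis.code)
  then have "(\<lambda>c. integral {0..t} (drift 0 0 (?p c))) \<in> borel_measurable paths"
    using Suc.prems by (intro borel_measurable_integral_path[where Y = "\<lambda>s c. drift 0 0 (?p c) s"])
      (auto intro!: continuous_intros cont)
  then show ?case by simp
qed simp

lemma measurable_angle[measurable]: "t \<ge> 0 \<Longrightarrow> (\<lambda>c. angle \<sigma> c t) \<in> borel_measurable paths"
  unfolding angle_def
proof (rule borel_measurable_LIMSEQ_metric[OF measurable_picard])
  fix c assume t: "t \<ge> 0" and c: "c \<in> space paths"
  show "(\<lambda>n. picard (\<lambda>s. \<sigma> * c s) n t) \<longlonglongrightarrow> sol (\<lambda>s. \<sigma> * c s) t"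
    by (rule tendsto_uniform_limitI[OF uniform_limit_picard[of t]])
       (use t c in \<open>auto intro!: continuous_on_scaled_path\<close>)
qed

lemma borel_measurable_cis[measurable]: "cis \<in> borel_measurable borel"
  by (intro borel_measurable_continuous_onI continuous_intros)

lemma measurable_memory[measurable]: "t \<ge> 0 \<Longrightarrow> (\<lambda>c. memory \<sigma> c t) \<in> borel_measurable paths"
  unfolding memory_def mem_def
  by (intro borel_measurable_add borel_measurable_const borel_measurable_integral_path)
     (auto intro!: continuous_intros continuous_on_angle)

lemma measurable_force[measurable]: "t \<ge> 0 \<Longrightarrow> (\<lambda>c. force \<sigma> c t) \<in> borel_measurable paths"
  unfolding force_eq_sin_cos
  using measurable_angle[of t \<sigma>] measurable_memory[of t \<sigma>] by simp

text \<open>Stands in for measurability with respect to the past up to \<open>a\<close>: together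
  with measurability on \<open>paths\<close> it implies the latter, as the stopped path shows later,
  and it is closed under composition without reference to a filtration.\<close>

definition known :: "real \<Rightarrow> ((real \<Rightarrow> real) \<Rightarrow> 'b) \<Rightarrow> bool" where
  "known a g \<longleftrightarrow> (\<forall>c c'. (\<forall>s\<in>{0..a}. c s = c' s) \<longrightarrow> g c = g c')"

lemma knownI:
  assumes "\<And>c c'. (\<And>s. 0 \<le> s \<Longrightarrow> s \<le> a \<Longrightarrow> c s = c' s) \<Longrightarrow> g c = g c'" shows "known a g"
  unfolding known_def
proof (intro allI impI)
  fix c c' :: "real \<Rightarrow> real" assume "\<forall>s\<in>{0..a}. c s = c' s"
  then show "g c = g c'" by (intro assms) (auto simp only: atLeastAtMost_iff)
qed

lemma knownD:
  assumes "known a g" "\<And>s. 0 \<le> s \<Longrightarrow> s \<le> a \<Longrightarrow> c s = c' s" shows "g c = g c'"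
  by (rule assms(1)[unfolded known_def, rule_format]) (use assms(2) in auto)

lemma known_mono: "known a g \<Longrightarrow> a \<le> b \<Longrightarrow> known b g"
  by (rule knownI, erule knownD) simp

lemma known_const[intro, simp]: "known a (\<lambda>_. k)"
  by (simp add: known_def)

lemma known_eval[intro, simp]: "0 \<le> s \<Longrightarrow> s \<le> a \<Longrightarrow> known a (\<lambda>c. c s)"
  by (simp add: known_def)

lemma known_comp: "known a g \<Longrightarrow> known a (\<lambda>c. f (g c))"
  by (rule knownI, rule arg_cong[where f = f]) (erule knownD)

lemma known_comp2: "known a g \<Longrightarrow> known a h \<Longrightarrow> known a (\<lambda>c. f (g c) (h c))"
  by (rule knownI, rule arg_cong2[where f = f]; erule knownD)

lemma angle_cong: "(\<And>s. 0 \<le> s \<Longrightarrow> s \<le> t \<Longrightarrow> c s = c' s) \<Longrightarrow> 0 \<le> t \<Longrightarrow> angle \<sigma> c t = angle \<sigma> c' t"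
  unfolding angle_def by (rule sol_cong) auto

lemma known_angle[intro, simp]: "0 \<le> s \<Longrightarrow> s \<le> a \<Longrightarrow> known a (\<lambda>c. angle \<sigma> c s)"
  by (rule knownI) (auto intro: angle_cong)

lemma known_memory[intro, simp]: "s \<le> a \<Longrightarrow> known a (\<lambda>c. memory \<sigma> c s)"
  unfolding memory_def by (rule knownI) (auto intro!: mem_cong angle_cong)

lemma known_force[intro, simp]: "0 \<le> s \<Longrightarrow> s \<le> a \<Longrightarrow> known a (\<lambda>c. force \<sigma> c s)"
  unfolding force_eq by (rule known_comp2[OF known_angle known_memory, where f = "\<lambda>u v. Im (cis u * cnj v)"])

section \<open>Reflection of the driving path\<close>

definition reflect :: "real \<Rightarrow> (real \<Rightarrow> real) \<Rightarrow> real \<Rightarrow> real" where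
  "reflect a c s = (if s \<le> a then c s else 2 * c a - c s)"

lemma reflect_paths: "c \<in> space paths \<Longrightarrow> 0 \<le> a \<Longrightarrow> reflect a c \<in> space paths"
proof -
  assume c: "c \<in> space paths" and a: "0 \<le> a"
  have "continuous_on ({0..a} \<union> {a..}) (\<lambda>s. if s \<le> a then c s else 2 * c a - c s)"
  proof (rule continuous_on_If)
    show "continuous_on {a..} (\<lambda>s. 2 * c a - c s)"
      using c a unfolding space_paths by (auto intro!: continuous_intros intro: continuous_on_subset)
  qed (use c continuous_on_path[OF c] in auto)
  moreover have "{0..a} \<union> {a..} = {0..}" using a by auto
  ultimately show ?thesis by (simp add: space_paths reflect_def[abs_def])
qed

lemma measurable_reflect[measurable]: "0 \<le> a \<Longrightarrow> reflect a \<in> measurable paths paths"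
proof (rule measurable_pathsI)
  show "(\<lambda>c. reflect a c t) \<in> borel_measurable paths" for t
    unfolding reflect_def by measurable
qed (use reflect_paths in \<open>auto simp: space_paths\<close>)

lemma known_reflect: "known a g \<Longrightarrow> g (reflect a c) = g c"
  by (erule knownD) (simp add: reflect_def)

text \<open>With \<open>S = stab_const T T\<close>, solution and mirror image differ by at most
  \<open>S * d\<close>, where \<open>d\<close> is the distance of their memories at the moment of
  reflection. In the drift this counts twice with a factor \<open>T\<close>, besides
  \<open>d\<close> itself, and \<open>d\<close> is twice the size of the drift at that
  moment.\<close>

definition reflect_const :: "real \<Rightarrow> real" where
  "reflect_const T = 2 * (2 * stab_const T T * T + 1)"

text \<open>The reflected noise drives the mirror image of the solution from the moment \<open>a\<close> on,
  except that the mirror image starts from the memory \<open>cis (2 * x a) * cnj z\<close>, which is at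
  distance \<open>2 * \<bar>force \<sigma> c a\<bar>\<close> from the actual memory \<open>z\<close>.\<close>

lemma force_reflect:
  assumes c: "c \<in> space paths" and a: "0 \<le> a" "a \<le> t" "t \<le> T"
  shows "\<bar>force \<sigma> (reflect a c) t + force \<sigma> c t\<bar> \<le> reflect_const T * \<bar>force \<sigma> c a\<bar>"
proof -
  define c' where "c' = reflect a c"
  have c': "c' \<in> space paths" using reflect_paths[OF c a(1)] by (simp add: c'_def)
  define x x' where "x = angle \<sigma> c" and "x' = angle \<sigma> c'"
  define z where "z = memory \<sigma> c a"
  \<comment> \<open>The reflected path drives \<open>x'\<close>. The image \<open>y\<close> of
    \<open>x'\<close> under the reflection that fixes the angle \<open>x a\<close> is driven by the
    original path and has initial memory \<open>z'\<close>, so \<open>x\<close> and \<open>y\<close>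
    satisfy the same equation up to the initial memory.\<close>
  define y where "y s = 2 * x a - x' s" for s
  define z' where "z' = cis (2 * x a) * cnj z"
  have xa: "x' a = x a"
    unfolding x_def x'_def c'_def using known_reflect[of a "\<lambda>c. angle \<sigma> c a" c] a by simp
  have za: "memory \<sigma> c' a = z"
    unfolding z_def c'_def using known_reflect[of a "\<lambda>c. memory \<sigma> c a" c] a by simp
  have cx: "continuous_on {0..T} x" "continuous_on {a..T} x" "continuous_on {0..T} x'" "continuous_on {a..T} x'"
    unfolding x_def x'_def using c c' a by (auto intro!: continuous_on_angle)
  have cy: "continuous_on {a..T} y" unfolding y_def by (intro continuous_intros cx)
  have Dc: "force \<sigma> c s = drift a z x s" if "s \<in> {a..T}" for s
    unfolding force_def x_def z_def memory_def
    by (rule drift_restart[of 0 T]) (use that a c in \<open>auto intro!: continuous_on_angle\<close>)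
  have Dc': "force \<sigma> c' s = drift a z x' s" if "s \<in> {a..T}" for s
    unfolding force_def x'_def za[symmetric] memory_def
    by (rule drift_restart[of 0 T]) (use that a c' in \<open>auto intro!: continuous_on_angle\<close>)
  have mem_y: "mem a z' y s = cis (2 * x a) * cnj (mem a z x' s)" if "s \<in> {a..T}" for s
  proof -
    have int: "(\<lambda>r. cis (x' r)) integrable_on {a..s}"
      by (intro integrable_continuous_interval continuous_intros continuous_on_subset[OF cx(4)]) (use that in auto)
    have "((\<lambda>r. cis (2 * x a) * cnj (cis (x' r))) has_integral
      cis (2 * x a) * cnj (integral {a..s} (\<lambda>r. cis (x' r)))) {a..s}"
      by (intro has_integral_mult_right) (use has_integral_linear[OF integrable_integral[OF int] bounded_linear_cnj] in \<open>simp add: o_def\<close>)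
    moreover have "cis (2 * x a) * cnj (cis (x' r)) = cis (y r)" for r
      by (simp add: y_def cis_cnj cis_mult)
    ultimately show ?thesis
      by (simp add: mem_def integral_unique z'_def algebra_simps)
  qed
  \<comment> \<open>A reflection reverses orientation, so the imaginary part changes its
    sign.\<close>
  have drift_y: "drift a z' y s = - drift a z x' s" if "s \<in> {a..T}" for s
  proof -
    have "cis (y s) * cnj (mem a z' y s) = (cis (y s) * cis (- (2 * x a))) * mem a z x' s"
      by (simp add: mem_y[OF that] cis_cnj mult_ac)
    also have "\<dots> = cnj (cis (x' s) * cnj (mem a z x' s))"
      by (simp add: cis_mult y_def cis_cnj)
    finally show ?thesis by (simp add: drift_def)
  qed
  define g where "g s = x a + \<sigma> * (c s - c a)" for s
  have xeq: "x s = g s + integral {a..s} (drift a z x)" if s: "s \<in> {a..T}" for s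
  proof -
    have "integral {a..s} (force \<sigma> c) = integral {a..s} (drift a z x)"
      by (rule integral_cong) (use s Dc in auto)
    then show ?thesis using angle_restart[OF c a(1), of s \<sigma>] s by (simp add: x_def g_def)
  qed
  have yeq: "y s = g s + integral {a..s} (drift a z' y)" if s: "s \<in> {a..T}" for s
  proof -
    have "integral {a..s} (drift a z' y) = integral {a..s} (\<lambda>r. - force \<sigma> c' r)"
      by (rule integral_cong) (use s Dc' drift_y in auto)
    moreover have "c' s - c' a = - (c s - c a)" using s by (auto simp: c'_def reflect_def)
    ultimately have "x' s = x a + \<sigma> * (- (c s - c a)) - integral {a..s} (drift a z' y)"
      using angle_restart[OF c' a(1), of s \<sigma>] s xa by (simp add: x'_def)
    then show ?thesis by (simp add: y_def g_def algebra_simps)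
  qed
  \<comment> \<open>After rotation by \<open>- x a\<close> the position points along the real axis,
    the reflection is complex conjugation, and the drift is minus the imaginary part of the
    memory.\<close>
  have zz': "norm (z - z') = 2 * \<bar>force \<sigma> c a\<bar>"
  proof -
    define u where "u = cis (- x a) * z"
    have "cis (- x a) * (z - z') = u - cnj u"
      by (simp add: u_def z'_def algebra_simps cis_cnj) (simp add: cis_mult mult.assoc[symmetric])
    then have "norm (z - z') = norm (u - cnj u)"
      by (metis mult_1 norm_cis norm_mult)
    also have "\<dots> = 2 * \<bar>Im u\<bar>"
      by (simp add: complex_diff_cnj norm_mult)
    also have "Im u = - force \<sigma> c a"
      by (simp add: u_def force_eq x_def z_def)
    finally show ?thesis by simp
  qed
  define S where "S = stab_const T T"
  have S: "S \<ge> 0" using a by (simp add: S_def stab_const_nonneg)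
  have nz: "norm z \<le> a" unfolding z_def using norm_memory_le[OF c a(1)] .
  define e where "e = S * norm (z - z')"
  have xy: "\<bar>x s - y s\<bar> \<le> e" if s: "s \<in> {a..T}" for s
  proof -
    have "stab_const (norm z) (T - a) \<le> S"
      unfolding S_def using nz a by (intro stab_const_mono) auto
    then show ?thesis
      using flow_stability[OF cx(2) cy xeq yeq s] unfolding e_def
      by (meson mult_right_mono norm_ge_zero order_trans)
  qed
  have e: "e \<ge> 0" using S by (simp add: e_def)
  have t: "t \<in> {a..T}" using a by auto
  have xt: "continuous_on {a..t} x" and yt: "continuous_on {a..t} y"
    using t by (auto intro: continuous_on_subset[OF cx(2)] continuous_on_subset[OF cy])
  have "force \<sigma> c' t + force \<sigma> c t = drift a z x t - drift a z' y t"
    using Dc[OF t] Dc'[OF t] drift_y[OF t] by simp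
  then have "\<bar>force \<sigma> c' t + force \<sigma> c t\<bar>
      \<le> \<bar>x t - y t\<bar> * (norm z + (t - a)) + (norm (z - z') + integral {a..t} (\<lambda>s. \<bar>x s - y s\<bar>))"
    using drift_diff_le[OF xt yt a(2)] by simp
  also have "\<dots> \<le> e * T + (norm (z - z') + e * T)"
  proof (intro add_mono mult_mono order_refl)
    have "norm (integral {a..t} (\<lambda>s. \<bar>x s - y s\<bar>)) \<le> e * (t - a)"
      by (rule integral_bound) (use a xy in \<open>auto intro!: continuous_intros xt yt\<close>)
    also have "\<dots> \<le> e * T" using a e by (intro mult_left_mono) auto
    finally show "integral {a..t} (\<lambda>s. \<bar>x s - y s\<bar>) \<le> e * T" by simp
  qed (use xy[OF t] nz a e in auto)
  also have "\<dots> = reflect_const T * \<bar>force \<sigma> c a\<bar>"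
    by (simp add: reflect_const_def e_def S_def zz' algebra_simps)
  finally show ?thesis by (simp add: c'_def)
qed

section \<open>Brownian motion on path space\<close>

lemma finite_real_set_enumeration:
  fixes J :: "real set"
  assumes "finite J" "J \<noteq> {}"
  shows "\<exists>(ts :: nat \<Rightarrow> real) n. J = ts ` {..n} \<and> (\<forall>i j. i < j \<longrightarrow> j \<le> n \<longrightarrow> ts i < ts j)"
proof -
  define L where "L = sorted_list_of_set J"
  have L: "set L = J" "sorted_wrt (<) L" "length L = card J"
    using assms by (auto simp: L_def)
  have c: "card J > 0" using assms by (simp add: card_gt_0_iff)
  show ?thesis
  proof (intro exI[of _ "\<lambda>i. L ! i"] exI[of _ "card J - 1"] conjI allI impI)
    have "{..<length L} = {..card J - 1}" using c L(3) by auto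
    then show "J = (!) L ` {..card J - 1}"
      using L(1) by (metis (no_types, lifting) atLeast0LessThan atLeast_upt image_set map_nth set_map)
    show "L ! i < L ! j" if "i < j" "j \<le> card J - 1" for i j
      using sorted_wrt_nth_less[OF L(2) that(1)] that(2) c L(3) by simp
  qed
qed

lemma sum_increments:
  fixes f :: "real \<Rightarrow> real"
  shows "f (ts j) = f (ts 0) + (\<Sum>i<j. f (ts (Suc i)) - f (ts i))"
  using sum_lessThan_telescope[of "\<lambda>i. f (ts i)" j] by simp

locale brownian = prob_space M for M :: "'a measure" and B :: "real \<Rightarrow> 'a \<Rightarrow> real" +
  assumes bm: "brownian_motion M B"
begin

lemma B_measurable[measurable]: "t \<ge> 0 \<Longrightarrow> B t \<in> borel_measurable M"
  and B_0: "\<omega> \<in> space M \<Longrightarrow> B 0 \<omega> = 0"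
  and B_cont: "\<omega> \<in> space M \<Longrightarrow> continuous_on {0..} (\<lambda>t. B t \<omega>)"
  and B_incr: "0 \<le> s \<Longrightarrow> s < t \<Longrightarrow>
    distributed M lborel (\<lambda>\<omega>. B t \<omega> - B s \<omega>) (\<lambda>x. ennreal (normal_density 0 (sqrt (t - s)) x))"
  and B_indep: "0 \<le> ts 0 \<Longrightarrow> (\<And>i. i < n \<Longrightarrow> ts i < ts (Suc i)) \<Longrightarrow>
    indep_vars (\<lambda>_. borel) (\<lambda>i \<omega>. B (ts (Suc i)) \<omega> - B (ts i) \<omega>) {..<n}"
  using bm unfolding brownian_motion_def by blast+

text \<open>\<open>B\<close> is constrained at nonnegative times only; clamping the time makes every
  coordinate of the path a random variable.\<close>

definition bpath :: "'a \<Rightarrow> real \<Rightarrow> real" where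
  "bpath \<omega> t = B (max 0 t) \<omega>"

lemma bpath_cont: "\<omega> \<in> space M \<Longrightarrow> continuous_on {0..} (bpath \<omega>)"
  using B_cont[of \<omega>] by (rule continuous_on_cong[THEN iffD1, rotated 2]) (auto simp: bpath_def max_def)

lemma bpath_eval_measurable[measurable]: "(\<lambda>\<omega>. bpath \<omega> t) \<in> borel_measurable M"
  unfolding bpath_def by simp

lemma bpath_measurable[measurable]: "bpath \<in> measurable M paths"
  by (rule measurable_pathsI) (auto intro: bpath_cont)

lemma bpath_paths: "\<omega> \<in> space M \<Longrightarrow> bpath \<omega> \<in> space paths"
  by (simp add: space_paths bpath_cont)

text \<open>A generator of the past up to \<open>a\<close>. Constraining values instead of
  increments makes it stable under intersection, because two finite time sets can simply be
  united.\<close>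

definition cylinders :: "real \<Rightarrow> 'a set set" where
  "cylinders a = {{\<omega>\<in>space M. \<forall>s\<in>J. bpath \<omega> s \<in> A s} | J A. finite J \<and> J \<subseteq> {0..a} \<and> (\<forall>s. A s \<in> sets borel)}"

lemma Int_stable_cylinders: "Int_stable (cylinders a)"
proof (rule Int_stableI)
  fix C C' assume "C \<in> cylinders a" "C' \<in> cylinders a"
  then obtain J A J' A' where
    C: "C = {\<omega>\<in>space M. \<forall>s\<in>J. bpath \<omega> s \<in> A s}" "finite J" "J \<subseteq> {0..a}" "\<forall>s. A s \<in> sets borel" and
    C': "C' = {\<omega>\<in>space M. \<forall>s\<in>J'. bpath \<omega> s \<in> A' s}" "finite J'" "J' \<subseteq> {0..a}" "\<forall>s. A' s \<in> sets borel"
    unfolding cylinders_def by blast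
  define A'' where "A'' s = (if s \<in> J then A s else UNIV) \<inter> (if s \<in> J' then A' s else UNIV)" for s
  have "C \<inter> C' = {\<omega>\<in>space M. \<forall>s\<in>J \<union> J'. bpath \<omega> s \<in> A'' s}"
    unfolding C(1) C'(1) A''_def by auto
  moreover have "\<forall>s. A'' s \<in> sets borel" using C(4) C'(4) by (auto simp: A''_def)
  ultimately show "C \<inter> C' \<in> cylinders a"
    unfolding cylinders_def using C(2,3) C'(2,3)
    by (intro CollectI exI[of _ "J \<union> J'"] exI[of _ A'']) auto
qed

text \<open>The values at the times of the cylinder are partial sums of increments over a partition
  of \<open>{0..a}\<close>; appending \<open>t\<close> to the partition adds one more independent
  increment, the one in question.\<close>

lemma cylinder_increment_indep:
  assumes a: "0 \<le> a" "a < t" and C: "C \<in> cylinders a" and S: "S \<in> sets borel"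
  shows "C \<in> events"
    and "prob (C \<inter> ((\<lambda>\<omega>. B t \<omega> - B a \<omega>) -` S \<inter> space M)) = prob C * prob ((\<lambda>\<omega>. B t \<omega> - B a \<omega>) -` S \<inter> space M)"
proof -
  obtain J A where C: "C = {\<omega>\<in>space M. \<forall>s\<in>J. bpath \<omega> s \<in> A s}" "finite J" "J \<subseteq> {0..a}" "\<And>s. A s \<in> sets borel"
    using C unfolding cylinders_def by blast
  have [measurable]: "A s \<in> sets borel" for s by (rule C(4))
  show "C \<in> events" unfolding C(1) using C(2) by measurable
  \<comment> \<open>Including 0 and \<open>a\<close> makes the partition start where the path
    vanishes and end where the new increment begins.\<close>
  define K where "K = J \<union> {0, a}"
  have "finite K" "K \<noteq> {}" using C(2) by (auto simp: K_def)
  from finite_real_set_enumeration[OF this] obtain ts :: "nat \<Rightarrow> real" and n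
    where ts': "K = ts ` {..n} \<and> (\<forall>i j. i < j \<longrightarrow> j \<le> n \<longrightarrow> ts i < ts j)" by (elim exE)
  then have ts: "K = ts ` {..n}" "\<And>i j. i < j \<Longrightarrow> j \<le> n \<Longrightarrow> ts i < ts j" by blast+
  have mono: "ts i \<le> ts j" if "i \<le> j" "j \<le> n" for i j using ts(2)[of i j] that by (cases "i = j") auto
  have K: "K \<subseteq> {0..a}" "0 \<in> K" "a \<in> K" using C a by (auto simp: K_def)
  have ts0: "ts 0 = 0"
  proof -
    obtain i where i: "i \<le> n" "ts i = 0" using K(2) ts(1) by (auto simp: image_iff)
    moreover have "ts 0 \<in> K" using ts(1) by auto
    ultimately show ?thesis using K(1) mono[of 0 i] by auto
  qed
  have tsn: "ts n = a"
  proof -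
    obtain i where i: "i \<le> n" "ts i = a" using K(3) ts(1) by (auto simp: image_iff)
    moreover have "ts n \<in> K" using ts(1) by auto
    ultimately show ?thesis using K(1) mono[of i n] by auto
  qed
  define us where "us i = (if i \<le> n then ts i else t)" for i
  define \<xi> where "\<xi> i \<omega> = B (us (Suc i)) \<omega> - B (us i) \<omega>" for i \<omega>
  have "indep_vars (\<lambda>_. borel) \<xi> {..<Suc n}"
    unfolding \<xi>_def
  proof (rule B_indep)
    show "us i < us (Suc i)" if "i < Suc n" for i
      using that ts(2)[of i "Suc i"] tsn a by (cases "i = n") (auto simp: us_def)
  qed (simp add: us_def ts0)
  from indep_var_restrict[OF this, of "{..<n}" "{n}"]
  have ind: "indep_var (PiM {..<n} (\<lambda>_. borel)) (\<lambda>\<omega>. restrict (\<lambda>i. \<xi> i \<omega>) {..<n})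
     (PiM {n} (\<lambda>_. borel)) (\<lambda>\<omega>. restrict (\<lambda>i. \<xi> i \<omega>) {n})" by auto
  have "\<exists>i\<le>n. ts i = s" if "s \<in> J" for s
  proof -
    have "s \<in> ts ` {..n}" using that ts(1) K_def by blast
    then show ?thesis by auto
  qed
  then obtain idx where idx: "\<And>s. s \<in> J \<Longrightarrow> idx s \<le> n \<and> ts (idx s) = s" by metis
  define E where "E = {x \<in> space (PiM {..<n} (\<lambda>_. borel)). \<forall>s\<in>J. (\<Sum>i<idx s. x i) \<in> A s}"
  have pred: "(\<lambda>x. \<Sum>i<idx s. x i) \<in> borel_measurable (PiM {..<n} (\<lambda>_. borel :: real measure))" if "s \<in> J" for s
    using idx[OF that] by (intro borel_measurable_sum measurable_component_singleton) auto
  have E: "E \<in> sets (PiM {..<n} (\<lambda>_. borel))"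
    unfolding E_def by (intro sets.sets_Collect_finite_All C(2) measurable_sets_Collect[OF pred]) auto
  define F where "F = {x \<in> space (PiM {n} (\<lambda>_. borel :: real measure)). x n \<in> S}"
  have F: "F \<in> sets (PiM {n} (\<lambda>_. borel))"
    unfolding F_def by (intro measurable_sets_Collect[OF measurable_component_singleton]) (use S in auto)
  have Bs: "bpath \<omega> s = (\<Sum>i<idx s. \<xi> i \<omega>)" if s: "s \<in> J" and \<omega>: "\<omega> \<in> space M" for s \<omega>
  proof -
    have "s \<ge> 0" using C(3) s by auto
    then have "bpath \<omega> s = B (ts (idx s)) \<omega>" using idx[OF s] by (simp add: bpath_def)
    also have "\<dots> = B (ts 0) \<omega> + (\<Sum>i<idx s. B (ts (Suc i)) \<omega> - B (ts i) \<omega>)"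
      by (rule sum_increments)
    also have "(\<Sum>i<idx s. B (ts (Suc i)) \<omega> - B (ts i) \<omega>) = (\<Sum>i<idx s. \<xi> i \<omega>)"
      using idx[OF s] by (intro sum.cong) (auto simp: \<xi>_def us_def)
    finally show ?thesis by (simp add: ts0 B_0[OF \<omega>])
  qed
  have pre: "C = (\<lambda>\<omega>. restrict (\<lambda>i. \<xi> i \<omega>) {..<n}) -` E \<inter> space M"
  proof -
    have "(\<Sum>i<idx s. restrict (\<lambda>i. \<xi> i \<omega>) {..<n} i) = (\<Sum>i<idx s. \<xi> i \<omega>)" if "s \<in> J" for s \<omega>
      using idx[OF that] by (intro sum.cong) auto
    then show ?thesis
      unfolding C(1) E_def using Bs by (auto simp: space_PiM)
  qed
  have post: "(\<lambda>\<omega>. B t \<omega> - B a \<omega>) -` S \<inter> space M = (\<lambda>\<omega>. restrict (\<lambda>i. \<xi> i \<omega>) {n}) -` F \<inter> space M"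
    unfolding F_def by (auto simp: space_PiM \<xi>_def us_def tsn)
  show "prob (C \<inter> ((\<lambda>\<omega>. B t \<omega> - B a \<omega>) -` S \<inter> space M)) = prob C * prob ((\<lambda>\<omega>. B t \<omega> - B a \<omega>) -` S \<inter> space M)"
  proof -
    have "(\<lambda>\<omega>. (restrict (\<lambda>i. \<xi> i \<omega>) {..<n}, restrict (\<lambda>i. \<xi> i \<omega>) {n})) -` (E \<times> F) \<inter> space M
        = C \<inter> ((\<lambda>\<omega>. B t \<omega> - B a \<omega>) -` S \<inter> space M)"
      unfolding pre post by auto
    then show ?thesis using indep_varD[OF ind E F] unfolding pre[symmetric] post[symmetric] by simp
  qed
qed

text \<open>The path stopped at \<open>a\<close> is measurable with respect to the past by
  construction, and a \<open>known\<close> functional cannot distinguish it from the path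
  itself.\<close>

lemma known_bpath_measurable:
  assumes a: "0 \<le> a" and g: "known a g" "g \<in> borel_measurable paths" and S: "S \<in> sets borel"
  shows "(\<lambda>\<omega>. g (bpath \<omega>)) -` S \<inter> space M \<in> sigma_sets (space M) (cylinders a)"
proof -
  define N where "N = sigma (space M) (cylinders a)"
  have sub: "cylinders a \<subseteq> Pow (space M)" by (auto simp: cylinders_def)
  have spN: "space N = space M" and seN: "sets N = sigma_sets (space M) (cylinders a)"
    using sub by (simp_all add: N_def)
  define stop where "stop \<omega> s = bpath \<omega> (max 0 (min s a))" for \<omega> s
  have "stop \<in> measurable N paths"
  proof (rule measurable_pathsI)
    fix s
    show "(\<lambda>\<omega>. stop \<omega> s) \<in> borel_measurable N"
    proof (rule measurableI)
      fix A :: "real set" assume A: "A \<in> sets borel"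
      have "(\<lambda>\<omega>. stop \<omega> s) -` A \<inter> space N = {\<omega>\<in>space M. \<forall>r\<in>{max 0 (min s a)}. bpath \<omega> r \<in> A}"
        by (auto simp: spN stop_def)
      also have "\<dots> \<in> cylinders a"
        unfolding cylinders_def using a A by (intro CollectI exI[of _ "{max 0 (min s a)}"] exI[of _ "\<lambda>_. A"]) auto
      finally show "(\<lambda>\<omega>. stop \<omega> s) -` A \<inter> space N \<in> sets N" unfolding seN by (rule sigma_sets.Basic)
    qed simp
  next
    fix \<omega> assume "\<omega> \<in> space N"
    then have "continuous_on {0..} (bpath \<omega>)" by (simp add: spN bpath_cont)
    then show "continuous_on {0..} (stop \<omega>)"
      unfolding stop_def by (rule continuous_on_compose2) (auto intro!: continuous_intros)
  qed
  then have "(\<lambda>\<omega>. g (stop \<omega>)) \<in> borel_measurable N" using g(2) by measurable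
  moreover have "g (stop \<omega>) = g (bpath \<omega>)" for \<omega>
    by (rule knownD[OF g(1)]) (simp add: stop_def)
  ultimately have "(\<lambda>\<omega>. g (bpath \<omega>)) \<in> borel_measurable N" by simp
  from measurable_sets[OF this S] show ?thesis by (simp add: seN spN)
qed

lemma known_indep_increment:
  fixes g :: "(real \<Rightarrow> real) \<Rightarrow> real"
  assumes a: "0 \<le> a" "a < t" and g: "known a g" "g \<in> borel_measurable paths"
  shows "indep_var borel (\<lambda>\<omega>. g (bpath \<omega>)) borel (\<lambda>\<omega>. B t \<omega> - B a \<omega>)"
proof -
  let ?Y = "\<lambda>\<omega>. B t \<omega> - B a \<omega>"
  let ?H = "{?Y -` S \<inter> space M | S. S \<in> sets borel}"
  have m: "(\<lambda>\<omega>. g (bpath \<omega>)) \<in> borel_measurable M" "?Y \<in> borel_measurable M"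
    using g(2) a by auto
  have "indep_set (cylinders a) ?H"
    unfolding indep_sets2_eq
    using cylinder_increment_indep[OF a] measurable_sets[OF m(2)] by blast
  moreover have "Int_stable ?H"
  proof (rule Int_stableI)
    fix A A' assume "A \<in> ?H" "A' \<in> ?H"
    then obtain S S' where "A = ?Y -` S \<inter> space M" "A' = ?Y -` S' \<inter> space M" "S \<in> sets borel" "S' \<in> sets borel" by blast
    then show "A \<inter> A' \<in> ?H" by (intro CollectI exI[of _ "S \<inter> S'"]) auto
  qed
  ultimately have "indep_set (sigma_sets (space M) (cylinders a)) (sigma_sets (space M) ?H)"
    by (intro indep_set_sigma_sets Int_stable_cylinders)
  moreover have "sigma_sets (space M) {(\<lambda>\<omega>. g (bpath \<omega>)) -` S \<inter> space M |S. S \<in> sets borel} \<subseteq> sigma_sets (space M) (cylinders a)"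
    by (intro sigma_sets_mono) (use known_bpath_measurable[OF a(1) g] in blast)
  ultimately have "indep_set (sigma_sets (space M) {(\<lambda>\<omega>. g (bpath \<omega>)) -` S \<inter> space M |S. S \<in> sets borel})
      (sigma_sets (space M) ?H)"
    unfolding indep_sets2_eq by blast
  then show ?thesis unfolding indep_var_eq using m by blast
qed

lemma expectation_known_times_increment:
  fixes g :: "(real \<Rightarrow> real) \<Rightarrow> real" and \<phi> :: "real \<Rightarrow> real"
  assumes a: "0 \<le> a" "a < t" and g: "known a g" "g \<in> borel_measurable paths"
    and bd: "\<And>c. c \<in> space paths \<Longrightarrow> \<bar>g c\<bar> \<le> K"
    and \<phi>[measurable]: "\<phi> \<in> borel_measurable borel"
    and int: "integrable lborel (\<lambda>x. normal_density 0 (sqrt (t - a)) x * \<phi> x)"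
  shows "integrable M (\<lambda>\<omega>. g (bpath \<omega>) * \<phi> (bpath \<omega> t - bpath \<omega> a))"
    and "expectation (\<lambda>\<omega>. g (bpath \<omega>) * \<phi> (bpath \<omega> t - bpath \<omega> a))
      = expectation (\<lambda>\<omega>. g (bpath \<omega>)) * (\<integral>x. normal_density 0 (sqrt (t - a)) x * \<phi> x \<partial>lborel)"
proof -
  let ?Y = "\<lambda>\<omega>. B t \<omega> - B a \<omega>"
  have Y: "bpath \<omega> t - bpath \<omega> a = ?Y \<omega>" for \<omega> using a by (simp add: bpath_def)
  have ind: "indep_var borel (\<lambda>\<omega>. g (bpath \<omega>)) borel (\<lambda>\<omega>. \<phi> (?Y \<omega>))"
    using indep_var_compose[OF known_indep_increment[OF a g] measurable_ident \<phi>] by (simp add: o_def)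
  have i1: "integrable M (\<lambda>\<omega>. g (bpath \<omega>))"
    by (rule integrable_const_bound[of _ K]) (use bd bpath_paths g(2) in auto)
  have i2: "integrable M (\<lambda>\<omega>. \<phi> (?Y \<omega>))"
    using distributed_integrable[OF B_incr[OF a], of \<phi>] int by simp
  have e2: "expectation (\<lambda>\<omega>. \<phi> (?Y \<omega>)) = (\<integral>x. normal_density 0 (sqrt (t - a)) x * \<phi> x \<partial>lborel)"
    using distributed_integral[OF B_incr[OF a], of \<phi>] by simp
  show "integrable M (\<lambda>\<omega>. g (bpath \<omega>) * \<phi> (bpath \<omega> t - bpath \<omega> a))"
    unfolding Y by (rule indep_var_integrable[OF ind i1 i2])
  show "expectation (\<lambda>\<omega>. g (bpath \<omega>) * \<phi> (bpath \<omega> t - bpath \<omega> a))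
      = expectation (\<lambda>\<omega>. g (bpath \<omega>)) * (\<integral>x. normal_density 0 (sqrt (t - a)) x * \<phi> x \<partial>lborel)"
    unfolding Y e2[symmetric] by (rule indep_var_lebesgue_integral[OF ind i1 i2])
qed

section \<open>Invariance of Brownian motion under reflection\<close>

lemma distr_neg_increment:
  assumes a: "0 \<le> s" "s < t"
  shows "distr M borel (\<lambda>\<omega>. - (B t \<omega> - B s \<omega>)) = distr M borel (\<lambda>\<omega>. B t \<omega> - B s \<omega>)"
proof -
  let ?Y = "\<lambda>\<omega>. B t \<omega> - B s \<omega>" and ?d = "\<lambda>x. ennreal (normal_density 0 (sqrt (t - s)) x)"
  have s: "0 < sqrt (t - s)" using a(2) by simp
  have "distributed M lborel (\<lambda>\<omega>. - ?Y \<omega>) ?d"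
    using normal_density_affine[OF B_incr[OF a] s, of "-1" 0] by (simp only: add_0 mult_minus1 mult_zero_right abs_neg_one mult_1 simp_thms neg_equal_0_iff_equal zero_neq_one one_neq_zero)
  from distributed_distr_eq_density[OF this] distributed_distr_eq_density[OF B_incr[OF a]]
  have "distr M lborel (\<lambda>\<omega>. - ?Y \<omega>) = distr M lborel ?Y" by (rule trans[OF _ sym])
  then show ?thesis
    unfolding distr_def by (simp only: sets_lborel space_lborel space_borel)
qed

text \<open>Reflection changes the sign of the increments after \<open>a\<close>. These are
  independent and symmetric, so the vector of increments keeps its law, and both paths are recovered
  from their increments by the same partial sums.\<close>

lemma fdd_reflect:
  assumes a: "0 \<le> a" and J: "finite J" and A: "\<And>s. s \<in> J \<Longrightarrow> A s \<in> sets borel"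
  shows "prob {\<omega>\<in>space M. \<forall>s\<in>J. bpath \<omega> s \<in> A s} = prob {\<omega>\<in>space M. \<forall>s\<in>J. reflect a (bpath \<omega>) s \<in> A s}"
proof -
  \<comment> \<open>Neither path changes when negative times are moved to 0; \<open>a\<close> is
    included so that no increment straddles the reflection time, and \<open>a + 1\<close> so that
    there is at least one increment.\<close>
  define K where "K = max 0 ` J \<union> {0, a, a + 1}"
  have "finite K" "K \<noteq> {}" using J by (auto simp: K_def)
  from finite_real_set_enumeration[OF this] obtain ts :: "nat \<Rightarrow> real" and n
    where ts': "K = ts ` {..n} \<and> (\<forall>i j. i < j \<longrightarrow> j \<le> n \<longrightarrow> ts i < ts j)" by (elim exE)
  then have ts: "K = ts ` {..n}" "\<And>i j. i < j \<Longrightarrow> j \<le> n \<Longrightarrow> ts i < ts j" by blast+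
  have mono: "ts i \<le> ts j" if "i \<le> j" "j \<le> n" for i j using ts(2)[of i j] that by (cases "i = j") auto
  have K: "K \<subseteq> {0..}" "0 \<in> K" "a \<in> K" "a + 1 \<in> K" using a by (auto simp: K_def)
  have ts0: "ts 0 = 0"
  proof -
    obtain i where i: "i \<le> n" "ts i = 0" using K(2) ts(1) by (auto simp: image_iff)
    moreover have "ts 0 \<in> K" using ts(1) by auto
    ultimately show ?thesis using K(1) mono[of 0 i] by auto
  qed
  have tpos: "ts i \<ge> 0" if "i \<le> n" for i using mono[of 0 i] that ts0 by simp
  obtain k where k: "k \<le> n" "ts k = a" using K(3) ts(1) by (auto simp: image_iff)
  obtain k' where k': "k' \<le> n" "ts k' = a + 1" using K(4) ts(1) by (auto simp: image_iff)
  have n: "n > 0" using k k' by (cases n) auto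
  define \<xi> where "\<xi> i \<omega> = B (ts (Suc i)) \<omega> - B (ts i) \<omega>" for i \<omega>
  define \<zeta> where "\<zeta> i \<omega> = (if i < k then \<xi> i \<omega> else - \<xi> i \<omega>)" for i \<omega>
  have rv[measurable]: "\<xi> i \<in> borel_measurable M" "\<zeta> i \<in> borel_measurable M" if "i < n" for i
    using that tpos[of i] tpos[of "Suc i"] unfolding \<xi>_def \<zeta>_def by auto
  have ind: "indep_vars (\<lambda>_. borel) \<xi> {..<n}"
    unfolding \<xi>_def by (rule B_indep) (use ts0 ts(2) in auto)
  have ind': "indep_vars (\<lambda>_. borel) \<zeta> {..<n}"
  proof -
    have "indep_vars (\<lambda>_. borel) (\<lambda>i \<omega>. (if i < k then (\<lambda>x. x) else uminus) (\<xi> i \<omega>)) {..<n}"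
      by (rule indep_vars_compose2[OF ind]) auto
    then show ?thesis by (rule indep_vars_cong[THEN iffD1, rotated -1]) (auto simp: \<zeta>_def)
  qed
  have dist: "distr M borel (\<zeta> i) = distr M borel (\<xi> i)" if "i < n" for i
    using distr_neg_increment[of "ts i" "ts (Suc i)"] that ts(2)[of i "Suc i"] tpos[of i]
    by (cases "i < k") (auto simp: \<zeta>_def[abs_def] \<xi>_def[abs_def])
  let ?P = "PiM {..<n} (\<lambda>_. borel :: real measure)"
  have "distr M ?P (\<lambda>\<omega>. \<lambda>i\<in>{..<n}. \<xi> i \<omega>) = PiM {..<n} (\<lambda>i. distr M borel (\<xi> i))"
    by (rule indep_vars_iff_distr_eq_PiM'[THEN iffD1, OF _ _ ind]) (use n rv in auto)
  also have "\<dots> = PiM {..<n} (\<lambda>i. distr M borel (\<zeta> i))"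
    by (rule PiM_cong) (use dist in auto)
  also have "\<dots> = distr M ?P (\<lambda>\<omega>. \<lambda>i\<in>{..<n}. \<zeta> i \<omega>)"
    by (rule indep_vars_iff_distr_eq_PiM'[THEN iffD1, OF _ _ ind', symmetric]) (use n rv in auto)
  finally have deq: "distr M ?P (\<lambda>\<omega>. \<lambda>i\<in>{..<n}. \<xi> i \<omega>) = distr M ?P (\<lambda>\<omega>. \<lambda>i\<in>{..<n}. \<zeta> i \<omega>)" .
  have "\<exists>i\<le>n. ts i = max 0 s" if "s \<in> J" for s
  proof -
    have "max 0 s \<in> ts ` {..n}" using that ts(1) K_def by blast
    then show ?thesis by force
  qed
  then obtain idx where idx: "\<And>s. s \<in> J \<Longrightarrow> idx s \<le> n \<and> ts (idx s) = max 0 s" by metis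
  define E where "E = {x \<in> space ?P. \<forall>s\<in>J. (\<Sum>i<idx s. x i) \<in> A s}"
  have pred: "(\<lambda>x. \<Sum>i<idx s. x i) \<in> borel_measurable ?P" if "s \<in> J" for s
    using idx[OF that] by (intro borel_measurable_sum measurable_component_singleton) auto
  have E: "E \<in> sets ?P"
    unfolding E_def by (intro sets.sets_Collect_finite_All J measurable_sets_Collect[OF pred]) (use A in auto)
  have bneg: "bpath \<omega> s = bpath \<omega> (max 0 s)" for \<omega> s by (simp add: bpath_def)
  have rneg: "reflect a (bpath \<omega>) s = reflect a (bpath \<omega>) (max 0 s)" for \<omega> s
    using a by (auto simp: reflect_def bpath_def max_def)
  have S1: "bpath \<omega> s = (\<Sum>i<idx s. (\<lambda>i\<in>{..<n}. \<xi> i \<omega>) i)" if s: "s \<in> J" and \<omega>: "\<omega> \<in> space M" for s \<omega>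
  proof -
    have "bpath \<omega> s = bpath \<omega> (ts (idx s))" using idx[OF s] bneg[of \<omega> s] by simp
    also have "\<dots> = bpath \<omega> (ts 0) + (\<Sum>i<idx s. bpath \<omega> (ts (Suc i)) - bpath \<omega> (ts i))"
      by (rule sum_increments)
    also have "(\<Sum>i<idx s. bpath \<omega> (ts (Suc i)) - bpath \<omega> (ts i)) = (\<Sum>i<idx s. (\<lambda>i\<in>{..<n}. \<xi> i \<omega>) i)"
      using idx[OF s] tpos by (intro sum.cong) (auto simp: \<xi>_def bpath_def)
    finally show ?thesis by (simp add: ts0 bpath_def B_0[OF \<omega>])
  qed
  have S2: "reflect a (bpath \<omega>) s = (\<Sum>i<idx s. (\<lambda>i\<in>{..<n}. \<zeta> i \<omega>) i)" if s: "s \<in> J" and \<omega>: "\<omega> \<in> space M" for s \<omega>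
  proof -
    let ?r = "reflect a (bpath \<omega>)"
    have "?r s = ?r (ts (idx s))" using idx[OF s] rneg[of \<omega> s] by simp
    also have "\<dots> = ?r (ts 0) + (\<Sum>i<idx s. ?r (ts (Suc i)) - ?r (ts i))"
      by (rule sum_increments)
    also have "(\<Sum>i<idx s. ?r (ts (Suc i)) - ?r (ts i)) = (\<Sum>i<idx s. (\<lambda>i\<in>{..<n}. \<zeta> i \<omega>) i)"
    proof (intro sum.cong refl)
      fix i assume "i \<in> {..<idx s}"
      then have i: "i < n" using idx[OF s] by auto
      have pos: "ts i \<ge> 0" "ts (Suc i) \<ge> 0" using tpos i by auto
      show "?r (ts (Suc i)) - ?r (ts i) = (\<lambda>i\<in>{..<n}. \<zeta> i \<omega>) i"
      proof (cases "i < k")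
        case True
        then have "ts (Suc i) \<le> a" "ts i \<le> a" using mono[of "Suc i" k] mono[of i k] k by auto
        then show ?thesis using True i pos by (simp add: reflect_def \<zeta>_def \<xi>_def bpath_def)
      next
        case False
        have "ts i \<ge> a" using mono[of k i] k i False by auto
        moreover have "ts (Suc i) > a" using ts(2)[of k "Suc i"] k i False by auto
        ultimately show ?thesis using False i pos by (auto simp: reflect_def \<zeta>_def \<xi>_def bpath_def)
      qed
    qed
    moreover have "?r (ts 0) = 0" using a by (simp add: ts0 reflect_def bpath_def B_0[OF \<omega>])
    ultimately show ?thesis by simp
  qed
  have "prob {\<omega>\<in>space M. \<forall>s\<in>J. bpath \<omega> s \<in> A s} = measure (distr M ?P (\<lambda>\<omega>. \<lambda>i\<in>{..<n}. \<xi> i \<omega>)) E"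
    by (subst measure_distr[OF _ E]) (auto simp: E_def S1 space_PiM intro!: measurable_restrict rv arg_cong[where f = prob])
  also have "\<dots> = prob {\<omega>\<in>space M. \<forall>s\<in>J. reflect a (bpath \<omega>) s \<in> A s}"
    unfolding deq
    by (subst measure_distr[OF _ E]) (auto simp: E_def S2 space_PiM intro!: measurable_restrict rv arg_cong[where f = prob])
  finally show ?thesis .
qed

lemma distr_reflect:
  assumes a: "0 \<le> a"
  shows "distr M paths (\<lambda>\<omega>. reflect a (bpath \<omega>)) = distr M paths bpath"
proof -
  let ?P = "PiM UNIV (\<lambda>_. borel) :: (real \<Rightarrow> real) measure"
  have id: "(\<lambda>c. c) \<in> measurable paths ?P"
    unfolding paths_def by (rule measurable_restrict_space1) simp
  have r: "(\<lambda>\<omega>. reflect a (bpath \<omega>)) \<in> measurable M paths" using a by simp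
  have mP: "bpath \<in> measurable M ?P" "(\<lambda>\<omega>. reflect a (bpath \<omega>)) \<in> measurable M ?P"
    using measurable_compose[OF bpath_measurable id] measurable_compose[OF r id] by auto
  have eq: "distr M ?P (\<lambda>\<omega>. reflect a (bpath \<omega>)) = distr M ?P bpath"
  proof (rule measure_eqI_PiM_infinite)
    show "finite_measure (distr M ?P (\<lambda>\<omega>. reflect a (bpath \<omega>)))"
      by (intro prob_space.finite_measure prob_space_distr mP)
    fix A :: "real \<Rightarrow> real set" and J :: "real set"
    assume J: "finite J" "J \<subseteq> UNIV" and A: "\<And>i. i \<in> J \<Longrightarrow> A i \<in> sets borel"
    have emb: "prod_emb UNIV (\<lambda>_. borel) J (Pi\<^sub>E J A) \<in> sets ?P"
      using J A by (intro sets_PiM_I) auto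
    have pre: "f -` prod_emb UNIV (\<lambda>_. borel) J (Pi\<^sub>E J A) \<inter> space M = {\<omega>\<in>space M. \<forall>s\<in>J. f \<omega> s \<in> A s}"
      for f :: "'a \<Rightarrow> real \<Rightarrow> real"
      by (auto simp: prod_emb_def PiE_iff)
    show "emeasure (distr M ?P (\<lambda>\<omega>. reflect a (bpath \<omega>))) (prod_emb UNIV (\<lambda>_. borel) J (Pi\<^sub>E J A))
        = emeasure (distr M ?P bpath) (prod_emb UNIV (\<lambda>_. borel) J (Pi\<^sub>E J A))"
      using fdd_reflect[OF a J(1) A] by (simp add: emeasure_distr mP emb pre emeasure_eq_measure)
  qed simp_all
  show ?thesis
  proof (rule measure_eqI)
    fix S assume "S \<in> sets (distr M paths (\<lambda>\<omega>. reflect a (bpath \<omega>)))"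
    then have S: "S \<in> sets paths" by simp
    then obtain S' where S': "S = {c. continuous_on {0..} c} \<inter> S'" "S' \<in> sets ?P"
      unfolding paths_def by (auto simp: sets_restrict_space)
    \<comment> \<open>A measurable set of paths is the trace of a set from the product space; for
      maps with values in \<open>paths\<close> taking the trace does not affect preimages.\<close>
    have *: "f -` S \<inter> space M = f -` S' \<inter> space M" if "f \<in> measurable M paths" for f
      using measurable_space[OF that] unfolding S'(1) space_paths by auto
    show "emeasure (distr M paths (\<lambda>\<omega>. reflect a (bpath \<omega>))) S = emeasure (distr M paths bpath) S"
      using arg_cong[OF eq, of "\<lambda>m. emeasure m S'"] S S'(2)
      by (simp add: emeasure_distr mP r *[OF r] *[OF bpath_measurable])
  qed simp
qed

end

text \<open>Canonical Brownian motion: the coordinate process on path space.  Of Brownian motion only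
  the independence of a Gaussian increment from the past and the invariance under reflection at
  deterministic times are retained.\<close>

locale wiener = prob_space W for W :: "(real \<Rightarrow> real) measure" +
  assumes sets_W: "sets W = sets paths"
    and distr_W_reflect: "0 \<le> a \<Longrightarrow> distr W paths (reflect a) = W"
    and increment_W: "0 \<le> a \<Longrightarrow> a < t \<Longrightarrow> known a g \<Longrightarrow> g \<in> borel_measurable paths \<Longrightarrow>
        (\<And>c. c \<in> space paths \<Longrightarrow> \<bar>g c\<bar> \<le> K) \<Longrightarrow> \<phi> \<in> borel_measurable borel \<Longrightarrow>
        integrable lborel (\<lambda>x. normal_density 0 (sqrt (t - a)) x * \<phi> x) \<Longrightarrow>
        integrable W (\<lambda>c. g c * \<phi> (c t - c a)) \<and>
        (\<integral>c. g c * \<phi> (c t - c a) \<partial>W) = (\<integral>c. g c \<partial>W) * (\<integral>x. normal_density 0 (sqrt (t - a)) x * \<phi> x \<partial>lborel)"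

lemma (in brownian) wiener_bpath: "wiener (distr M paths bpath)"
proof (intro wiener.intro wiener_axioms.intro)
  show "prob_space (distr M paths bpath)" by (rule prob_space_distr) simp
  show "sets (distr M paths bpath) = sets paths" by simp
  show "distr (distr M paths bpath) paths (reflect a) = distr M paths bpath" if "0 \<le> a" for a
    using that by (subst distr_distr) (simp_all add: o_def distr_reflect)
next
  fix a t K :: real and g :: "(real \<Rightarrow> real) \<Rightarrow> real" and \<phi> :: "real \<Rightarrow> real"
  assume h: "0 \<le> a" "a < t" "known a g" and g[measurable]: "g \<in> borel_measurable paths"
    and bd: "\<And>c. c \<in> space paths \<Longrightarrow> \<bar>g c\<bar> \<le> K" and \<phi>[measurable]: "\<phi> \<in> borel_measurable borel"
    and int: "integrable lborel (\<lambda>x. normal_density 0 (sqrt (t - a)) x * \<phi> x)"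
  have "(\<lambda>c. g c * \<phi> (c t - c a)) \<in> borel_measurable paths" by measurable
  then show "integrable (distr M paths bpath) (\<lambda>c. g c * \<phi> (c t - c a)) \<and>
        (\<integral>c. g c * \<phi> (c t - c a) \<partial>distr M paths bpath)
          = (\<integral>c. g c \<partial>distr M paths bpath) * (\<integral>x. normal_density 0 (sqrt (t - a)) x * \<phi> x \<partial>lborel)"
    using expectation_known_times_increment[OF h g bd \<phi> int]
    by (simp add: integrable_distr_eq integral_distr)
qed

section \<open>Dynkin's formula for functions of the angle\<close>

text \<open>The inequality of arithmetic and geometric means, balanced at the scale
  \<open>sqrt h\<close> of a Brownian increment over time \<open>h\<close>. It bounds odd absolute
  moments by even ones, which have explicit Gaussian values, without losing the order in
  \<open>h\<close>; multiplied by \<open>x^2\<close> it gives the cubic bound below.\<close>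

lemma abs_le_sqrt_mean: "h > 0 \<Longrightarrow> \<bar>x\<bar> \<le> (sqrt h + x^2 / sqrt h) / 2" for x h :: real
proof -
  assume h: "h > 0"
  have "0 \<le> (\<bar>x\<bar> - sqrt h)^2" by simp
  then have "2 * \<bar>x\<bar> * sqrt h \<le> x^2 + sqrt h * sqrt h" using h by (simp add: power2_diff)
  then show ?thesis using h by (simp add: field_simps)
qed

lemma abs_cube_le_sqrt_mean: "h > 0 \<Longrightarrow> \<bar>x\<bar>^3 \<le> (sqrt h * x^2 + x^4 / sqrt h) / 2" for x h :: real
proof -
  assume h: "h > 0"
  have "x^2 * \<bar>x\<bar> \<le> x^2 * ((sqrt h + x^2 / sqrt h) / 2)"
    by (intro mult_left_mono abs_le_sqrt_mean h) simp
  moreover have "x^2 * \<bar>x\<bar> = \<bar>x\<bar>^3" by (simp add: power3_eq_cube power2_eq_square)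
  moreover have "x^2 * ((sqrt h + x^2 / sqrt h) / 2) = (sqrt h * x^2 + x^4 / sqrt h) / 2"
    by (simp add: field_simps power4_eq_xxxx power2_eq_square)
  ultimately show ?thesis by simp
qed

lemma abs_sum_cube_le: "0 \<le> p \<Longrightarrow> 0 \<le> q \<Longrightarrow> (p + q)^3 \<le> 4 * (p^3 + q^3)" for p q :: real
proof -
  assume pq: "0 \<le> p" "0 \<le> q"
  have "4 * (p^3 + q^3) - (p + q)^3 = 3 * (p + q) * (p - q)^2"
    by (simp add: power3_eq_cube power2_eq_square algebra_simps)
  also have "\<dots> \<ge> 0" using pq by simp
  finally show ?thesis by simp
qed

text \<open>The Lipschitz condition on the second derivative stands in for a bounded third
  derivative and makes the remainder cubic.\<close>

lemma taylor_two:
  fixes f f1 f2 :: "real \<Rightarrow> real"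
  assumes f1: "\<And>x. (f has_real_derivative f1 x) (at x)" and f2: "\<And>x. (f1 has_real_derivative f2 x) (at x)"
    and lip: "\<And>x y. \<bar>f2 x - f2 y\<bar> \<le> C * \<bar>x - y\<bar>"
  shows "\<bar>f (y + d) - f y - f1 y * d - f2 y * d^2 / 2\<bar> \<le> C * \<bar>d\<bar>^3"
proof (cases "d = 0")
  case False
  define F where "F m = (if m = (0::nat) then f else if m = 1 then f1 else f2)" for m
  have "\<forall>m t. m < 2 \<and> min y (y + d) \<le> t \<and> t \<le> max y (y + d) \<longrightarrow> (F m has_real_derivative F (Suc m) t) (at t)"
    using f1 f2 by (auto simp: F_def less_2_cases_iff)
  from Taylor[OF _ _ this, of f y "y + d"] False obtain t where t: "if y + d < y then y + d < t \<and> t < y else y < t \<and> t < y + d"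
    "f (y + d) = (\<Sum>m<2. F m y / fact m * (y + d - y)^m) + F 2 t / fact 2 * (y + d - y)^2"
    by (auto simp: F_def)
  have "f (y + d) - f y - f1 y * d - f2 y * d^2 / 2 = (f2 t - f2 y) * d^2 / 2"
    using t(2) by (simp add: F_def numeral_2_eq_2 field_simps)
  then have "\<bar>f (y + d) - f y - f1 y * d - f2 y * d^2 / 2\<bar> = \<bar>(f2 t - f2 y) * d^2 / 2\<bar>"
    by (simp only:)
  also have "\<dots> = \<bar>f2 t - f2 y\<bar> * d^2 / 2"
    by (simp add: abs_mult)
  also have "\<dots> \<le> (C * \<bar>d\<bar>) * d^2 / 2"
  proof -
    have "C \<ge> 0" using lip[of 0 1] by (simp add: abs_le_iff)
    moreover have "\<bar>t - y\<bar> \<le> \<bar>d\<bar>" using t(1) by (auto split: if_splits)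
    ultimately have "\<bar>f2 t - f2 y\<bar> \<le> C * \<bar>d\<bar>" by (meson lip mult_left_mono order_trans)
    then show ?thesis by (intro divide_right_mono mult_right_mono) auto
  qed
  also have "\<dots> = C * \<bar>d\<bar>^3 / 2" by (simp add: power3_eq_cube power2_eq_square)
  also have "\<dots> \<le> C * \<bar>d\<bar>^3"
    using lip[of 0 1] by (simp add: abs_le_iff)
  finally show ?thesis .
qed simp

context wiener
begin

lemma space_W: "space W = space paths"
  by (rule sets_eq_imp_space_eq[OF sets_W])

lemma measurable_W_iff: "f \<in> borel_measurable W \<longleftrightarrow> f \<in> borel_measurable paths"
  using measurable_cong_sets[OF sets_W refl] by blast

lemma measurable_W[measurable (raw)]: "f \<in> borel_measurable paths \<Longrightarrow> f \<in> borel_measurable W"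
  by (simp add: measurable_W_iff)

lemma integrable_bounded:
  fixes f :: "(real \<Rightarrow> real) \<Rightarrow> real"
  assumes "f \<in> borel_measurable paths" "\<And>c. c \<in> space paths \<Longrightarrow> \<bar>f c\<bar> \<le> K"
  shows "integrable W f"
  by (rule integrable_const_bound[of _ K]) (use assms in \<open>auto simp: space_W measurable_W_iff\<close>)

lemma
  fixes g :: "(real \<Rightarrow> real) \<Rightarrow> real"
  assumes a: "0 \<le> a" "a < t" and g: "known a g" "g \<in> borel_measurable paths"
    and bd: "\<And>c. c \<in> space paths \<Longrightarrow> \<bar>g c\<bar> \<le> K"
  shows integrable_increment: "integrable W (\<lambda>c. g c * (c t - c a))"
    and expectation_increment: "(\<integral>c. g c * (c t - c a) \<partial>W) = 0"
    and integrable_increment2: "integrable W (\<lambda>c. g c * (c t - c a)^2)"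
    and expectation_increment2: "(\<integral>c. g c * (c t - c a)^2 \<partial>W) = (t - a) * (\<integral>c. g c \<partial>W)"
    and integrable_increment4: "integrable W (\<lambda>c. g c * (c t - c a)^4)"
    and expectation_increment4: "(\<integral>c. g c * (c t - c a)^4 \<partial>W) = 3 * (t - a)^2 * (\<integral>c. g c \<partial>W)"
proof -
  have s: "sqrt (t - a) > 0" using a by simp
  note inc = increment_W[OF a g bd]
  have int: "integrable lborel (\<lambda>x. normal_density 0 (sqrt (t - a)) x * x ^ k)" for k
    using integrable_normal_moment[OF s, of 0 k] by simp
  have "integrable W (\<lambda>c. g c * (c t - c a)^k) \<and> (\<integral>c. g c * (c t - c a)^k \<partial>W)
      = (\<integral>c. g c \<partial>W) * (\<integral>x. normal_density 0 (sqrt (t - a)) x * x ^ k \<partial>lborel)" for k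
    by (rule inc) (use int in auto)
  note m = this[of 1] this[of 2] this[of 4]
  have e1: "(\<integral>x. normal_density 0 (sqrt (t - a)) x * x \<partial>lborel) = 0"
    using integral_normal_moment_nz_1[OF s] by simp
  have e2: "(\<integral>x. normal_density 0 (sqrt (t - a)) x * x ^ 2 \<partial>lborel) = t - a"
    using integral_normal_moment_even[OF s, of 0 1] a by (simp add: fact_numeral)
  have e4: "(\<integral>x. normal_density 0 (sqrt (t - a)) x * x ^ 4 \<partial>lborel) = 3 * (t - a)^2"
    using integral_normal_moment_even[OF s, of 0 2] a by (simp add: fact_numeral power2_eq_square field_simps)
  show "integrable W (\<lambda>c. g c * (c t - c a))" "(\<integral>c. g c * (c t - c a) \<partial>W) = 0"
    "integrable W (\<lambda>c. g c * (c t - c a)^2)" "(\<integral>c. g c * (c t - c a)^2 \<partial>W) = (t - a) * (\<integral>c. g c \<partial>W)"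
    "integrable W (\<lambda>c. g c * (c t - c a)^4)" "(\<integral>c. g c * (c t - c a)^4 \<partial>W) = 3 * (t - a)^2 * (\<integral>c. g c \<partial>W)"
    using m by (simp_all add: e1 e2 e4)
qed

end

locale repelling = wiener +
  fixes \<sigma> :: real
  assumes \<sigma>_pos: "\<sigma> > 0"
begin

text \<open>Error of one time step of length \<open>h\<close> when the drift is bounded by
  \<open>K\<close>: cubic Taylor remainder of the noise, cubic remainder of the drift, mixed
  second-order term, square of the drift. Every term is \<open>o(h)\<close>, so the errors of
  \<open>n\<close> steps of length of order \<open>1 / n\<close> vanish together in the
  limit.\<close>

definition step_error :: "real \<Rightarrow> real \<Rightarrow> real \<Rightarrow> real" where
  "step_error C K h = 8 * C * \<sigma>^3 * (h * sqrt h) + 4 * C * (K * h)^3 + C * \<sigma> * K * (h * sqrt h) + C * (K * h)^2 / 2"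

text \<open>In the second-order Taylor expansion around \<open>Y c t\<close>, the noise increment
  and its square have conditional means 0 and \<open>h\<close>, because everything they are
  multiplied by is known at \<open>t\<close>. The drift increment is kept as an exact integral; all
  other terms go into the error.\<close>

lemma dynkin_step:
  fixes w \<theta> :: "(real \<Rightarrow> real) \<Rightarrow> real" and f f1 f2 :: "real \<Rightarrow> real"
  assumes t: "0 \<le> t" "h > 0" "t + h \<le> b"
    and w: "known t w" "w \<in> borel_measurable paths" "\<And>c. c \<in> space paths \<Longrightarrow> \<bar>w c\<bar> \<le> Kw"
    and \<theta>: "known t \<theta>" "\<theta> \<in> borel_measurable paths"
    and f1: "\<And>x. (f has_real_derivative f1 x) (at x)" and f2: "\<And>x. (f1 has_real_derivative f2 x) (at x)"
    and lip: "\<And>x y. \<bar>f2 x - f2 y\<bar> \<le> C * \<bar>x - y\<bar>"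
    and bd: "\<And>x. \<bar>f x\<bar> \<le> C" "\<And>x. \<bar>f1 x\<bar> \<le> C" "\<And>x. \<bar>f2 x\<bar> \<le> C"
    and [measurable]: "f \<in> borel_measurable borel" "f1 \<in> borel_measurable borel" "f2 \<in> borel_measurable borel"
  defines "Y \<equiv> \<lambda>c s. angle \<sigma> c s - \<theta> c"
  shows "\<bar>\<integral>c. w c * (f (Y c (t + h)) - f (Y c t)
      - (integral {t..t + h} (force \<sigma> c) * f1 (Y c t) + h * (\<sigma>^2 / 2 * f2 (Y c t)))) \<partial>W\<bar> \<le> Kw * step_error C b h"
proof -
  have [measurable]: "w \<in> borel_measurable paths" "\<theta> \<in> borel_measurable paths"
    "(\<lambda>c. angle \<sigma> c t) \<in> borel_measurable paths" "(\<lambda>c. angle \<sigma> c (t + h)) \<in> borel_measurable paths"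
    using w \<theta> t by auto
  have C: "C \<ge> 0" using bd(1)[of 0] by linarith
  have b: "b \<ge> 0" using t by simp
  have Kw: "Kw \<ge> 0" using w(3)[of "\<lambda>_. 0"] by (force simp: space_paths)
  define \<Delta> where "\<Delta> c = c (t + h) - c t" for c :: "real \<Rightarrow> real"
  define d where "d c = integral {t..t + h} (force \<sigma> c)" for c
  have [measurable]: "d \<in> borel_measurable paths"
    unfolding d_def using t by (intro borel_measurable_integral_path) (auto intro: continuous_on_force)
  have dle: "\<bar>d c\<bar> \<le> b * h" if c: "c \<in> space paths" for c
  proof -
    have "norm (d c) \<le> b * (t + h - t)"
      unfolding d_def
    proof (rule integral_bound)
      fix s assume "s \<in> {t..t + h}"
      then show "norm (force \<sigma> c s) \<le> b"
        using abs_force_le_norm_memory[of \<sigma> c s] norm_memory_le[OF c, of s \<sigma>] t by simp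
    qed (use t c in \<open>auto intro: continuous_on_force\<close>)
    then show ?thesis by simp
  qed
  define main where "main c = f (Y c (t + h)) - f (Y c t)
      - (integral {t..t + h} (force \<sigma> c) * f1 (Y c t) + h * (\<sigma>^2 / 2 * f2 (Y c t)))" for c
  define G1 where "G1 c = w c * (\<sigma> * f1 (Y c t))" for c
  define G2 where "G2 c = w c * (\<sigma>^2 / 2 * f2 (Y c t))" for c
  have [measurable]: "(\<lambda>c. Y c t) \<in> borel_measurable paths" "(\<lambda>c. Y c (t + h)) \<in> borel_measurable paths"
    unfolding Y_def by measurable
  have m: "main \<in> borel_measurable paths" "G1 \<in> borel_measurable paths" "G2 \<in> borel_measurable paths"
    unfolding main_def d_def[symmetric] G1_def G2_def by measurable
  have Yt: "known t (\<lambda>c. Y c t)"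
    unfolding Y_def by (rule known_comp2[OF known_angle \<theta>(1)]) (use t in auto)
  have kG: "known t G1" "known t G2"
    unfolding G1_def G2_def
    by (rule known_comp2[OF w(1) known_comp[OF Yt, of "\<lambda>y. \<sigma> * f1 y"]], rule known_comp2[OF w(1) known_comp[OF Yt, of "\<lambda>y. \<sigma>^2 / 2 * f2 y"]])
  have bG1: "\<bar>G1 c\<bar> \<le> Kw * (\<sigma> * C)" if "c \<in> space paths" for c
    unfolding G1_def abs_mult using w(3)[OF that] bd(2)[of "Y c t"] \<sigma>_pos Kw C by (intro mult_mono) auto
  have bG2: "\<bar>G2 c\<bar> \<le> Kw * (\<sigma>^2 / 2 * C)" if "c \<in> space paths" for c
    unfolding G2_def abs_mult using w(3)[OF that] bd(3)[of "Y c t"] \<sigma>_pos Kw C by (intro mult_mono) auto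
  have i: "integrable W (\<lambda>c. G1 c * \<Delta> c)" "(\<integral>c. G1 c * \<Delta> c \<partial>W) = 0"
    using integrable_increment[OF t(1) _ kG(1) m(2) bG1, of "t + h"] expectation_increment[OF t(1) _ kG(1) m(2) bG1, of "t + h"] t
    by (simp_all add: \<Delta>_def)
  have i2: "integrable W (\<lambda>c. G2 c * (\<Delta> c)^2)" "(\<integral>c. G2 c * (\<Delta> c)^2 \<partial>W) = h * (\<integral>c. G2 c \<partial>W)"
    using integrable_increment2[OF t(1) _ kG(2) m(3) bG2, of "t + h"] expectation_increment2[OF t(1) _ kG(2) m(3) bG2, of "t + h"] t
    by (simp_all add: \<Delta>_def)
  have iG2: "integrable W G2" by (rule integrable_bounded[OF m(3) bG2])
  have one: "integrable W (\<lambda>c. (\<Delta> c)^2)" "(\<integral>c. (\<Delta> c)^2 \<partial>W) = h" "integrable W (\<lambda>c. (\<Delta> c)^4)" "(\<integral>c. (\<Delta> c)^4 \<partial>W) = 3 * h^2"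
    using integrable_increment2[OF t(1), of "t + h" "\<lambda>_. 1" 1] expectation_increment2[OF t(1), of "t + h" "\<lambda>_. 1" 1]
      integrable_increment4[OF t(1), of "t + h" "\<lambda>_. 1" 1] expectation_increment4[OF t(1), of "t + h" "\<lambda>_. 1" 1] t
    by (simp_all add: \<Delta>_def prob_space)
  \<comment> \<open>A majorant of the remainder that contains only even powers of the noise
    increment, so that its expectation is explicit.\<close>
  define P where "P c = 4 * C * \<sigma>^3 * ((sqrt h * (\<Delta> c)^2 + (\<Delta> c)^4 / sqrt h) / 2) + 4 * C * (b * h)^3
      + C * \<sigma> * (b * h) * ((sqrt h + (\<Delta> c)^2 / sqrt h) / 2) + C * (b * h)^2 / 2" for c
  have iP: "integrable W P"
    unfolding P_def using one by (intro Bochner_Integration.integrable_add integrable_mult_right integrable_divide integrable_const) auto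
  have eP: "(\<integral>c. P c \<partial>W) = step_error C b h"
  proof -
    have "(\<integral>c. P c \<partial>W) = 4 * C * \<sigma>^3 * ((sqrt h * h + 3 * h^2 / sqrt h) / 2) + 4 * C * (b * h)^3
      + C * \<sigma> * (b * h) * ((sqrt h + h / sqrt h) / 2) + C * (b * h)^2 / 2"
      unfolding P_def using one by (simp add: prob_space)
    also have "h / sqrt h = sqrt h" using t by (simp add: real_div_sqrt)
    also have "3 * h^2 / sqrt h = 3 * (h * sqrt h)" using t by (simp add: power2_eq_square real_div_sqrt flip: times_divide_eq_right)
    finally show ?thesis by (simp add: step_error_def algebra_simps)
  qed
  \<comment> \<open>The two terms subtracted from \<open>main\<close> have mean zero after
    multiplication by \<open>w\<close>; what remains is bounded pointwise, not only on
    average.\<close>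
  define \<rho> where "\<rho> c = main c - \<sigma> * f1 (Y c t) * \<Delta> c - \<sigma>^2 / 2 * f2 (Y c t) * ((\<Delta> c)^2 - h)" for c
  have \<rho>P: "\<bar>\<rho> c\<bar> \<le> P c" if c: "c \<in> space paths" for c
  proof -
    define \<delta> where "\<delta> = \<sigma> * \<Delta> c + d c"
    have Y: "Y c (t + h) = Y c t + \<delta>"
      using angle_restart[OF c t(1), of "t + h" \<sigma>] t by (simp add: Y_def \<delta>_def \<Delta>_def d_def)
    define u where "u = f (Y c t + \<delta>) - f (Y c t) - f1 (Y c t) * \<delta> - f2 (Y c t) * \<delta>^2 / 2"
    define v where "v = 2 * (\<sigma> * \<Delta> c) * d c + (d c)^2"
    have "\<rho> c = u + f2 (Y c t) * v / 2"
      unfolding \<rho>_def main_def Y d_def[symmetric] u_def v_def \<delta>_def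
      by (simp add: power2_eq_square field_simps)
    then have split: "\<bar>\<rho> c\<bar> \<le> \<bar>u\<bar> + \<bar>f2 (Y c t)\<bar> * \<bar>v\<bar> / 2"
      using abs_triangle_ineq[of u "f2 (Y c t) * v / 2"] by (simp add: abs_mult)
    have "\<bar>\<delta>\<bar>^3 \<le> (\<sigma> * \<bar>\<Delta> c\<bar> + b * h)^3"
      using abs_triangle_ineq[of "\<sigma> * \<Delta> c" "d c"] dle[OF c] \<sigma>_pos by (intro power_mono) (auto simp: \<delta>_def abs_mult)
    also have "\<dots> \<le> 4 * ((\<sigma> * \<bar>\<Delta> c\<bar>)^3 + (b * h)^3)"
      using \<sigma>_pos b t by (intro abs_sum_cube_le) auto
    also have "(\<sigma> * \<bar>\<Delta> c\<bar>)^3 \<le> \<sigma>^3 * ((sqrt h * (\<Delta> c)^2 + (\<Delta> c)^4 / sqrt h) / 2)"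
      unfolding power_mult_distrib using \<sigma>_pos by (intro mult_left_mono abs_cube_le_sqrt_mean t) auto
    finally have "\<bar>\<delta>\<bar>^3 \<le> 4 * (\<sigma>^3 * ((sqrt h * (\<Delta> c)^2 + (\<Delta> c)^4 / sqrt h) / 2) + (b * h)^3)" by simp
    then have "C * \<bar>\<delta>\<bar>^3 \<le> C * (4 * (\<sigma>^3 * ((sqrt h * (\<Delta> c)^2 + (\<Delta> c)^4 / sqrt h) / 2) + (b * h)^3))"
      using C by (rule mult_left_mono)
    moreover have "\<bar>u\<bar> \<le> C * \<bar>\<delta>\<bar>^3"
      unfolding u_def by (rule taylor_two[OF f1 f2 lip])
    ultimately have u: "\<bar>u\<bar> \<le> 4 * C * \<sigma>^3 * ((sqrt h * (\<Delta> c)^2 + (\<Delta> c)^4 / sqrt h) / 2) + 4 * C * (b * h)^3"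
      by (simp add: algebra_simps)
    have "\<bar>f2 (Y c t)\<bar> * \<bar>v\<bar> \<le> C * (2 * \<sigma> * (b * h) * ((sqrt h + (\<Delta> c)^2 / sqrt h) / 2) + (b * h)^2)"
    proof (intro mult_mono bd C)
      have "\<bar>v\<bar> \<le> 2 * (\<sigma> * \<bar>\<Delta> c\<bar>) * \<bar>d c\<bar> + \<bar>d c\<bar>^2"
        unfolding v_def using \<sigma>_pos abs_triangle_ineq[of "2 * (\<sigma> * \<Delta> c) * d c" "(d c)^2"] by (simp add: abs_mult)
      also have "\<dots> \<le> 2 * (\<sigma> * ((sqrt h + (\<Delta> c)^2 / sqrt h) / 2)) * (b * h) + (b * h)^2"
        using \<sigma>_pos dle[OF c] abs_le_sqrt_mean[OF t(2), of "\<Delta> c"] t b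
        by (intro add_mono mult_mono power_mono) auto
      finally show "\<bar>v\<bar> \<le> 2 * \<sigma> * (b * h) * ((sqrt h + (\<Delta> c)^2 / sqrt h) / 2) + (b * h)^2"
        by (simp add: mult_ac)
    qed simp
    then have "\<bar>f2 (Y c t)\<bar> * \<bar>v\<bar> / 2 \<le> C * \<sigma> * (b * h) * ((sqrt h + (\<Delta> c)^2 / sqrt h) / 2) + C * (b * h)^2 / 2"
      by (simp add: algebra_simps)
    with split u show ?thesis unfolding P_def by linarith
  qed
  have mb: "\<bar>w c * main c\<bar> \<le> Kw * (C + C + (b * h * C + h * (\<sigma>^2 / 2 * C)))" if c: "c \<in> space paths" for c
    unfolding abs_mult
  proof (intro mult_mono w(3) c)
    have "\<bar>d c * f1 (Y c t)\<bar> \<le> b * h * C" unfolding abs_mult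
      by (intro mult_mono dle c bd) (use b t in auto)
    moreover have "\<bar>h * (\<sigma>^2 / 2 * f2 (Y c t))\<bar> \<le> h * (\<sigma>^2 / 2 * C)" unfolding abs_mult
      using bd(3)[of "Y c t"] t by (simp add: abs_mult mult_left_mono)
    ultimately show "\<bar>main c\<bar> \<le> C + C + (b * h * C + h * (\<sigma>^2 / 2 * C))"
      unfolding main_def d_def[symmetric] using bd(1)[of "Y c t"] bd(1)[of "Y c (t + h)"] by linarith
  qed (use Kw in auto)
  have iw: "integrable W (\<lambda>c. w c * main c)"
    by (rule integrable_bounded[OF _ mb]) (use m(1) in measurable)
  have \<rho>w: "w c * \<rho> c = w c * main c - G1 c * \<Delta> c - (G2 c * (\<Delta> c)^2 - h * G2 c)" for c
    by (simp add: \<rho>_def G1_def G2_def field_simps)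
  have ir: "integrable W (\<lambda>c. w c * \<rho> c)"
    unfolding \<rho>w using iw i i2 iG2 by simp
  have "(\<integral>c. w c * main c \<partial>W) = (\<integral>c. w c * \<rho> c \<partial>W)"
    unfolding \<rho>w using iw i i2 iG2 by simp
  then have "\<bar>\<integral>c. w c * main c \<partial>W\<bar> \<le> (\<integral>c. \<bar>w c * \<rho> c\<bar> \<partial>W)"
    using integral_abs_bound[of W "\<lambda>c. w c * \<rho> c"] by simp
  also have "\<dots> \<le> (\<integral>c. Kw * P c \<partial>W)"
    using ir iP
    by (intro integral_mono integrable_abs integrable_mult_right)
       (auto simp: space_W abs_mult intro!: mult_mono w(3) \<rho>P Kw)
  also have "\<dots> = Kw * step_error C b h" using eP by simp
  finally show ?thesis unfolding main_def .
qed

lemma step_error_vanishes: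
  assumes L: "L > 0"
  shows "(\<lambda>n. real n * step_error C K (L / real n)) \<longlonglongrightarrow> 0"
proof -
  have "(\<lambda>n::nat. real n * ((L / n) * sqrt (L / n))) \<longlonglongrightarrow> 0" using L by real_asymp
  moreover have "(\<lambda>n::nat. real n * (L / n)^3) \<longlonglongrightarrow> 0" using L by real_asymp
  moreover have "(\<lambda>n::nat. real n * (L / n)^2) \<longlonglongrightarrow> 0" using L by real_asymp
  ultimately have "(\<lambda>n::nat. 8 * C * \<sigma>^3 * (real n * ((L / n) * sqrt (L / n))) + 4 * C * K^3 * (real n * (L / n)^3)
      + C * \<sigma> * K * (real n * ((L / n) * sqrt (L / n))) + C * K^2 / 2 * (real n * (L / n)^2))
     \<longlonglongrightarrow> 8 * C * \<sigma>^3 * 0 + 4 * C * K^3 * 0 + C * \<sigma> * K * 0 + C * K^2 / 2 * 0"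
    by (intro tendsto_intros)
  moreover have "real n * step_error C K h = 8 * C * \<sigma>^3 * (real n * (h * sqrt h)) + 4 * C * K^3 * (real n * h^3)
      + C * \<sigma> * K * (real n * (h * sqrt h)) + C * K^2 / 2 * (real n * h^2)" for n h
    by (simp add: step_error_def power_mult_distrib algebra_simps)
  ultimately show ?thesis by simp
qed

lemma abs_force_le: "c \<in> space paths \<Longrightarrow> 0 \<le> t \<Longrightarrow> \<bar>force \<sigma> c t\<bar> \<le> t"
  using abs_force_le_norm_memory[of \<sigma> c t] norm_memory_le[of c t \<sigma>] by linarith

lemma dynkin:
  fixes w \<theta> :: "(real \<Rightarrow> real) \<Rightarrow> real" and f f1 f2 :: "real \<Rightarrow> real"
  assumes a: "0 \<le> a" "a < b"
    and w: "known a w" "w \<in> borel_measurable paths" "\<And>c. c \<in> space paths \<Longrightarrow> \<bar>w c\<bar> \<le> Kw"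
    and \<theta>: "known a \<theta>" "\<theta> \<in> borel_measurable paths"
    and f1: "\<And>x. (f has_real_derivative f1 x) (at x)" and f2: "\<And>x. (f1 has_real_derivative f2 x) (at x)"
    and lip: "\<And>x y. \<bar>f2 x - f2 y\<bar> \<le> C * \<bar>x - y\<bar>"
    and bd: "\<And>x. \<bar>f x\<bar> \<le> C" "\<And>x. \<bar>f1 x\<bar> \<le> C" "\<And>x. \<bar>f2 x\<bar> \<le> C"
    and cont: "continuous_on UNIV f2"
  defines "Y \<equiv> \<lambda>c s. angle \<sigma> c s - \<theta> c"
  shows "(\<integral>c. w c * (f (Y c b) - f (Y c a)) \<partial>W)
    = (\<integral>c. w c * integral {a..b} (\<lambda>s. force \<sigma> c s * f1 (Y c s) + \<sigma>^2 / 2 * f2 (Y c s)) \<partial>W)"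
proof -
  have C: "C \<ge> 0" using bd(1)[of 0] by linarith
  have b: "b > 0" using a by simp
  have Kw: "Kw \<ge> 0" using w(3)[of "\<lambda>_. 0"] by (force simp: space_paths)
  have cf: "continuous_on UNIV f" "continuous_on UNIV f1"
    using f1 f2 by (auto intro!: continuous_at_imp_continuous_on DERIV_isCont)
  note [measurable] = w(2) \<theta>(2)
  have [measurable]: "f \<in> borel_measurable borel" "f1 \<in> borel_measurable borel" "f2 \<in> borel_measurable borel"
    using cf cont by (auto intro: borel_measurable_continuous_onI)
  have Ym: "(\<lambda>c. Y c s) \<in> borel_measurable paths" if "s \<ge> 0" for s
    unfolding Y_def using measurable_angle[OF that, of \<sigma>] by measurable
  have Yc: "continuous_on {a..b} (Y c)" if "c \<in> space paths" for c
    unfolding Y_def using continuous_on_angle[OF that a(1)] by (intro continuous_intros)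
  define g where "g n j = grid a b n j" for n j
  have gpos: "0 \<le> g n j" for n j using a by (simp add: g_def grid_def)
  define h where "h n = (b - a) / real n" for n :: nat
  define S where "S n c = (\<Sum>j<n. integral {g n j..g n (Suc j)} (force \<sigma> c) * f1 (Y c (g n j)) + h n * (\<sigma>^2 / 2 * f2 (Y c (g n j))))" for n c
  define F where "F c = w c * (f (Y c b) - f (Y c a))" for c
  define G where "G c = integral {a..b} (\<lambda>s. force \<sigma> c s * f1 (Y c s) + \<sigma>^2 / 2 * f2 (Y c s))" for c
  have mono: "g n j \<le> g n (Suc j)" for n j using grid_mono[of a b j "Suc j" n] a by (simp add: g_def)
  have meas_d: "(\<lambda>c. integral {g n j..g n (Suc j)} (force \<sigma> c)) \<in> borel_measurable paths" for n j
    using gpos mono by (intro borel_measurable_integral_path measurable_force continuous_on_force) (auto intro: order_trans)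
  have term_meas: "(\<lambda>c. integral {g n j..g n (Suc j)} (force \<sigma> c) * f1 (Y c (g n j)) + h n * (\<sigma>^2 / 2 * f2 (Y c (g n j))))
      \<in> borel_measurable paths" for n j
    using meas_d[of n j] Ym[OF gpos, of n j] by measurable
  have mF: "F \<in> borel_measurable paths"
  proof -
    have [measurable]: "(\<lambda>c. Y c a) \<in> borel_measurable paths" "(\<lambda>c. Y c b) \<in> borel_measurable paths"
      using Ym a by auto
    show ?thesis unfolding F_def by measurable
  qed
  have mS: "S n \<in> borel_measurable paths" for n
    unfolding S_def by (intro borel_measurable_sum term_meas)
  have term_bd: "\<bar>integral {g n j..g n (Suc j)} (force \<sigma> c) * f1 (Y c (g n j)) + h n * (\<sigma>^2 / 2 * f2 (Y c (g n j)))\<bar>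
      \<le> (b * C + \<sigma>^2 / 2 * C) * h n" if c: "c \<in> space paths" and j: "j < n" for c n j
  proof -
    have "norm (integral {g n j..g n (Suc j)} (force \<sigma> c)) \<le> b * (g n (Suc j) - g n j)"
    proof (rule integral_bound[OF mono])
      show "continuous_on {g n j..g n (Suc j)} (force \<sigma> c)" by (rule continuous_on_force[OF c gpos])
      fix s assume s: "s \<in> {g n j..g n (Suc j)}"
      have "s \<le> b" using s grid_mem[of a b "Suc j" n] a j by (auto simp: g_def)
      then show "norm (force \<sigma> c s) \<le> b" using abs_force_le[OF c, of s] s gpos[of n j] by simp
    qed
    also have "g n (Suc j) - g n j = h n" by (simp add: g_def h_def grid_Suc)
    finally have "\<bar>integral {g n j..g n (Suc j)} (force \<sigma> c) * f1 (Y c (g n j))\<bar> \<le> (b * h n) * C"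
      unfolding abs_mult using a b by (intro mult_mono bd) (auto simp: h_def)
    moreover have "\<bar>h n * (\<sigma>^2 / 2 * f2 (Y c (g n j)))\<bar> \<le> h n * (\<sigma>^2 / 2 * C)"
      using bd(3)[of "Y c (g n j)"] a by (simp add: abs_mult h_def mult_left_mono divide_right_mono)
    ultimately show ?thesis by (simp add: algebra_simps abs_le_iff)
  qed
  have bS: "\<bar>S n c\<bar> \<le> (b * C + \<sigma>^2 / 2 * C) * (b - a)" if c: "c \<in> space paths" for n c
  proof -
    have "\<bar>S n c\<bar> \<le> (\<Sum>j<n. (b * C + \<sigma>^2 / 2 * C) * h n)"
      unfolding S_def by (rule order_trans[OF sum_abs sum_mono]) (use term_bd[OF c] in auto)
    also have "\<dots> \<le> (b * C + \<sigma>^2 / 2 * C) * (b - a)"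
      using a b C by (cases "n = 0") (auto simp: h_def)
    finally show ?thesis .
  qed
  have bF: "\<bar>F c\<bar> \<le> Kw * (2 * C)" if "c \<in> space paths" for c
  proof -
    have "\<bar>f (Y c b) - f (Y c a)\<bar> \<le> 2 * C" using bd(1)[of "Y c b"] bd(1)[of "Y c a"] by linarith
    then show ?thesis unfolding F_def abs_mult using w(3)[OF that] Kw by (intro mult_mono) auto
  qed
  have iF: "integrable W F" by (rule integrable_bounded[OF mF bF])
  have wSm: "(\<lambda>c. w c * S n c) \<in> borel_measurable paths" for n using mS[of n] by measurable
  have wSb: "\<bar>w c * S n c\<bar> \<le> Kw * ((b * C + \<sigma>^2 / 2 * C) * (b - a))" if "c \<in> space paths" for n c
    unfolding abs_mult using w(3)[OF that] bS[OF that, of n] Kw by (intro mult_mono) auto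
  have iS: "integrable W (\<lambda>c. w c * S n c)" for n by (rule integrable_bounded[OF wSm wSb])
  have err: "\<bar>(\<integral>c. F c \<partial>W) - (\<integral>c. w c * S n c \<partial>W)\<bar> \<le> Kw * (real n * step_error C b ((b - a) / real n))" if n: "n > 0" for n
  proof -
    define m where "m j c = w c * (f (Y c (g n j + h n)) - f (Y c (g n j))
      - (integral {g n j..g n j + h n} (force \<sigma> c) * f1 (Y c (g n j)) + h n * (\<sigma>^2 / 2 * f2 (Y c (g n j)))))" for j c
    have gs: "g n (Suc j) = g n j + h n" for j by (simp add: g_def h_def grid_Suc)
    have im: "integrable W (m j)" if j: "j < n" for j
    proof (rule integrable_bounded)
      have [measurable]: "(\<lambda>c. Y c (g n j)) \<in> borel_measurable paths" "(\<lambda>c. Y c (g n (Suc j))) \<in> borel_measurable paths"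
        using Ym[OF gpos] by auto
      show "m j \<in> borel_measurable paths"
        unfolding m_def gs[symmetric] using term_meas[of n j] by measurable
      fix c assume c: "c \<in> space paths"
      have "\<bar>f (Y c (g n (Suc j))) - f (Y c (g n j))
          - (integral {g n j..g n (Suc j)} (force \<sigma> c) * f1 (Y c (g n j)) + h n * (\<sigma>^2 / 2 * f2 (Y c (g n j))))\<bar>
          \<le> 2 * C + (b * C + \<sigma>^2 / 2 * C) * h n"
        using bd(1)[of "Y c (g n (Suc j))"] bd(1)[of "Y c (g n j)"] term_bd[OF c j] by linarith
      then show "\<bar>m j c\<bar> \<le> Kw * (2 * C + (b * C + \<sigma>^2 / 2 * C) * h n)"
        unfolding m_def gs[symmetric] abs_mult using w(3)[OF c] Kw by (intro mult_mono) auto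
    qed
    have tel: "f (Y c b) - f (Y c a) = (\<Sum>j<n. f (Y c (g n (Suc j))) - f (Y c (g n j)))" for c
      using sum_lessThan_telescope[of "\<lambda>j. f (Y c (g n j))" n] n by (simp add: g_def)
    have "F c - w c * S n c = (\<Sum>j<n. m j c)" for c
      unfolding F_def S_def m_def tel gs[symmetric]
      by (simp add: sum_subtractf[symmetric] sum_distrib_left[symmetric] right_diff_distrib[symmetric])
    then have "(\<integral>c. F c \<partial>W) - (\<integral>c. w c * S n c \<partial>W) = (\<integral>c. (\<Sum>j<n. m j c) \<partial>W)"
      using Bochner_Integration.integral_diff[OF iF iS[of n]] by simp
    also have "\<dots> = (\<Sum>j<n. \<integral>c. m j c \<partial>W)"
      by (rule Bochner_Integration.integral_sum) (use im in auto)
    finally have "\<bar>(\<integral>c. F c \<partial>W) - (\<integral>c. w c * S n c \<partial>W)\<bar> \<le> (\<Sum>j<n. \<bar>\<integral>c. m j c \<partial>W\<bar>)"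
      by (simp add: sum_abs)
    also have "\<dots> \<le> (\<Sum>j<n. Kw * step_error C b (h n))"
    proof (rule sum_mono)
      fix j assume "j \<in> {..<n}"
      then have j: "j < n" by simp
      have aj: "a \<le> g n j" using grid_mem[of a b j n] a j by (auto simp: g_def)
      have hb: "g n j + h n \<le> b" using grid_mem[of a b "Suc j" n] a j by (auto simp: gs[symmetric] g_def[symmetric])
      show "\<bar>\<integral>c. m j c \<partial>W\<bar> \<le> Kw * step_error C b (h n)"
        unfolding m_def Y_def
        by (rule dynkin_step[OF gpos _ hb known_mono[OF w(1) aj] w(2,3) known_mono[OF \<theta>(1) aj] \<theta>(2) f1 f2 lip bd])
           (use n a in \<open>auto simp: h_def\<close>)
    qed
    finally show ?thesis by (simp add: h_def mult.left_commute)
  qed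
  have lim1: "(\<lambda>n. \<integral>c. w c * S n c \<partial>W) \<longlonglongrightarrow> (\<integral>c. F c \<partial>W)"
  proof (rule Lim_transform_bound[where f = "\<lambda>n. (\<integral>c. w c * S n c \<partial>W) - (\<integral>c. F c \<partial>W)", THEN LIM_zero_cancel])
    show "(\<lambda>n. Kw * (real n * step_error C b ((b - a) / real n))) \<longlonglongrightarrow> 0"
      using tendsto_mult_left[OF step_error_vanishes[of "b - a" C b], of Kw] a by simp
    show "\<forall>\<^sub>F n in sequentially. norm ((\<integral>c. w c * S n c \<partial>W) - (\<integral>c. F c \<partial>W))
        \<le> norm (Kw * (real n * step_error C b ((b - a) / real n)))"
      using eventually_gt_at_top[of 0]
    proof eventually_elim
      case (elim n)
      then show ?case using err[of n] by (simp add: abs_minus_commute)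
    qed
  qed
  have lim2: "(\<lambda>n. \<integral>c. w c * S n c \<partial>W) \<longlonglongrightarrow> (\<integral>c. w c * G c \<partial>W)"
  proof (rule integral_dominated_convergence[where w = "\<lambda>_. Kw * ((b * C + \<sigma>^2 / 2 * C) * (b - a))"])
    have SG: "(\<lambda>n. S n c) \<longlonglongrightarrow> G c" if c: "c \<in> space paths" for c
    proof -
      have c1: "continuous_on {a..b} (\<lambda>s. f1 (Y c s))" "continuous_on {a..b} (\<lambda>s. \<sigma>^2 / 2 * f2 (Y c s))"
        using continuous_on_compose2[OF cf(2) Yc[OF c]] continuous_on_compose2[OF cont Yc[OF c]]
        by (auto intro!: continuous_intros)
      have cD: "continuous_on {a..b} (force \<sigma> c)" by (rule continuous_on_force[OF c a(1)])
      have "(\<lambda>n. (\<Sum>j<n. integral {g n j..g n (Suc j)} (force \<sigma> c) *\<^sub>R f1 (Y c (g n j)))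
           + (\<Sum>j<n. h n *\<^sub>R (\<sigma>^2 / 2 * f2 (Y c (g n j)))))
         \<longlonglongrightarrow> integral {a..b} (\<lambda>s. force \<sigma> c s *\<^sub>R f1 (Y c s)) + integral {a..b} (\<lambda>s. \<sigma>^2 / 2 * f2 (Y c s))"
        unfolding g_def h_def
        by (intro tendsto_add weighted_riemann_sums riemann_sums c1 cD) (use a in auto)
      also have "integral {a..b} (\<lambda>s. force \<sigma> c s *\<^sub>R f1 (Y c s)) + integral {a..b} (\<lambda>s. \<sigma>^2 / 2 * f2 (Y c s)) = G c"
        unfolding G_def real_scaleR_def
        by (rule Henstock_Kurzweil_Integration.integral_add[symmetric])
           (intro integrable_continuous_interval continuous_intros cD c1)+
      finally show ?thesis by (simp add: S_def sum.distrib)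
    qed
    show "AE c in W. (\<lambda>n. w c * S n c) \<longlonglongrightarrow> w c * G c"
      by (rule AE_I2) (auto simp: space_W intro!: tendsto_mult_left SG)
    have "G \<in> borel_measurable paths"
      by (rule borel_measurable_LIMSEQ_metric[OF mS SG])
    then show "(\<lambda>c. w c * G c) \<in> borel_measurable W" unfolding measurable_W_iff by measurable
    show "(\<lambda>c. w c * S n c) \<in> borel_measurable W" for n unfolding measurable_W_iff by (rule wSm)
    show "AE c in W. norm (w c * S n c) \<le> Kw * ((b * C + \<sigma>^2 / 2 * C) * (b - a))" for n
      by (rule AE_I2) (use wSb in \<open>auto simp: space_W\<close>)
  qed simp
  show ?thesis
    using LIMSEQ_unique[OF lim1 lim2] by (simp add: F_def G_def)
qed

end

section \<open>Lyapunov function\<close>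

text \<open>\<open>Arg\<close> is continuous off the nonpositive real axis, equals \<open>pi\<close>
  on the negative axis and is 0 at 0.\<close>

lemma borel_measurable_Arg[measurable]: "Arg \<in> borel_measurable borel"
proof -
  have op: "- \<real>\<^sub>\<le>\<^sub>0 \<in> sets (borel :: complex measure)"
    by (intro borel_open) (simp add: open_Compl)
  have "(\<lambda>z. indicator (- \<real>\<^sub>\<le>\<^sub>0) z *\<^sub>R Arg z) \<in> borel_measurable borel"
    by (rule borel_measurable_continuous_on_indicator[OF op])
       (auto intro!: continuous_at_imp_continuous_on continuous_at_Arg)
  moreover have "(\<real>\<^sub>\<le>\<^sub>0 - {0} :: complex set) \<in> sets borel"
    by (intro sets.Diff borel_closed) auto
  then have "(\<lambda>z. indicator (\<real>\<^sub>\<le>\<^sub>0 - {0}) z * pi) \<in> borel_measurable (borel :: complex measure)"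
    by (intro borel_measurable_times borel_measurable_indicator borel_measurable_const)
  ultimately have "(\<lambda>z. indicator (- \<real>\<^sub>\<le>\<^sub>0) z *\<^sub>R Arg z + indicator (\<real>\<^sub>\<le>\<^sub>0 - {0}) z * pi) \<in> borel_measurable borel"
    by (rule borel_measurable_add)
  moreover have "indicator (- \<real>\<^sub>\<le>\<^sub>0) z *\<^sub>R Arg z + indicator (\<real>\<^sub>\<le>\<^sub>0 - {0}) z * pi = Arg z" for z
  proof (cases "z \<in> \<real>\<^sub>\<le>\<^sub>0 \<and> z \<noteq> 0")
    case True
    then have "Arg z = pi"
      by (auto simp: Arg_eq_pi complex_nonpos_Reals_iff complex_is_Real_iff complex_eq_iff)
    with True show ?thesis by simp
  next
    case False then show ?thesis by (cases "z = 0") (auto simp: Arg_zero)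
  qed
  ultimately show ?thesis by simp
qed

text \<open>First-order expansion of the length with an explicit quadratic error; in the square the
  cross term is exactly \<open>2 * R * Re \<zeta>\<close>.\<close>

lemma norm_of_real_add_le:
  assumes R: "0 < R" "norm \<zeta> \<le> L" "L \<le> R"
  shows "norm (of_real R + \<zeta>) \<le> R + Re \<zeta> + L^2 / (2 * R)"
proof (rule power2_le_imp_le)
  have n: "norm \<zeta> ^ 2 \<le> L^2" using R by (intro power_mono) auto
  have "\<bar>Re \<zeta>\<bar> \<le> R" using abs_Re_le_cmod[of \<zeta>] R by linarith
  moreover have "0 \<le> L^2 / (2 * R)" using R by simp
  ultimately show "0 \<le> R + Re \<zeta> + L^2 / (2 * R)" by linarith
  have "norm (of_real R + \<zeta>) ^ 2 = R^2 + 2 * R * Re \<zeta> + norm \<zeta> ^ 2"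
    unfolding cmod_power2 by (simp add: power2_eq_square algebra_simps)
  also have "\<dots> \<le> R^2 + 2 * R * Re \<zeta> + L^2" using n by simp
  also have "\<dots> = R^2 + 2 * R * (Re \<zeta> + L^2 / (2 * R))" using R by (simp add: field_simps power2_eq_square)
  also have "R^2 + 2 * R * q \<le> (R + q)^2" for q by (simp add: power2_sum)
  finally show "norm (of_real R + \<zeta>) ^ 2 \<le> (R + Re \<zeta> + L^2 / (2 * R))^2" by (simp add: add.assoc)
qed

text \<open>Rotating the memory at time \<open>a\<close> onto the positive real axis makes the real
  part of its increment the integral of the cosine of the relative angle. So the length shrinks at
  nearly unit speed while this angle is near \<open>pi\<close>.\<close>

lemma norm_memory_increment_le:
  assumes c: "c \<in> space paths" and a: "0 \<le> a" "0 \<le> L" and R: "norm (memory \<sigma> c a) > 0" "L \<le> norm (memory \<sigma> c a)"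
  shows "norm (memory \<sigma> c (a + L)) \<le> norm (memory \<sigma> c a)
    + integral {a..a + L} (\<lambda>s. cos (angle \<sigma> c s - Arg (memory \<sigma> c a))) + L^2 / (2 * norm (memory \<sigma> c a))"
proof -
  define \<Theta> where "\<Theta> = Arg (memory \<sigma> c a)"
  define R where "R = norm (memory \<sigma> c a)"
  have Za: "cis (- \<Theta>) * memory \<sigma> c a = of_real R"
  proof -
    have "memory \<sigma> c a = of_real R * cis \<Theta>"
      using rcis_cmod_Arg[of "memory \<sigma> c a"] by (simp add: rcis_def R_def \<Theta>_def)
    then show ?thesis by (simp add: mult.left_commute[of "cis (- \<Theta>)"] cis_mult)
  qed
  define \<zeta> where "\<zeta> = cis (- \<Theta>) * (memory \<sigma> c (a + L) - memory \<sigma> c a)"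
  have int: "(\<lambda>s. cis (angle \<sigma> c s)) integrable_on {a..a + L}"
    by (intro integrable_continuous_interval continuous_intros continuous_on_angle c a)
  have "((\<lambda>s. cis (- \<Theta>) * cis (angle \<sigma> c s)) has_integral \<zeta>) {a..a + L}"
    unfolding \<zeta>_def using memory_diff_eq[OF c a(1), of "a + L" \<sigma>] a(2) integrable_integral[OF int]
    by (auto intro!: has_integral_mult_right)
  from has_integral_linear[OF this bounded_linear_Re]
  have "((\<lambda>s. cos (angle \<sigma> c s - \<Theta>)) has_integral Re \<zeta>) {a..a + L}"
    by (simp add: o_def cis_mult)
  then have Re\<zeta>: "integral {a..a + L} (\<lambda>s. cos (angle \<sigma> c s - \<Theta>)) = Re \<zeta>" by (rule integral_unique)
  have "norm \<zeta> \<le> L"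
    using norm_memory_diff_le[OF c a(1), of "a + L" \<sigma>] a(2) by (simp add: \<zeta>_def norm_mult)
  moreover have "norm (memory \<sigma> c (a + L)) = norm (of_real R + \<zeta>)"
  proof -
    have "of_real R + \<zeta> = cis (- \<Theta>) * memory \<sigma> c (a + L)" by (simp add: \<zeta>_def Za[symmetric] algebra_simps)
    then show ?thesis by (simp add: norm_mult)
  qed
  ultimately show ?thesis
    using norm_of_real_add_le[of R \<zeta> L] assms(4,5) by (simp add: Re\<zeta> \<Theta>_def[symmetric] R_def)
qed

text \<open>The drift is 1-Lipschitz in the memory and the memory moves with unit speed, so freezing
  it at time \<open>a\<close> costs at most \<open>s - a\<close>.\<close>

lemma force_close_to_sin:
  assumes c: "c \<in> space paths" and a: "0 \<le> a" "a \<le> s"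
  shows "\<bar>force \<sigma> c s - norm (memory \<sigma> c a) * sin (angle \<sigma> c s - Arg (memory \<sigma> c a))\<bar> \<le> s - a"
proof -
  define \<Theta> where "\<Theta> = Arg (memory \<sigma> c a)"
  define R where "R = norm (memory \<sigma> c a)"
  have "memory \<sigma> c a = of_real R * cis \<Theta>"
    using rcis_cmod_Arg[of "memory \<sigma> c a"] by (simp add: rcis_def R_def \<Theta>_def)
  then have "Im (cis (angle \<sigma> c s) * cnj (memory \<sigma> c a)) = R * sin (angle \<sigma> c s - \<Theta>)"
    by (simp add: sin_diff algebra_simps)
  moreover have "\<bar>Im (cis (angle \<sigma> c s) * cnj (memory \<sigma> c s)) - Im (cis (angle \<sigma> c s) * cnj (memory \<sigma> c a))\<bar> \<le> norm (memory \<sigma> c s - memory \<sigma> c a)"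
    using abs_Im_cis_cnj_diff_le[of "angle \<sigma> c s" "memory \<sigma> c s" "angle \<sigma> c s" "memory \<sigma> c a"] by simp
  ultimately show ?thesis
    using norm_memory_diff_le[OF c a, of \<sigma>] unfolding force_eq R_def \<Theta>_def by linarith
qed

text \<open>Here \<open>x\<close> will be the cosine of the relative angle. The terms without
  \<open>K\<close> suffice where \<open>x^2\<close> is at least 3/4. Elsewhere
  \<open>1 - x^2\<close> exceeds 1/4 and \<open>1 + x\<close> is at least 13/100, since the square
  root of 3/4 is below 87/100, and the term with \<open>K\<close> dominates.\<close>

lemma lyapunov_polynomial_bound:
  fixes x K :: real
  assumes x: "\<bar>x\<bar> \<le> 1" and K: "100 \<le> K"
  shows "1 - 2 * x^2 - K * ((1 - x^2) * (1 + x)) \<le> - 1 / 2"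
proof -
  have x2: "x^2 \<le> 1" using x by (simp add: abs_square_le_1)
  have pos: "(1 - x^2) * (1 + x) \<ge> 0" using x x2 by (intro mult_nonneg_nonneg) auto
  show ?thesis
  proof (cases "x^2 \<ge> 3 / 4")
    case True
    then show ?thesis using mult_nonneg_nonneg[OF _ pos, of K] K by linarith
  next
    case False
    have "x \<ge> - (87 / 100)"
    proof (rule ccontr)
      assume "\<not> ?thesis"
      then have "(87/100)^2 \<le> (- x)^2" by (intro power_mono) auto
      then show False using False by (simp add: power2_eq_square)
    qed
    then have *: "(1 / 4) * (13 / 100) \<le> (1 - x^2) * (1 + x)"
      using False by (intro mult_mono) auto
    have "100 * ((1 / 4) * (13 / 100)) \<le> K * ((1 - x^2) * (1 + x))"
      by (rule mult_mono[OF K *]) (use K in auto)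
    moreover have "0 \<le> x^2" by simp
    ultimately show ?thesis by linarith
  qed
qed

text \<open>The angle \<open>y\<close> between the position and the direction of a long memory vector feels a
  drift \<open>R * sin y\<close>.  The test function \<open>cos y + cos (2 * y) / 4\<close> is strictly concave at the
  unstable angle \<open>0\<close> and flat to second order at the stable angle \<open>\<pi>\<close>, which is what makes the
  correction to the length \<open>R\<close> work at both of them.\<close>

definition tst :: "real \<Rightarrow> real" where "tst y = cos y + cos (2 * y) / 4"
definition tst1 :: "real \<Rightarrow> real" where "tst1 y = - sin y * (1 + cos y)"
definition tst2 :: "real \<Rightarrow> real" where "tst2 y = - (cos y + cos (2 * y))"

lemma abs_cos_diff_le: "\<bar>cos x - cos y\<bar> \<le> \<bar>x - y\<bar>" for x y :: real
  using abs_Re_le_cmod[of "cis x - cis y"] norm_cis_diff_le[of x y] by simp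

lemma tst_deriv: "(tst has_real_derivative tst1 y) (at y)" "(tst1 has_real_derivative tst2 y) (at y)"
proof -
  have "(tst has_real_derivative - sin y + - sin (2 * y) * 2 / 4) (at y)"
    unfolding tst_def by (auto intro!: derivative_eq_intros)
  also have "- sin y + - sin (2 * y) * 2 / 4 = tst1 y"
    unfolding tst1_def sin_double by (simp add: algebra_simps)
  finally show "(tst has_real_derivative tst1 y) (at y)" .
  have "(tst1 has_real_derivative - cos y * (1 + cos y) + - sin y * - sin y) (at y)"
    unfolding tst1_def by (auto intro!: derivative_eq_intros)
  also have "- cos y * (1 + cos y) + - sin y * - sin y = tst2 y"
    unfolding tst2_def cos_double by (simp add: power2_eq_square algebra_simps)
  finally show "(tst1 has_real_derivative tst2 y) (at y)" .
qed

lemma tst_bounds: "\<bar>tst y\<bar> \<le> 5 / 4" "\<bar>tst1 y\<bar> \<le> 2" "\<bar>tst2 y\<bar> \<le> 2"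
proof -
  show "\<bar>tst y\<bar> \<le> 5 / 4" "\<bar>tst2 y\<bar> \<le> 2"
    using abs_cos_le_one[of y] abs_cos_le_one[of "2 * y"] unfolding tst_def tst2_def by linarith+
  have "\<bar>1 + cos y\<bar> \<le> 2" using abs_cos_le_one[of y] by linarith
  then have "\<bar>sin y\<bar> * \<bar>1 + cos y\<bar> \<le> 1 * 2"
    using abs_sin_le_one[of y] by (intro mult_mono) auto
  then show "\<bar>tst1 y\<bar> \<le> 2" by (simp add: tst1_def abs_mult)
qed

lemma tst2_lipschitz: "\<bar>tst2 x - tst2 y\<bar> \<le> 3 * \<bar>x - y\<bar>"
proof -
  have "\<bar>2 * x - 2 * y\<bar> = 2 * \<bar>x - y\<bar>" by (simp add: abs_if)
  then show ?thesis
    using abs_cos_diff_le[of x y] abs_cos_diff_le[of "2 * x" "2 * y"] unfolding tst2_def by linarith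
qed

lemma continuous_on_tst[continuous_intros]:
  fixes g :: "real \<Rightarrow> real"
  shows "continuous_on A g \<Longrightarrow> continuous_on A (\<lambda>s. tst1 (g s))" "continuous_on A g \<Longrightarrow> continuous_on A (\<lambda>s. tst2 (g s))"
  unfolding tst1_def tst2_def by (auto intro!: continuous_intros)

lemma tst_measurable[measurable]: "tst \<in> borel_measurable borel"
  unfolding tst_def by measurable

text \<open>With \<open>\<beta> = 2 / \<sigma>^2\<close> the bracket is \<open>\<beta>\<close> times
  the generator applied to \<open>tst\<close>, for a drift \<open>R * sin y\<close> perturbed by
  \<open>e\<close>. Half of the damping \<open>R * (sin y)^2\<close> absorbs the perturbation, by
  completing a square; the other half carries the factor \<open>\<beta> * R / 2\<close>, at least
  100, that \<open>lyapunov_polynomial_bound\<close> asks for.\<close>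

lemma tst_pointwise:
  fixes R e \<beta> L y :: real
  assumes R: "R > 0" and e: "\<bar>e\<bar> \<le> L" and \<beta>: "\<beta> > 0" "200 \<le> \<beta> * R"
  shows "cos y + (\<beta> * ((R * sin y + e) * tst1 y) + tst2 y) \<le> - 1 / 2 + \<beta> * L^2 / R"
proof -
  define s x where "s = sin y" and "x = cos y"
  have s2: "s^2 = 1 - x^2" by (simp add: s_def x_def sin_squared_eq)
  have x: "\<bar>x\<bar> \<le> 1" by (simp add: x_def)
  have "0 \<le> (R * s + e)^2" by simp
  then have "- (2 * R * s * e) \<le> R^2 * s^2 + e^2" by (simp add: power2_sum power_mult_distrib)
  then have "- (s * e) \<le> R * s^2 / 2 + e^2 / (2 * R)"
    using R by (simp add: field_simps power2_eq_square)
  also have "e^2 / (2 * R) \<le> L^2 / (2 * R)"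
    using R e by (intro divide_right_mono) (auto simp: abs_le_square_iff[symmetric])
  finally have "- (s * e) \<le> R * s^2 / 2 + L^2 / (2 * R)" by simp
  then have "- (s * (R * s + e)) \<le> - (R / 2 * s^2) + L^2 / (2 * R)"
    by (simp add: algebra_simps power2_eq_square)
  then have "\<beta> * (1 + x) * (- (s * (R * s + e))) \<le> \<beta> * (1 + x) * (- (R / 2 * s^2) + L^2 / (2 * R))"
    using \<beta> x by (intro mult_left_mono) auto
  also have "\<dots> = - (\<beta> * R / 2 * ((1 - x^2) * (1 + x))) + \<beta> * (1 + x) * (L^2 / (2 * R))"
    by (simp add: s2 algebra_simps)
  also have "\<beta> * (1 + x) * (L^2 / (2 * R)) \<le> \<beta> * 2 * (L^2 / (2 * R))"
    using \<beta> x R by (intro mult_right_mono mult_left_mono) auto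
  finally have "\<beta> * (1 + x) * (- (s * (R * s + e))) \<le> - (\<beta> * R / 2 * ((1 - x^2) * (1 + x))) + \<beta> * L^2 / R"
    using R by (simp add: field_simps)
  moreover have "\<beta> * ((R * sin y + e) * tst1 y) = \<beta> * (1 + x) * (- (s * (R * s + e)))"
    by (simp add: tst1_def s_def x_def algebra_simps)
  moreover have "cos y + tst2 y = 1 - 2 * x^2"
    by (simp add: tst2_def x_def cos_double_cos)
  moreover have "1 - 2 * x^2 - \<beta> * R / 2 * ((1 - x^2) * (1 + x)) \<le> - 1 / 2"
    by (rule lyapunov_polynomial_bound) (use x \<beta> in auto)
  ultimately show ?thesis by linarith
qed

context repelling
begin

text \<open>On a block of length \<open>T\<close> the gain \<open>T / 2\<close> dominates the boundary terms of the test function,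
  which are at most \<open>(2 / \<sigma>\<^sup>2) * (5 / 2) = T / 16\<close>.\<close>

definition T :: real where "T = 80 / \<sigma>^2"
text \<open>For every \<open>R\<close> from \<open>R0\<close> on, the three summands make
  \<open>(2 / \<sigma>^2) * T^2 / R\<close> at most 1/16, \<open>T^2 / (2 * R)\<close> at most
  \<open>T / 16\<close> and \<open>(2 / \<sigma>^2) * R\<close> at least 200.\<close>

definition R0 :: real where "R0 = 16 * (2 / \<sigma>^2) * T^2 + 8 * T + 100 * \<sigma>^2"
text \<open>Over a block the exponent of \<open>V\<close> changes by at most 1/8. The quadratic
  error 1/64 is then half of the gain \<open>\<epsilon> * T / 4 = 1 / 32\<close>, which leaves the
  contraction factor 63/64.\<close>

definition \<epsilon> :: real where "\<epsilon> = 1 / (8 * T)"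
definition V :: "(real \<Rightarrow> real) \<Rightarrow> real \<Rightarrow> real" where "V c t = exp (\<epsilon> * norm (memory \<sigma> c t))"
text \<open>Bounds \<open>V\<close> at the end of a block that starts with a memory shorter than
  \<open>R0\<close>.\<close>

definition C0 :: real where "C0 = exp (\<epsilon> * (R0 + T))"

lemma T_pos: "T > 0" using \<sigma>_pos by (simp add: T_def)
lemma \<epsilon>_pos: "\<epsilon> > 0" using T_pos by (simp add: \<epsilon>_def)
lemma R0_ge: "R0 \<ge> 8 * T" "R0 > 0" "R0 \<ge> 16 * (2 / \<sigma>^2) * T^2" "2 / \<sigma>^2 * R0 \<ge> 200"
proof -
  have p: "16 * (2 / \<sigma>^2) * T^2 \<ge> 0" "8 * T > 0" "100 * \<sigma>^2 \<ge> 0" using \<sigma>_pos T_pos by auto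
  then show "R0 \<ge> 8 * T" "R0 > 0" "R0 \<ge> 16 * (2 / \<sigma>^2) * T^2" unfolding R0_def by linarith+
  have "200 = 2 / \<sigma>^2 * (100 * \<sigma>^2)" using \<sigma>_pos by simp
  also have "\<dots> \<le> 2 / \<sigma>^2 * R0" using p \<sigma>_pos by (intro mult_left_mono) (auto simp: R0_def)
  finally show "2 / \<sigma>^2 * R0 \<ge> 200" .
qed

text \<open>The change of length is at most the integral of the cosine of the relative angle plus a
  quadratic error. The cosine itself has no sign; adding \<open>\<beta>\<close> times the generator
  of \<open>tst\<close> brings it to \<open>- 1 / 2\<close> up to small errors, and by Dynkin's
  formula the expected integral of this addition is only a boundary term.\<close>

lemma lyapunov_drift:
  fixes w :: "(real \<Rightarrow> real) \<Rightarrow> real"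
  assumes a: "0 \<le> a"
    and w: "known a w" "w \<in> borel_measurable paths" "\<And>c. c \<in> space paths \<Longrightarrow> 0 \<le> w c" "\<And>c. c \<in> space paths \<Longrightarrow> w c \<le> Kw"
    and supp: "\<And>c. c \<in> space paths \<Longrightarrow> w c \<noteq> 0 \<Longrightarrow> R0 \<le> norm (memory \<sigma> c a)"
  shows "(\<integral>c. w c * (norm (memory \<sigma> c (a + T)) - norm (memory \<sigma> c a)) \<partial>W) \<le> - (T / 4) * (\<integral>c. w c \<partial>W)"
proof -
  define \<beta> where "\<beta> = 2 / \<sigma>^2"
  have \<beta>: "\<beta> > 0" "\<beta> * (\<sigma>^2 / 2) = 1" "T = 40 * \<beta>" using \<sigma>_pos by (auto simp: \<beta>_def T_def)
  define \<theta> where "\<theta> c = Arg (memory \<sigma> c a)" for c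
  define b where "b = a + T"
  have ab: "a < b" "0 \<le> b" using a T_pos by (auto simp: b_def)
  have [measurable]: "w \<in> borel_measurable paths" "(\<lambda>c. memory \<sigma> c a) \<in> borel_measurable paths"
    "(\<lambda>c. memory \<sigma> c b) \<in> borel_measurable paths"
    using w a ab by auto
  have [measurable]: "\<theta> \<in> borel_measurable paths" unfolding \<theta>_def by measurable
  have k\<theta>: "known a \<theta>" unfolding \<theta>_def by (rule known_comp) simp
  have wabs: "\<bar>w c\<bar> \<le> Kw" if "c \<in> space paths" for c using w(3,4)[OF that] by simp
  have Kw: "Kw \<ge> 0" using wabs[of "\<lambda>_. 0"] by (force simp: space_paths)
  define G where "G c = integral {a..b} (\<lambda>s. force \<sigma> c s * tst1 (angle \<sigma> c s - \<theta> c) + \<sigma>^2 / 2 * tst2 (angle \<sigma> c s - \<theta> c))" for c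
  define E where "E c = tst (angle \<sigma> c b - \<theta> c) - tst (angle \<sigma> c a - \<theta> c)" for c
  have cG: "continuous_on {a..b} (\<lambda>s. force \<sigma> c s * tst1 (angle \<sigma> c s - \<theta> c) + \<sigma>^2 / 2 * tst2 (angle \<sigma> c s - \<theta> c))"
    if "c \<in> space paths" for c
    by (intro continuous_intros continuous_on_force continuous_on_angle that a)
  have mG: "G \<in> borel_measurable paths"
    unfolding G_def
  proof (rule borel_measurable_integral_path[OF _ _ cG])
    fix s assume s: "s \<in> {a..b}"
    have [measurable]: "(\<lambda>c. force \<sigma> c s) \<in> borel_measurable paths" "(\<lambda>c. angle \<sigma> c s) \<in> borel_measurable paths"
      using s a by auto
    show "(\<lambda>c. force \<sigma> c s * tst1 (angle \<sigma> c s - \<theta> c) + \<sigma>^2 / 2 * tst2 (angle \<sigma> c s - \<theta> c)) \<in> borel_measurable paths"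
      unfolding tst1_def tst2_def by measurable
  qed (use ab in auto)
  have bG: "\<bar>G c\<bar> \<le> (b * 2 + \<sigma>^2 / 2 * 2) * (b - a)" if c: "c \<in> space paths" for c
  proof -
    have "norm (G c) \<le> (b * 2 + \<sigma>^2 / 2 * 2) * (b - a)"
      unfolding G_def
    proof (rule integral_bound[OF _ cG[OF c]])
      fix s assume s: "s \<in> {a..b}"
      have "\<bar>force \<sigma> c s * tst1 (angle \<sigma> c s - \<theta> c)\<bar> \<le> b * 2"
        unfolding abs_mult using abs_force_le[OF c, of s] s a by (intro mult_mono tst_bounds) auto
      moreover have "\<bar>\<sigma>^2 / 2 * tst2 (angle \<sigma> c s - \<theta> c)\<bar> \<le> \<sigma>^2 / 2 * 2"
        using tst_bounds(3)[of "angle \<sigma> c s - \<theta> c"] mult_left_mono[of "\<bar>tst2 (angle \<sigma> c s - \<theta> c)\<bar>" 2 "\<sigma>^2 / 2"] by (simp add: abs_mult)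
      ultimately show "norm (force \<sigma> c s * tst1 (angle \<sigma> c s - \<theta> c) + \<sigma>^2 / 2 * tst2 (angle \<sigma> c s - \<theta> c)) \<le> b * 2 + \<sigma>^2 / 2 * 2"
        by simp
    qed (use ab in auto)
    then show ?thesis by simp
  qed
  have mE: "E \<in> borel_measurable paths"
  proof -
    have [measurable]: "(\<lambda>c. angle \<sigma> c a) \<in> borel_measurable paths" "(\<lambda>c. angle \<sigma> c b) \<in> borel_measurable paths"
      using a ab by auto
    show ?thesis unfolding E_def by measurable
  qed
  have bE: "\<bar>E c\<bar> \<le> 5 / 2" for c
    using tst_bounds(1)[of "angle \<sigma> c b - \<theta> c"] tst_bounds(1)[of "angle \<sigma> c a - \<theta> c"] unfolding E_def by linarith
  have iw: "integrable W w" by (rule integrable_bounded[OF w(2) wabs])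
  have iG: "integrable W (\<lambda>c. w c * G c)"
  proof (rule integrable_bounded)
    show "\<bar>w c * G c\<bar> \<le> Kw * ((b * 2 + \<sigma>^2 / 2 * 2) * (b - a))" if "c \<in> space paths" for c
      unfolding abs_mult using wabs[OF that] bG[OF that] Kw by (intro mult_mono) auto
  qed (use mG in measurable)
  have iE: "integrable W (\<lambda>c. w c * E c)"
  proof (rule integrable_bounded)
    show "\<bar>w c * E c\<bar> \<le> Kw * (5 / 2)" if "c \<in> space paths" for c
      unfolding abs_mult using wabs[OF that] bE Kw by (intro mult_mono) auto
  qed (use mE in measurable)
  have dyn: "(\<integral>c. w c * E c \<partial>W) = (\<integral>c. w c * G c \<partial>W)"
    unfolding E_def G_def
  proof (rule dynkin[OF a ab(1) w(1,2) wabs k\<theta> _ tst_deriv tst2_lipschitz])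
    show "continuous_on UNIV tst2" unfolding tst2_def by (intro continuous_intros)
    show "\<bar>tst x\<bar> \<le> 3" "\<bar>tst1 x\<bar> \<le> 3" "\<bar>tst2 x\<bar> \<le> 3" for x
      using tst_bounds[of x] by linarith+
  qed simp_all
  \<comment> \<open>\<open>3 / 8\<close> is \<open>1 / 2\<close> minus two errors of
    \<open>1 / 16\<close>, one from freezing the memory and one from expanding the length.\<close>
  have pw: "w c * (norm (memory \<sigma> c b) - norm (memory \<sigma> c a)) \<le> - (3 * T / 8) * w c - \<beta> * (w c * G c)" if c: "c \<in> space paths" for c
  proof (cases "w c = 0")
    case False
    define R where "R = norm (memory \<sigma> c a)"
    have R: "R \<ge> R0" "R > 0" "T \<le> R" using supp[OF c False] R0_ge T_pos by (auto simp: R_def)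
    define Y where "Y s = angle \<sigma> c s - \<theta> c" for s
    have cY: "continuous_on {a..b} Y" unfolding Y_def by (intro continuous_intros continuous_on_angle c a)
    have pt: "cos (Y s) + \<beta> * (force \<sigma> c s * tst1 (Y s) + \<sigma>^2 / 2 * tst2 (Y s)) \<le> - 1 / 2 + \<beta> * T^2 / R"
      if s: "s \<in> {a..b}" for s
    proof -
      define e where "e = force \<sigma> c s - R * sin (Y s)"
      have "\<bar>e\<bar> \<le> T"
        using force_close_to_sin[OF c a, of s \<sigma>] s by (simp add: e_def R_def Y_def \<theta>_def b_def)
      moreover have "200 \<le> \<beta> * R"
        using R0_ge(4) R(1) \<beta>(1) mult_left_mono[of R0 R \<beta>] unfolding \<beta>_def[symmetric] by linarith
      ultimately have "cos (Y s) + (\<beta> * ((R * sin (Y s) + e) * tst1 (Y s)) + tst2 (Y s)) \<le> - 1 / 2 + \<beta> * T^2 / R"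
        by (intro tst_pointwise R \<beta>)
      moreover have "\<beta> * (\<sigma>^2 / 2 * tst2 (Y s)) = tst2 (Y s)"
        using \<beta>(2) by (metis mult.assoc mult_1)
      moreover have "R * sin (Y s) + e = force \<sigma> c s" by (simp add: e_def)
      ultimately show ?thesis by (simp only: distrib_left)
    qed
    have icos: "(\<lambda>s. cos (Y s)) integrable_on {a..b}"
      by (intro integrable_continuous_interval continuous_intros cY)
    have iGc: "(\<lambda>s. force \<sigma> c s * tst1 (Y s) + \<sigma>^2 / 2 * tst2 (Y s)) integrable_on {a..b}"
      using integrable_continuous_interval[OF cG[OF c]] by (simp add: Y_def)
    have "integral {a..b} (\<lambda>s. cos (Y s)) + \<beta> * G c
        = integral {a..b} (\<lambda>s. cos (Y s) + \<beta> * (force \<sigma> c s * tst1 (Y s) + \<sigma>^2 / 2 * tst2 (Y s)))"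
      using Henstock_Kurzweil_Integration.integral_add[OF icos integrable_on_mult_right[OF iGc, of \<beta>]]
      by (simp add: G_def Y_def)
    also have "\<dots> \<le> integral {a..b} (\<lambda>s. - 1 / 2 + \<beta> * T^2 / R)"
      by (rule integral_le) (use pt icos iGc in \<open>auto intro!: Henstock_Kurzweil_Integration.integrable_add integrable_on_mult_right\<close>)
    also have "\<dots> = (- 1 / 2 + \<beta> * T^2 / R) * T" using ab by (simp add: b_def)
    finally have "integral {a..b} (\<lambda>s. cos (Y s)) + \<beta> * G c \<le> - T / 2 + \<beta> * T^2 / R * T"
      by (simp add: algebra_simps)
    moreover have "\<beta> * T^2 / R \<le> 1 / 16"
      using R0_ge(3) R by (simp add: \<beta>_def[symmetric] divide_simps)
    then have "\<beta> * T^2 / R * T \<le> 1 / 16 * T" using T_pos by (intro mult_right_mono) auto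
    moreover have "T^2 / (2 * R) \<le> T / 16"
    proof -
      have "8 * T * T \<le> R * T" using R0_ge(1) R T_pos by (intro mult_right_mono) auto
      then show ?thesis using R T_pos by (simp add: field_simps power2_eq_square)
    qed
    moreover have "norm (memory \<sigma> c b) \<le> R + integral {a..b} (\<lambda>s. cos (Y s)) + T^2 / (2 * R)"
      using norm_memory_increment_le[OF c a, of T \<sigma>] R T_pos unfolding R_def[symmetric] b_def Y_def \<theta>_def by auto
    ultimately have "norm (memory \<sigma> c b) - R \<le> - (3 * T / 8) - \<beta> * G c" by linarith
    then have "w c * (norm (memory \<sigma> c b) - R) \<le> w c * (- (3 * T / 8) - \<beta> * G c)"
      using w(3)[OF c] by (rule mult_left_mono)
    then show ?thesis by (simp add: R_def algebra_simps)
  qed simp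
  have "(\<integral>c. w c * (norm (memory \<sigma> c b) - norm (memory \<sigma> c a)) \<partial>W) \<le> (\<integral>c. - (3 * T / 8) * w c - \<beta> * (w c * G c) \<partial>W)"
  proof (rule integral_mono)
    show "integrable W (\<lambda>c. w c * (norm (memory \<sigma> c b) - norm (memory \<sigma> c a)))"
    proof (rule integrable_bounded)
      fix c assume c: "c \<in> space paths"
      have "\<bar>norm (memory \<sigma> c b) - norm (memory \<sigma> c a)\<bar> \<le> T"
        using norm_triangle_ineq3[of "memory \<sigma> c b" "memory \<sigma> c a"] norm_memory_diff_le[OF c a, of b \<sigma>] ab by (simp add: b_def)
      then show "\<bar>w c * (norm (memory \<sigma> c b) - norm (memory \<sigma> c a))\<bar> \<le> Kw * T"
        unfolding abs_mult using wabs[OF c] Kw by (intro mult_mono) auto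
    qed measurable
  qed (use iw iG pw in \<open>auto simp: space_W\<close>)
  also have "\<dots> = - (3 * T / 8) * (\<integral>c. w c \<partial>W) - \<beta> * (\<integral>c. w c * E c \<partial>W)"
    unfolding dyn using iw iG by simp
  also have "\<dots> \<le> - (T / 4) * (\<integral>c. w c \<partial>W)"
  proof -
    \<comment> \<open>The boundary term costs at most \<open>\<beta> * (5 / 2) = T / 16\<close>, and
      \<open>3 / 8 - 1 / 16\<close> still exceeds \<open>1 / 4\<close>.\<close>
    have "(\<integral>c. - (5 / 2) * w c \<partial>W) \<le> (\<integral>c. w c * E c \<partial>W)"
    proof (rule integral_mono)
      fix c assume "c \<in> space W"
      then have c: "c \<in> space paths" by (simp add: space_W)
      have "w c * (- (5 / 2)) \<le> w c * E c" using bE[of c] w(3)[OF c] by (intro mult_left_mono) (auto simp: abs_le_iff)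
      then show "- (5 / 2) * w c \<le> w c * E c" by simp
    qed (use iw iE in auto)
    then have "- (5 / 2) * (\<integral>c. w c \<partial>W) \<le> (\<integral>c. w c * E c \<partial>W)" using iw by simp
    then have "\<beta> * (- (5 / 2) * (\<integral>c. w c \<partial>W)) \<le> \<beta> * (\<integral>c. w c * E c \<partial>W)"
      using \<beta> by (intro mult_left_mono) auto
    moreover have "(\<integral>c. w c \<partial>W) \<ge> 0" by (rule integral_nonneg_AE, rule AE_I2) (use w(3) in \<open>auto simp: space_W\<close>)
    then have "\<beta> * (\<integral>c. w c \<partial>W) \<ge> 0" using \<beta> by simp
    ultimately show ?thesis unfolding \<beta>(3) by (simp add: algebra_simps)
  qed
  finally show ?thesis by (simp add: b_def)
qed

end

section \<open>Geometric drift of the exponential moment\<close>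

lemma exp_le_quadratic: "\<bar>x\<bar> \<le> 1 \<Longrightarrow> exp x \<le> 1 + x + x^2" for x :: real
proof (cases "x \<ge> 0")
  case True
  then show "\<bar>x\<bar> \<le> 1 \<Longrightarrow> ?thesis" by (simp add: exp_bound)
next
  case False
  define y where "y = - x"
  assume "\<bar>x\<bar> \<le> 1"
  then have y: "0 \<le> y" "y \<le> 1" using False by (auto simp: y_def)
  have "1 + y + y^2 / 2 \<le> exp y" using exp_lower_Taylor_quadratic[OF y(1)] .
  moreover have "1 \<le> (1 - y + y^2) * (1 + y + y^2 / 2)"
  proof -
    have "(1 - y + y^2) * (1 + y + y^2 / 2) - 1 = y^2 / 2 * (1 + y + y^2)"
      by (simp add: field_simps power2_eq_square)
    moreover have "0 \<le> y^2 / 2 * (1 + y + y^2)" using y by simp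
    ultimately show ?thesis by linarith
  qed
  moreover have "0 < 1 - y + y^2"
    using y zero_le_power2[of y] by (cases "y = 1") (auto simp: add_pos_nonneg)
  ultimately have "1 \<le> (1 - y + y^2) * exp y"
    by (meson less_imp_le mult_left_mono order_trans)
  then have "exp (- y) \<le> 1 - y + y^2"
    by (simp add: exp_minus divide_simps)
  then show ?thesis by (simp add: y_def)
qed

context repelling
begin

lemma V_ge_1: "V c t \<ge> 1"
  using \<epsilon>_pos by (simp add: V_def)

lemma V_le: "c \<in> space paths \<Longrightarrow> 0 \<le> t \<Longrightarrow> V c t \<le> exp (\<epsilon> * t)"
  using \<epsilon>_pos norm_memory_le[of c t \<sigma>] by (simp add: V_def)

lemma V_measurable[measurable]: "0 \<le> t \<Longrightarrow> (\<lambda>c. V c t) \<in> borel_measurable paths"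
  unfolding V_def using measurable_memory[of t \<sigma>] by simp

lemma known_V: "t \<le> a \<Longrightarrow> known a (\<lambda>c. V c t)"
  unfolding V_def by (rule known_comp) simp

lemma abs_norm_memory_diff_le: "c \<in> space paths \<Longrightarrow> 0 \<le> s \<Longrightarrow> s \<le> t \<Longrightarrow> \<bar>norm (memory \<sigma> c t) - norm (memory \<sigma> c s)\<bar> \<le> t - s"
  using norm_triangle_ineq3[of "memory \<sigma> c t" "memory \<sigma> c s"] norm_memory_diff_le[of c s t \<sigma>] by linarith

text \<open>From below \<open>R0\<close> the value after one block is at most \<open>C0\<close>;
  from above, the exponential is expanded to second order and the linear term is controlled by
  \<open>lyapunov_drift\<close>. The weight is arbitrary because the estimate is needed again on the
  event that no sign change has occurred so far.\<close>

lemma lyapunov_exp: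
  fixes w :: "(real \<Rightarrow> real) \<Rightarrow> real"
  assumes a: "0 \<le> a"
    and w: "known a w" "w \<in> borel_measurable paths" "\<And>c. c \<in> space paths \<Longrightarrow> 0 \<le> w c" "\<And>c. c \<in> space paths \<Longrightarrow> w c \<le> Kw"
  shows "(\<integral>c. w c * V c (a + T) \<partial>W) \<le> 63 / 64 * (\<integral>c. w c * V c a \<partial>W) + C0 * (\<integral>c. w c \<partial>W)"
proof -
  have aT: "0 \<le> a + T" using a T_pos by simp
  have [measurable]: "w \<in> borel_measurable paths" "(\<lambda>c. memory \<sigma> c a) \<in> borel_measurable paths"
    "(\<lambda>c. memory \<sigma> c (a + T)) \<in> borel_measurable paths" "(\<lambda>c. V c a) \<in> borel_measurable paths"
    "(\<lambda>c. V c (a + T)) \<in> borel_measurable paths"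
    using w a aT by auto
  have Kw: "Kw \<ge> 0" using w(3,4)[of "\<lambda>_. 0"] by (force simp: space_paths)
  define far :: "(real \<Rightarrow> real) \<Rightarrow> real" where "far c = (if R0 \<le> norm (memory \<sigma> c a) then 1 else 0)" for c
  \<comment> \<open>At the fixed time \<open>a\<close> the factor \<open>V c a\<close> is at most
    \<open>exp (\<epsilon> * a)\<close>, so it may be absorbed into a bounded weight supported where
    the memory is long.\<close>
  define w1 where "w1 c = w c * V c a * far c" for c
  define dR where "dR c = norm (memory \<sigma> c (a + T)) - norm (memory \<sigma> c a)" for c
  have [measurable]: "w1 \<in> borel_measurable paths" "dR \<in> borel_measurable paths"
    unfolding w1_def far_def dR_def by measurable
  have k1: "known a w1"
    unfolding w1_def far_def by (intro known_comp2[where f = "(*)"] w(1) known_V known_comp[OF known_memory, where f = "\<lambda>z. if R0 \<le> norm z then 1 else 0"]) auto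
  have w1: "0 \<le> w1 c" "w1 c \<le> Kw * exp (\<epsilon> * a)" "w1 c \<le> w c * V c a" if c: "c \<in> space paths" for c
  proof -
    have V0: "0 \<le> V c a" using V_ge_1[of c a] by linarith
    show "0 \<le> w1 c" using w(3)[OF c] V0 by (simp add: w1_def far_def)
    show le: "w1 c \<le> w c * V c a" using w(3)[OF c] V0 by (simp add: w1_def far_def)
    have "w c * V c a \<le> Kw * exp (\<epsilon> * a)"
      using w(3,4)[OF c] V0 V_le[OF c a] Kw by (intro mult_mono) auto
    with le show "w1 c \<le> Kw * exp (\<epsilon> * a)" by linarith
  qed
  have dR: "\<bar>dR c\<bar> \<le> T" if "c \<in> space paths" for c
    using abs_norm_memory_diff_le[OF that a, of "a + T"] T_pos by (simp add: dR_def)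
  have pw: "w c * V c (a + T) \<le> (1 + 1 / 64) * w1 c + \<epsilon> * (w1 c * dR c) + C0 * w c" if c: "c \<in> space paths" for c
  proof (cases "R0 \<le> norm (memory \<sigma> c a)")
    case True
    have V: "V c (a + T) = V c a * exp (\<epsilon> * dR c)"
      by (simp add: V_def dR_def exp_add[symmetric] algebra_simps)
    have small: "\<bar>\<epsilon> * dR c\<bar> \<le> 1 / 8"
    proof -
      have "\<bar>\<epsilon> * dR c\<bar> \<le> \<epsilon> * T" unfolding abs_mult using dR[OF c] \<epsilon>_pos by (intro mult_mono) auto
      then show ?thesis using T_pos by (simp add: \<epsilon>_def)
    qed
    then have "exp (\<epsilon> * dR c) \<le> 1 + \<epsilon> * dR c + (\<epsilon> * dR c)^2" by (intro exp_le_quadratic) simp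
    also have "(\<epsilon> * dR c)^2 \<le> (1 / 8)^2" using power_mono[OF small, of 2] by simp
    finally have "exp (\<epsilon> * dR c) \<le> (1 + 1 / 64) + \<epsilon> * dR c" by (simp add: power2_eq_square)
    then have "w1 c * exp (\<epsilon> * dR c) \<le> w1 c * ((1 + 1 / 64) + \<epsilon> * dR c)"
      using w1(1)[OF c] by (rule mult_left_mono)
    moreover have "w c * V c (a + T) = w1 c * exp (\<epsilon> * dR c)"
      using True by (simp add: V w1_def far_def)
    moreover have "0 \<le> C0 * w c" using w(3)[OF c] by (simp add: C0_def)
    ultimately show ?thesis by (simp add: algebra_simps)
  next
    case False
    have "norm (memory \<sigma> c (a + T)) \<le> R0 + T" using False dR[OF c] by (simp add: dR_def)
    then have "V c (a + T) \<le> C0" using \<epsilon>_pos by (simp add: V_def C0_def)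
    then have "w c * V c (a + T) \<le> w c * C0" using w(3)[OF c] by (rule mult_left_mono)
    then show ?thesis using False by (simp add: w1_def far_def mult.commute)
  qed
  have i1: "integrable W w1" by (rule integrable_bounded) (use w1 in auto)
  have iw: "integrable W w" by (rule integrable_bounded[where K = Kw]) (use w in auto)
  have iwV: "integrable W (\<lambda>c. w c * V c a)"
  proof (rule integrable_bounded)
    fix c assume c: "c \<in> space paths"
    show "\<bar>w c * V c a\<bar> \<le> Kw * exp (\<epsilon> * a)" unfolding abs_mult
      using w(3,4)[OF c] V_ge_1[of c a] V_le[OF c a] Kw by (intro mult_mono) auto
  qed measurable
  have iwV': "integrable W (\<lambda>c. w c * V c (a + T))"
  proof (rule integrable_bounded)
    fix c assume c: "c \<in> space paths"
    show "\<bar>w c * V c (a + T)\<bar> \<le> Kw * exp (\<epsilon> * (a + T))" unfolding abs_mult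
      using w(3,4)[OF c] V_ge_1[of c "a + T"] V_le[OF c aT] Kw by (intro mult_mono) auto
  qed measurable
  have id: "integrable W (\<lambda>c. w1 c * dR c)"
  proof (rule integrable_bounded)
    fix c assume c: "c \<in> space paths"
    show "\<bar>w1 c * dR c\<bar> \<le> (Kw * exp (\<epsilon> * a)) * T" unfolding abs_mult
      using w1[OF c] dR[OF c] Kw by (intro mult_mono) auto
  qed measurable
  have drift: "(\<integral>c. w1 c * dR c \<partial>W) \<le> - (T / 4) * (\<integral>c. w1 c \<partial>W)"
    unfolding dR_def
    by (rule lyapunov_drift[OF a k1 _ w1(1,2)]) (auto simp: w1_def far_def split: if_splits)
  have nn: "0 \<le> (\<integral>c. w1 c \<partial>W)"
    by (rule integral_nonneg_AE, rule AE_I2) (use w1(1) in \<open>auto simp: space_W\<close>)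
  have "(\<integral>c. w c * V c (a + T) \<partial>W) \<le> (\<integral>c. (1 + 1 / 64) * w1 c + \<epsilon> * (w1 c * dR c) + C0 * w c \<partial>W)"
    by (rule integral_mono[OF iwV']) (use i1 id iw pw in \<open>auto simp: space_W\<close>)
  also have "\<dots> = (1 + 1 / 64) * (\<integral>c. w1 c \<partial>W) + \<epsilon> * (\<integral>c. w1 c * dR c \<partial>W) + C0 * (\<integral>c. w c \<partial>W)"
    using i1 id iw by simp
  also have "\<epsilon> * (\<integral>c. w1 c * dR c \<partial>W) \<le> \<epsilon> * (- (T / 4) * (\<integral>c. w1 c \<partial>W))"
    using drift \<epsilon>_pos by (intro mult_left_mono) auto
  also have "\<dots> = - (1 / 32) * (\<integral>c. w1 c \<partial>W)" using T_pos by (simp add: \<epsilon>_def)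
  finally have "(\<integral>c. w c * V c (a + T) \<partial>W) \<le> 63 / 64 * (\<integral>c. w1 c \<partial>W) + C0 * (\<integral>c. w c \<partial>W)" by simp
  moreover have "(\<integral>c. w1 c \<partial>W) \<le> (\<integral>c. w c * V c a \<partial>W)"
    by (rule integral_mono[OF i1 iwV]) (use w1(3) in \<open>auto simp: space_W\<close>)
  ultimately show ?thesis by simp
qed

definition block_time :: "nat \<Rightarrow> real" where "block_time n = real n * T"

lemma block_time_nonneg[simp]: "0 \<le> block_time n" using T_pos by (simp add: block_time_def)
lemma block_time_Suc: "block_time (Suc n) = block_time n + T" by (simp add: block_time_def algebra_simps)
lemma block_time_mono: "m \<le> n \<Longrightarrow> block_time m \<le> block_time n" using T_pos by (simp add: block_time_def mult_right_mono)

lemma integrable_V: "integrable W (\<lambda>c. V c (block_time n))"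
proof (rule integrable_bounded)
  show "\<bar>V c (block_time n)\<bar> \<le> exp (\<epsilon> * block_time n)" if "c \<in> space paths" for c
    using V_le[OF that block_time_nonneg, of n] V_ge_1[of c "block_time n"] by simp
qed simp

text \<open>\<open>64 * C0\<close> is the fixed point of multiplying by 63/64 and adding
  \<open>C0\<close>; the 1 accounts for the initial value.\<close>

lemma expectation_V_le: "(\<integral>c. V c (block_time n) \<partial>W) \<le> 1 + 64 * C0"
proof (induction n)
  case 0
  have "V c (block_time 0) = 1" for c by (simp add: V_def block_time_def memory_def)
  then show ?case by (simp add: prob_space C0_def)
next
  case (Suc n)
  have "(\<integral>c. 1 * V c (block_time n + T) \<partial>W) \<le> 63 / 64 * (\<integral>c. 1 * V c (block_time n) \<partial>W) + C0 * (\<integral>c. 1 \<partial>W)"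
    by (rule lyapunov_exp[where Kw = 1]) auto
  then show ?case using Suc by (simp add: block_time_Suc prob_space)
qed

section \<open>Paths that force a sign change of the drift\<close>

lemma exists_sin_eq_one:
  obtains y where "x \<le> y" "y \<le> x + 2 * pi" "sin y = (1::real)"
proof -
  define k where "k = \<lceil>(x - pi / 2) / (2 * pi)\<rceil>"
  define y where "y = pi / 2 + 2 * pi * of_int k"
  have "(x - pi / 2) / (2 * pi) \<le> of_int k" "of_int k < (x - pi / 2) / (2 * pi) + 1"
    unfolding k_def by linarith+
  then have "x \<le> y" "y \<le> x + 2 * pi" by (auto simp: y_def field_simps)
  moreover have "sin y = 1" unfolding y_def sin_add by (simp add: cos_int_2pin)
  ultimately show thesis by (rule that)
qed

lemma exists_sin_eq_minus_one:
  obtains y where "x \<le> y" "y \<le> x + 2 * pi" "sin y = (-1::real)"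
proof -
  obtain y where "x - pi \<le> y" "y \<le> x - pi + 2 * pi" "sin y = 1" by (rule exists_sin_eq_one)
  then show thesis by (intro that[of "y + pi"]) auto
qed

text \<open>Strict inequalities make this stable under small perturbations of a continuous function,
  hence visible on every sufficiently fine grid and through the integrals of the positive and
  negative parts.\<close>

definition sign_change :: "(real \<Rightarrow> real) \<Rightarrow> real \<Rightarrow> real \<Rightarrow> bool" where
  "sign_change c a b \<longleftrightarrow> (\<exists>s\<in>{a..b}. force \<sigma> c s > 0) \<and> (\<exists>s\<in>{a..b}. force \<sigma> c s < 0)"

lemma sign_change_mono: "sign_change c a b \<Longrightarrow> a' \<le> a \<Longrightarrow> b \<le> b' \<Longrightarrow> sign_change c a' b'"
  unfolding sign_change_def by fastforce

lemma known_sign_change: "0 \<le> a \<Longrightarrow> b \<le> t \<Longrightarrow> known t (\<lambda>c. sign_change c a b)"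
proof (rule knownI)
  fix c c' :: "real \<Rightarrow> real" assume a: "0 \<le> a" "b \<le> t" and e: "\<And>s. 0 \<le> s \<Longrightarrow> s \<le> t \<Longrightarrow> c s = c' s"
  have "force \<sigma> c s = force \<sigma> c' s" if "s \<in> {a..b}" for s
    by (rule knownD[OF known_force[of s t]]) (use that a e in auto)
  then show "sign_change c a b = sign_change c' a b" by (simp add: sign_change_def)
qed

text \<open>A continuous function is positive somewhere on the interval exactly when the integral of
  its positive part does not vanish.\<close>

lemma measurable_sign_change:
  assumes ab: "0 \<le> a" "a < b"
  shows "Measurable.pred paths (\<lambda>c. sign_change c a b)"
proof -
  have ex: "(\<exists>s\<in>{a..b}. g s > 0) \<longleftrightarrow> integral {a..b} (\<lambda>s. max 0 (g s)) \<noteq> 0" if g: "continuous_on {a..b} g" for g :: "real \<Rightarrow> real"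
    using integral_eq_0_iff[of a b "\<lambda>s. max 0 (g s)"] ab g by (force intro!: continuous_intros)
  have "sign_change c a b \<longleftrightarrow> integral {a..b} (\<lambda>s. max 0 (force \<sigma> c s)) \<noteq> 0 \<and> integral {a..b} (\<lambda>s. max 0 (- force \<sigma> c s)) \<noteq> 0"
    if c: "c \<in> space paths" for c
    unfolding sign_change_def using ex[of "force \<sigma> c"] ex[of "\<lambda>s. - force \<sigma> c s"] continuous_on_force[OF c ab(1), of b \<sigma>]
    by (auto intro!: continuous_intros)
  moreover have [measurable]: "(\<lambda>c. integral {a..b} (\<lambda>s. max 0 (force \<sigma> c s))) \<in> borel_measurable paths"
    "(\<lambda>c. integral {a..b} (\<lambda>s. max 0 (- force \<sigma> c s))) \<in> borel_measurable paths"
    using ab by (auto intro!: borel_measurable_integral_path borel_measurable_max borel_measurable_uminus measurable_force continuous_intros continuous_on_force)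
  ultimately show ?thesis by (subst measurable_cong) (assumption, measurable)
qed

text \<open>While the memory moves by at most \<open>\<delta>\<close>, the drift stays within
  \<open>\<delta> < R\<close> of \<open>R\<close> times the sine of the relative angle. Running
  through more than a full turn, this angle meets points where the sine is 1 and where it is
  -1.\<close>

lemma run_sign_change:
  assumes c: "c \<in> space paths" and a: "0 \<le> a" and \<delta>: "0 < \<delta>" "2 * \<delta> \<le> norm (memory \<sigma> c a)"
    and run: "3 * pi \<le> angle \<sigma> c (a + \<delta>) - angle \<sigma> c a"
  shows "sign_change c a (a + \<delta>)"
proof -
  define \<Theta> where "\<Theta> = Arg (memory \<sigma> c a)"
  define R where "R = norm (memory \<sigma> c a)"
  have cX: "continuous_on {a..a + \<delta>} (angle \<sigma> c)" by (rule continuous_on_angle[OF c a])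
  have att: "\<exists>s\<in>{a..a + \<delta>}. angle \<sigma> c s - \<Theta> = y" if "angle \<sigma> c a - \<Theta> \<le> y" "y \<le> angle \<sigma> c a - \<Theta> + 2 * pi" for y
    using IVT'[of "angle \<sigma> c" a "y + \<Theta>" "a + \<delta>"] that run \<delta>(1) cX pi_gt_zero by (force simp: algebra_simps)
  have close: "\<bar>force \<sigma> c s - R * sin (angle \<sigma> c s - \<Theta>)\<bar> < R" if "s \<in> {a..a + \<delta>}" for s
    using force_close_to_sin[OF c a, of s \<sigma>] that \<delta> unfolding R_def \<Theta>_def by auto
  obtain y where "angle \<sigma> c a - \<Theta> \<le> y" "y \<le> angle \<sigma> c a - \<Theta> + 2 * pi" "sin y = 1" by (rule exists_sin_eq_one)
  with att obtain s where s: "s \<in> {a..a + \<delta>}" "sin (angle \<sigma> c s - \<Theta>) = 1" by blast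
  obtain y' where "angle \<sigma> c a - \<Theta> \<le> y'" "y' \<le> angle \<sigma> c a - \<Theta> + 2 * pi" "sin y' = -1" by (rule exists_sin_eq_minus_one)
  with att obtain s' where s': "s' \<in> {a..a + \<delta>}" "sin (angle \<sigma> c s' - \<Theta>) = -1" by blast
  have "force \<sigma> c s > 0" "force \<sigma> c s' < 0"
    using close[OF s(1)] close[OF s'(1)] s(2) s'(2) by auto
  then show ?thesis using s(1) s'(1) by (auto simp: sign_change_def)
qed

text \<open>Measures how much the noise turns the position on \<open>[a, b]\<close>; unlike a supremum it needs no maximal
  inequality to be shown small.\<close>

definition wobble :: "(real \<Rightarrow> real) \<Rightarrow> real \<Rightarrow> real \<Rightarrow> real" where
  "wobble c a b = integral {a..b} (\<lambda>s. norm (cis (\<sigma> * (c s - c a)) - 1))"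

text \<open>The velocity of the memory is \<open>cis\<close> of the angle. If noise and drift hardly
  turn the angle, the displacement is close to \<open>\<kappa>\<close> in the initial direction;
  noise and drift spoil at most \<open>\<kappa> / 4\<close> each.\<close>

lemma stay_moves_memory:
  assumes c: "c \<in> space paths" and a: "0 \<le> a" and \<kappa>: "0 < \<kappa>" "\<kappa> * (norm (memory \<sigma> c a) + \<kappa>) \<le> 1 / 4"
    and stay: "wobble c a (a + \<kappa>) \<le> \<kappa> / 4"
  shows "\<kappa> / 2 \<le> norm (memory \<sigma> c (a + \<kappa>) - memory \<sigma> c a)"
proof -
  define b where "b = a + \<kappa>"
  have cw: "continuous_on {a..b} (\<lambda>s. norm (cis (\<sigma> * (c s - c a)) - 1))"
    by (intro continuous_intros continuous_on_path[OF c a])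
  have le: "norm (cis (angle \<sigma> c s) - cis (angle \<sigma> c a)) \<le> norm (cis (\<sigma> * (c s - c a)) - 1) + 1 / 4" if s: "s \<in> {a..b}" for s
  proof -
    define d where "d = integral {a..s} (force \<sigma> c)"
    have "norm d \<le> (norm (memory \<sigma> c a) + \<kappa>) * (s - a)"
      unfolding d_def
    proof (rule integral_bound)
      fix r assume r: "r \<in> {a..s}"
      have "norm (memory \<sigma> c r) \<le> norm (memory \<sigma> c a) + (r - a)"
        using abs_norm_memory_diff_le[OF c a, of r] r by auto
      then show "norm (force \<sigma> c r) \<le> norm (memory \<sigma> c a) + \<kappa>"
        using abs_force_le_norm_memory[of \<sigma> c r] r s by (auto simp: b_def)
    qed (use s in \<open>auto intro: continuous_on_force[OF c a]\<close>)
    also have "\<dots> \<le> (norm (memory \<sigma> c a) + \<kappa>) * \<kappa>" using s \<kappa>(1) by (intro mult_left_mono) (auto simp: b_def)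
    also have "\<dots> \<le> 1 / 4" using \<kappa>(2) by (simp add: mult.commute)
    finally have d: "\<bar>d\<bar> \<le> 1 / 4" by simp
    define e where "e = \<sigma> * (c s - c a)"
    have Xs: "angle \<sigma> c s = angle \<sigma> c a + (e + d)"
      using angle_restart[OF c a, of s \<sigma>] s by (simp add: d_def e_def)
    have "cis (angle \<sigma> c s) - cis (angle \<sigma> c a) = cis (angle \<sigma> c a) * (cis (e + d) - 1)"
      unfolding Xs by (simp add: cis_mult[symmetric] algebra_simps)
    then have "norm (cis (angle \<sigma> c s) - cis (angle \<sigma> c a)) = norm ((cis e - 1) + (cis (e + d) - cis e))"
      by (simp add: norm_mult)
    also have "\<dots> \<le> norm (cis e - 1) + \<bar>(e + d) - e\<bar>"
      by (rule order_trans[OF norm_triangle_ineq add_left_mono[OF norm_cis_diff_le]])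
    finally show ?thesis using d by (simp add: e_def)
  qed
  have int: "(\<lambda>s. cis (angle \<sigma> c s) - cis (angle \<sigma> c a)) integrable_on {a..b}" "(\<lambda>s. cis (angle \<sigma> c s)) integrable_on {a..b}"
    by (intro integrable_continuous_interval continuous_intros continuous_on_angle[OF c a])+
  have "norm (integral {a..b} (\<lambda>s. cis (angle \<sigma> c s) - cis (angle \<sigma> c a))) \<le> integral {a..b} (\<lambda>s. norm (cis (\<sigma> * (c s - c a)) - 1) + 1 / 4)"
    by (rule integral_norm_bound_integral[OF int(1)])
       (use le in \<open>auto intro!: integrable_continuous_interval continuous_intros cw\<close>)
  also have "\<dots> = wobble c a b + \<kappa> / 4"
    using \<kappa>(1) by (subst Henstock_Kurzweil_Integration.integral_add)
      (auto simp: wobble_def b_def intro!: integrable_continuous_interval cw[unfolded b_def])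
  also have "\<dots> \<le> \<kappa> / 2" using stay by (simp add: b_def)
  also have "integral {a..b} (\<lambda>s. cis (angle \<sigma> c s) - cis (angle \<sigma> c a)) = (memory \<sigma> c b - memory \<sigma> c a) - of_real \<kappa> * cis (angle \<sigma> c a)"
    using memory_diff_eq[OF c a, of b \<sigma>] \<kappa>(1) int(2)
    by (subst Henstock_Kurzweil_Integration.integral_diff) (auto simp: b_def scaleR_conv_of_real)
  finally have "norm ((memory \<sigma> c b - memory \<sigma> c a) - of_real \<kappa> * cis (angle \<sigma> c a)) \<le> \<kappa> / 2" .
  moreover have "norm (of_real \<kappa> * cis (angle \<sigma> c a)) = \<kappa>" using \<kappa>(1) by (simp add: norm_mult)
  ultimately show ?thesis
    using norm_triangle_ineq3[of "memory \<sigma> c b - memory \<sigma> c a" "of_real \<kappa> * cis (angle \<sigma> c a)"]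
    by (simp add: b_def)
qed

section \<open>Sign changes of the drift\<close>

lemma wobble_measurable: "0 \<le> a \<Longrightarrow> a \<le> b \<Longrightarrow> (\<lambda>c. wobble c a b) \<in> borel_measurable paths"
proof -
  assume ab: "0 \<le> a" "a \<le> b"
  have "continuous_on {a..b} (\<lambda>s. norm (cis (\<sigma> * (c s - c a)) - 1))" if "c \<in> space paths" for c
    by (intro continuous_intros continuous_on_path[OF that ab(1)])
  then show ?thesis
    unfolding wobble_def by (intro borel_measurable_integral_path ab(2)) measurable
qed

lemma known_wobble: "0 \<le> a \<Longrightarrow> b \<le> t \<Longrightarrow> known t (\<lambda>c. wobble c a b)"
  unfolding wobble_def by (rule knownI, rule integral_cong) auto

text \<open>A chord is at most its arc, and the mean absolute increment over a time at most
  \<open>\<kappa>\<close> is at most \<open>sqrt \<kappa>\<close>. Expectation and time integral are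
  exchanged through Riemann sums.\<close>

lemma expectation_wobble:
  assumes a: "0 \<le> a" "0 < \<kappa>"
    and w: "known a w" "w \<in> borel_measurable paths" "\<And>c. c \<in> space paths \<Longrightarrow> 0 \<le> w c" "\<And>c. c \<in> space paths \<Longrightarrow> w c \<le> Kw"
  shows "(\<integral>c. w c * wobble c a (a + \<kappa>) \<partial>W) \<le> \<kappa> * (\<sigma> * sqrt \<kappa> * (\<integral>c. w c \<partial>W))"
proof -
  have [measurable]: "w \<in> borel_measurable paths" by (rule w)
  define b where "b = a + \<kappa>"
  have ab: "a < b" using a by (simp add: b_def)
  have wabs: "\<bar>w c\<bar> \<le> Kw" if "c \<in> space paths" for c using w(3,4)[OF that] by simp
  have Kw: "Kw \<ge> 0" using wabs[of "\<lambda>_. 0"] by (force simp: space_paths)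
  have iw: "integrable W w" by (rule integrable_bounded[OF w(2) wabs])
  have Ew: "0 \<le> (\<integral>c. w c \<partial>W)"
    by (rule integral_nonneg_AE, rule AE_I2) (use w(3) in \<open>auto simp: space_W\<close>)
  define p where "p c s = norm (cis (\<sigma> * (c s - c a)) - 1)" for c s
  have cp: "continuous_on {a..b} (p c)" if "c \<in> space paths" for c
    unfolding p_def by (intro continuous_intros continuous_on_path[OF that a(1)])
  have p2: "0 \<le> p c s" "p c s \<le> 2" for c s
    unfolding p_def using norm_triangle_ineq4[of "cis (\<sigma> * (c s - c a))" 1] by auto
  have pm[measurable]: "(\<lambda>c. p c s) \<in> borel_measurable paths" for s
    unfolding p_def by measurable
  have ip: "integrable W (\<lambda>c. w c * p c s)" for s
  proof (rule integrable_bounded)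
    show "\<bar>w c * p c s\<bar> \<le> Kw * 2" if "c \<in> space paths" for c
      unfolding abs_mult using wabs[OF that] p2[of c s] Kw by (intro mult_mono) auto
  qed measurable
  have Ep: "(\<integral>c. w c * p c s \<partial>W) \<le> \<sigma> * sqrt \<kappa> * (\<integral>c. w c \<partial>W)" if s: "s \<in> {a..b}" for s
  proof (cases "s = a")
    case True
    then show ?thesis using Ew \<sigma>_pos a by (simp add: p_def)
  next
    case False
    then have sa: "a < s" using s by simp
    note i2 = integrable_increment2[OF a(1) sa w(1,2) wabs] expectation_increment2[OF a(1) sa w(1,2) wabs]
    have "(\<integral>c. w c * p c s \<partial>W) \<le> (\<integral>c. \<sigma> * ((sqrt \<kappa> * w c + w c * (c s - c a)^2 / sqrt \<kappa>) / 2) \<partial>W)"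
    proof (rule integral_mono[OF ip])
      show "integrable W (\<lambda>c. \<sigma> * ((sqrt \<kappa> * w c + w c * (c s - c a)^2 / sqrt \<kappa>) / 2))"
        using iw i2(1) by simp
      fix c assume "c \<in> space W"
      then have c: "c \<in> space paths" by (simp add: space_W)
      have "p c s \<le> \<bar>\<sigma> * (c s - c a)\<bar>"
        using norm_cis_diff_le[of "\<sigma> * (c s - c a)" 0] by (simp add: p_def)
      also have "\<dots> \<le> \<sigma> * ((sqrt \<kappa> + (c s - c a)^2 / sqrt \<kappa>) / 2)"
        unfolding abs_mult using \<sigma>_pos abs_le_sqrt_mean[OF a(2), of "c s - c a"] by simp
      finally have "w c * p c s \<le> w c * (\<sigma> * ((sqrt \<kappa> + (c s - c a)^2 / sqrt \<kappa>) / 2))"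
        using w(3)[OF c] by (rule mult_left_mono)
      then show "w c * p c s \<le> \<sigma> * ((sqrt \<kappa> * w c + w c * (c s - c a)^2 / sqrt \<kappa>) / 2)"
        by (simp add: algebra_simps add_divide_distrib)
    qed
    also have "\<dots> = \<sigma> * ((sqrt \<kappa> * (\<integral>c. w c \<partial>W) + (s - a) * (\<integral>c. w c \<partial>W) / sqrt \<kappa>) / 2)"
      using iw i2 by simp
    also have "\<dots> \<le> \<sigma> * ((sqrt \<kappa> * (\<integral>c. w c \<partial>W) + \<kappa> * (\<integral>c. w c \<partial>W) / sqrt \<kappa>) / 2)"
      using s Ew \<sigma>_pos a by (intro mult_left_mono divide_right_mono add_left_mono mult_right_mono) (auto simp: b_def)
    also have "\<dots> = \<sigma> * sqrt \<kappa> * (\<integral>c. w c \<partial>W)"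
      using a(2) by (simp add: real_div_sqrt mult.commute[of \<kappa>] flip: times_divide_eq_right)
    finally show ?thesis .
  qed
  define S where "S n c = (\<Sum>j<n. ((b - a) / n) *\<^sub>R p c (grid a b n j))" for n c
  have ES: "(\<integral>c. w c * S n c \<partial>W) \<le> \<kappa> * (\<sigma> * sqrt \<kappa> * (\<integral>c. w c \<partial>W))" for n
  proof -
    have "(\<integral>c. w c * S n c \<partial>W) = (\<Sum>j<n. ((b - a) / n) * (\<integral>c. w c * p c (grid a b n j) \<partial>W))"
    proof -
      have "w c * S n c = (\<Sum>j<n. ((b - a) / n) * (w c * p c (grid a b n j)))" for c
        unfolding S_def sum_distrib_left by (intro sum.cong) (auto simp: mult_ac)
      then show ?thesis using ip by (simp add: Bochner_Integration.integral_sum)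
    qed
    also have "\<dots> \<le> (\<Sum>j<n. ((b - a) / n) * (\<sigma> * sqrt \<kappa> * (\<integral>c. w c \<partial>W)))"
      using ab grid_mem[of a b _ n] by (intro sum_mono mult_left_mono Ep) auto
    also have "\<dots> \<le> \<kappa> * (\<sigma> * sqrt \<kappa> * (\<integral>c. w c \<partial>W))"
      using Ew \<sigma>_pos a by (cases "n = 0") (auto simp: b_def)
    finally show ?thesis .
  qed
  have "(\<lambda>n. \<integral>c. w c * S n c \<partial>W) \<longlonglongrightarrow> (\<integral>c. w c * wobble c a b \<partial>W)"
  proof (rule integral_dominated_convergence[where w = "\<lambda>_. Kw * (2 * (b - a))"])
    have Sm[measurable]: "(\<lambda>c. S n c) \<in> borel_measurable paths" for n unfolding S_def by measurable
    show "(\<lambda>c. w c * S n c) \<in> borel_measurable W" for n unfolding measurable_W_iff by measurable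
    have [measurable]: "(\<lambda>c. wobble c a b) \<in> borel_measurable paths" using a ab by (intro wobble_measurable) auto
    show "(\<lambda>c. w c * wobble c a b) \<in> borel_measurable W" unfolding measurable_W_iff by measurable
    show "AE c in W. (\<lambda>n. w c * S n c) \<longlonglongrightarrow> w c * wobble c a b"
    proof (rule AE_I2, rule tendsto_mult_left)
      fix c assume "c \<in> space W"
      then show "(\<lambda>n. S n c) \<longlonglongrightarrow> wobble c a b"
        using riemann_sums[OF _ cp, of c] ab unfolding S_def wobble_def by (simp add: space_W p_def[abs_def])
    qed
    show "AE c in W. norm (w c * S n c) \<le> Kw * (2 * (b - a))" for n
    proof (rule AE_I2)
      fix c assume "c \<in> space W"
      then have c: "c \<in> space paths" by (simp add: space_W)
      have "\<bar>S n c\<bar> \<le> (\<Sum>j<n. ((b - a) / n) * 2)"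
        unfolding S_def
      proof (intro order_trans[OF sum_abs] sum_mono)
        fix j
        have "(b - a) / n * p c (grid a b n j) \<le> (b - a) / n * 2"
          using ab p2 by (intro mult_left_mono) auto
        then show "\<bar>((b - a) / n) *\<^sub>R p c (grid a b n j)\<bar> \<le> (b - a) / n * 2"
          using ab p2[of c "grid a b n j"] by (simp add: abs_mult)
      qed
      also have "\<dots> \<le> 2 * (b - a)" using ab by (cases "n = 0") auto
      finally show "norm (w c * S n c) \<le> Kw * (2 * (b - a))"
        unfolding real_norm_def abs_mult using wabs[OF c] Kw by (intro mult_mono) auto
    qed
  qed simp
  then show ?thesis unfolding b_def[symmetric] by (rule LIMSEQ_le_const2) (use ES in auto)
qed

definition tail_prob :: "real \<Rightarrow> real \<Rightarrow> real" where
  "tail_prob h q = (\<integral>x. normal_density 0 (sqrt h) x * indicator {q..} x \<partial>lborel)"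

lemma integrable_normal_indicator: "h > 0 \<Longrightarrow> integrable lborel (\<lambda>x. normal_density 0 (sqrt h) x * indicator {q..} x :: real)"
  by (intro integrable_real_mult_indicator integrable_normal_density) auto

text \<open>On \<open>{q..q + 1}\<close> the density is at least its value at the right end
  point.\<close>

lemma tail_prob_pos: "h > 0 \<Longrightarrow> q > 0 \<Longrightarrow> tail_prob h q > 0"
proof -
  assume h: "h > 0" and q: "q > 0"
  define m where "m = normal_density 0 (sqrt h) (q + 1)"
  have m: "m > 0" unfolding m_def using h by (intro normal_density_pos) simp
  have "(\<integral>x. m * indicator {q..q + 1} x \<partial>lborel) \<le> tail_prob h q"
    unfolding tail_prob_def
  proof (rule integral_mono[OF _ integrable_normal_indicator[OF h]])
    show "integrable lborel (\<lambda>x. m * indicator {q..q + 1} x)" by simp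
    fix x :: real
    show "m * indicator {q..q + 1} x \<le> normal_density 0 (sqrt h) x * indicator {q..} x"
    proof (cases "x \<in> {q..q + 1}")
      case True
      then have "x^2 \<le> (q + 1)^2" using q by (intro power_mono) auto
      then have "m \<le> normal_density 0 (sqrt h) x"
        unfolding m_def normal_density_def using h by (intro mult_left_mono) (auto simp: divide_right_mono)
      then show ?thesis using True by simp
    qed auto
  qed
  moreover have "(\<integral>x. m * indicator {q..q + 1} x \<partial>lborel) = m" by simp
  ultimately show ?thesis using m by simp
qed

lemma tail_prob_le_1: "h > 0 \<Longrightarrow> tail_prob h q \<le> 1"
proof -
  assume h: "h > 0"
  have "tail_prob h q \<le> (\<integral>x. normal_density 0 (sqrt h) x \<partial>lborel)"
    unfolding tail_prob_def
    by (rule integral_mono[OF integrable_normal_indicator[OF h]]) (use h in \<open>auto simp: indicator_def\<close>)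
  then show ?thesis using h by simp
qed

lemma expectation_large_increment:
  assumes a: "0 \<le> a" "h > 0"
    and w: "known a w" "w \<in> borel_measurable paths" "\<And>c. c \<in> space paths \<Longrightarrow> \<bar>w c\<bar> \<le> Kw"
  shows "(\<integral>c. w c * indicator {q..} (c (a + h) - c a) \<partial>W) = (\<integral>c. w c \<partial>W) * tail_prob h q"
  unfolding tail_prob_def
  using increment_W[OF a(1) _ w, of "a + h" "indicator {q..}"] integrable_normal_indicator[OF a(2), of q] a(2) by simp

text \<open>A large increment of the noise carries the angle over three half turns; if the memory is not too
  short, the drift changes sign on the way.  If the memory is short, a quiet period of length \<open>\<kappa>\<close>
  first makes it long enough, and a second large increment follows.\<close>

lemma sign_change_likely:
  assumes R1: "0 \<le> R1"
  obtains p :: real where "0 < p" "p \<le> 1"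
    "\<And>a w Kw. 0 \<le> a \<Longrightarrow> known a w \<Longrightarrow> w \<in> borel_measurable paths \<Longrightarrow> (\<And>c. c \<in> space paths \<Longrightarrow> 0 \<le> w c) \<Longrightarrow>
      (\<And>c. c \<in> space paths \<Longrightarrow> w c \<le> Kw) \<Longrightarrow> (\<And>c. c \<in> space paths \<Longrightarrow> w c \<noteq> 0 \<Longrightarrow> norm (memory \<sigma> c a) \<le> R1) \<Longrightarrow>
      (\<integral>c. w c * of_bool (\<not> sign_change c a (a + T)) \<partial>W) \<le> (1 - p) * (\<integral>c. w c \<partial>W)"
proof -
  \<comment> \<open>The bound 1/80 gives \<open>\<kappa> \<le> 1 / 8\<close>, which keeps the drift
    harmless during the quiet period; the bound with \<open>\<sigma>\<close> gives the quiet period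
    a conditional probability of at least 1/2.\<close>
  define \<delta> where "\<delta> = min (1 / 80) (1 / (640 * \<sigma>^2))"
  \<comment> \<open>A memory of length at most \<open>3 * \<delta>\<close> that is displaced by at
    least \<open>\<kappa> / 2 = 5 * \<delta>\<close> has length at least \<open>2 * \<delta>\<close>
    afterwards, as \<open>run_sign_change\<close> requires.\<close>
  define \<kappa> where "\<kappa> = 10 * \<delta>"
  have \<delta>: "0 < \<delta>" "\<delta> \<le> 1 / 80" "\<delta> \<le> 1 / (640 * \<sigma>^2)" using \<sigma>_pos by (auto simp: \<delta>_def)
  have \<kappa>: "0 < \<kappa>" "\<kappa> \<le> 1 / 8" "\<kappa> \<le> 1 / (64 * \<sigma>^2)" using \<delta> by (auto simp: \<kappa>_def field_simps)
  have fit: "\<delta> + \<kappa> + \<delta> \<le> T"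
  proof -
    have "12 * \<delta> \<le> 12 * (1 / (640 * \<sigma>^2))" using \<delta>(3) by simp
    also have "\<dots> \<le> T" using \<sigma>_pos by (simp add: T_def divide_simps)
    finally show ?thesis by (simp add: \<kappa>_def)
  qed
  have sq: "4 * (\<sigma> * sqrt \<kappa>) \<le> 1 / 2"
  proof -
    have "sqrt \<kappa> \<le> sqrt (1 / (64 * \<sigma>^2))" using \<kappa>(3) by simp
    also have "\<dots> = 1 / (8 * \<sigma>)" using \<sigma>_pos by (simp add: real_sqrt_divide real_sqrt_mult)
    finally have "\<sigma> * sqrt \<kappa> \<le> \<sigma> * (1 / (8 * \<sigma>))" using \<sigma>_pos by (intro mult_left_mono) auto
    then show ?thesis using \<sigma>_pos by simp
  qed
  \<comment> \<open>An increment of size \<open>q\<close> beats by \<open>3 * pi\<close> a drift of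
    at most \<open>R1 + T\<close> that acts for a time less than 1.\<close>
  define q where "q = (3 * pi + R1 + T) / \<sigma>"
  have q: "q > 0" "\<sigma> * q = 3 * pi + R1 + T" using R1 T_pos \<sigma>_pos by (auto simp: q_def add_pos_nonneg)
  define \<pi> where "\<pi> = tail_prob \<delta> q"
  have \<pi>: "0 < \<pi>" "\<pi> \<le> 1" using tail_prob_pos[OF \<delta>(1) q(1)] tail_prob_le_1[OF \<delta>(1)] by (auto simp: \<pi>_def)
  show thesis
  \<comment> \<open>Two large increments, each of probability \<open>\<pi>\<close>, and between them
    a quiet period of conditional probability at least 1/2.\<close>
  proof (rule that[of "\<pi> * \<pi> / 2"])
    show "0 < \<pi> * \<pi> / 2" using \<pi> by simp
    have "\<pi> * \<pi> \<le> 1 * 1" using \<pi> by (intro mult_mono) auto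
    then show "\<pi> * \<pi> / 2 \<le> 1" by simp
    fix a Kw :: real and w :: "(real \<Rightarrow> real) \<Rightarrow> real"
    assume a: "0 \<le> a" and w: "known a w" "w \<in> borel_measurable paths"
      and w0: "\<And>c. c \<in> space paths \<Longrightarrow> 0 \<le> w c" and wK: "\<And>c. c \<in> space paths \<Longrightarrow> w c \<le> Kw"
      and supp: "\<And>c. c \<in> space paths \<Longrightarrow> w c \<noteq> 0 \<Longrightarrow> norm (memory \<sigma> c a) \<le> R1"
    define a1 a2 where "a1 = a + \<delta>" and "a2 = a1 + \<kappa>"
    have a1: "0 \<le> a1" "a \<le> a1" and a2: "0 \<le> a2" "a1 \<le> a2" using a \<delta> \<kappa> by (auto simp: a1_def a2_def)
    have [measurable]: "w \<in> borel_measurable paths" "(\<lambda>c. wobble c a1 a2) \<in> borel_measurable paths"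
      using w wobble_measurable[OF a1(1) a2(2)] by auto
    \<comment> \<open>All three requirements are imposed on every path, also where the first large
      increment already suffices; this avoids splitting the weight according to the length of the
      memory.\<close>
    define w1 where "w1 c = w c * indicator {q..} (c a1 - c a)" for c
    define st :: "(real \<Rightarrow> real) \<Rightarrow> real" where "st c = (if wobble c a1 a2 \<le> \<kappa> / 4 then 1 else 0)" for c
    define w2 where "w2 c = w1 c * st c" for c
    define w3 where "w3 c = w2 c * indicator {q..} (c (a2 + \<delta>) - c a2)" for c
    have [measurable]: "w1 \<in> borel_measurable paths" "st \<in> borel_measurable paths" "w2 \<in> borel_measurable paths" "w3 \<in> borel_measurable paths"
      unfolding w1_def st_def w2_def w3_def by measurable
    have k1: "known a1 w1"
      unfolding w1_def
      by (rule known_comp2[where f = "(*)"], rule known_mono[OF w(1) a1(2)], rule known_comp2[where f = "\<lambda>x y. indicator {q..} (x - y)"])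
         (use a a1 in auto)
    have k2: "known a2 w2"
      unfolding w2_def st_def
      by (rule known_comp2[where f = "(*)"], rule known_mono[OF k1 a2(2)], rule known_comp[OF known_wobble, where f = "\<lambda>x. if x \<le> \<kappa> / 4 then 1 else 0"])
         (use a1 in auto)
    have ind: "0 \<le> (indicator {q..} x :: real)" "(indicator {q..} x :: real) \<le> 1" for x by (auto simp: indicator_def)
    have w1b: "0 \<le> w1 c" "w1 c \<le> w c" if "c \<in> space paths" for c
      using w0[OF that] ind[of "c a1 - c a"] by (auto simp: w1_def mult_left_le)
    have w2b: "0 \<le> w2 c" "w2 c \<le> w1 c" if "c \<in> space paths" for c
      using w1b[OF that] by (auto simp: w2_def st_def)
    have w3b: "0 \<le> w3 c" "w3 c \<le> w2 c" if "c \<in> space paths" for c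
      using w2b[OF that] ind[of "c (a2 + \<delta>) - c a2"] by (auto simp: w3_def mult_left_le)
    have abs: "\<bar>w c\<bar> \<le> Kw" "\<bar>w1 c\<bar> \<le> Kw" "\<bar>w2 c\<bar> \<le> Kw" "\<bar>w3 c\<bar> \<le> Kw" "w1 c \<le> Kw" if "c \<in> space paths" for c
      using w0[OF that] wK[OF that] w1b[OF that] w2b[OF that] w3b[OF that] by linarith+
    have i: "integrable W w" "integrable W w1" "integrable W w2" "integrable W w3"
      by (rule integrable_bounded[where K = Kw], simp, simp add: abs)+
    have E1: "(\<integral>c. w1 c \<partial>W) = (\<integral>c. w c \<partial>W) * \<pi>"
      unfolding w1_def a1_def \<pi>_def by (rule expectation_large_increment[OF a \<delta>(1) w abs(1)])
    have E3: "(\<integral>c. w3 c \<partial>W) = (\<integral>c. w2 c \<partial>W) * \<pi>"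
      unfolding w3_def \<pi>_def by (rule expectation_large_increment[OF a2(1) \<delta>(1) k2 _ abs(3)]) auto
    have wob0: "0 \<le> wobble c a1 a2" if "c \<in> space paths" for c
      unfolding wobble_def
      by (intro Henstock_Kurzweil_Integration.integral_nonneg integrable_continuous_interval continuous_intros continuous_on_path[OF that a1(1)]) auto
    \<comment> \<open>Markov's inequality: a path that is not quiet has \<open>wobble\<close> above
      \<open>\<kappa> / 4\<close>.\<close>
    have E2: "(\<integral>c. w1 c \<partial>W) / 2 \<le> (\<integral>c. w2 c \<partial>W)"
    proof -
      have iwob: "integrable W (\<lambda>c. w1 c * wobble c a1 a2)"
      proof (rule integrable_bounded)
        fix c assume c: "c \<in> space paths"
        have "norm (wobble c a1 a2) \<le> 2 * (a2 - a1)"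
          unfolding wobble_def
        proof (rule integral_bound[OF a2(2)])
          show "norm (norm (cis (\<sigma> * (c s - c a1)) - 1)) \<le> 2" for s
            using norm_triangle_ineq4[of "cis (\<sigma> * (c s - c a1))" 1] by auto
        qed (intro continuous_intros continuous_on_path[OF c a1(1)])
        then show "\<bar>w1 c * wobble c a1 a2\<bar> \<le> Kw * (2 * (a2 - a1))"
          unfolding abs_mult using abs(2)[OF c] by (intro mult_mono) auto
      qed measurable
      have "(\<integral>c. w1 c - w2 c \<partial>W) \<le> (\<integral>c. 4 / \<kappa> * (w1 c * wobble c a1 a2) \<partial>W)"
      proof (rule integral_mono)
        fix c assume "c \<in> space W"
        then have c: "c \<in> space paths" by (simp add: space_W)
        show "w1 c - w2 c \<le> 4 / \<kappa> * (w1 c * wobble c a1 a2)"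
        proof (cases "wobble c a1 a2 \<le> \<kappa> / 4")
          case True
          then show ?thesis using w1b[OF c] wob0[OF c] \<kappa> by (simp add: w2_def st_def)
        next
          case False
          then have "w1 c * 1 \<le> w1 c * (4 / \<kappa> * wobble c a1 a2)"
            using w1b[OF c] \<kappa> by (intro mult_left_mono) (auto simp: field_simps)
          then show ?thesis using False by (simp add: w2_def st_def mult_ac)
        qed
      qed (use i iwob in auto)
      also have "\<dots> = 4 / \<kappa> * (\<integral>c. w1 c * wobble c a1 a2 \<partial>W)" by simp
      also have "\<dots> \<le> 4 / \<kappa> * (\<kappa> * (\<sigma> * sqrt \<kappa> * (\<integral>c. w1 c \<partial>W)))"
        unfolding a2_def
        using \<kappa> by (intro mult_left_mono expectation_wobble[OF a1(1) \<kappa>(1) k1 _ w1b(1) abs(5)]) auto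
      also have "\<dots> = 4 * (\<sigma> * sqrt \<kappa>) * (\<integral>c. w1 c \<partial>W)" using \<kappa> by simp
      also have "\<dots> \<le> 1 / 2 * (\<integral>c. w1 c \<partial>W)"
        by (intro mult_right_mono sq integral_nonneg_AE AE_I2) (use w1b in \<open>auto simp: space_W\<close>)
      finally show ?thesis using i by simp
    qed
    have sc: "sign_change c a (a + T)" if c: "c \<in> space paths" and pos: "w3 c \<noteq> 0" for c
    proof -
      have ne: "w c \<noteq> 0" "c a1 - c a \<ge> q" "wobble c a1 a2 \<le> \<kappa> / 4" "c (a2 + \<delta>) - c a2 \<ge> q"
        using pos by (auto simp: w3_def w2_def w1_def st_def indicator_def split: if_splits)
      have Da: "\<bar>force \<sigma> c s\<bar> \<le> R1 + T" if s: "s \<in> {a..a + T}" for s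
        using abs_force_le_norm_memory[of \<sigma> c s] abs_norm_memory_diff_le[OF c a, of s] s supp[OF c ne(1)] by auto
      have run: "3 * pi \<le> angle \<sigma> c (t + \<delta>) - angle \<sigma> c t" if t: "a \<le> t" "t + \<delta> \<le> a + T" "c (t + \<delta>) - c t \<ge> q" for t
      proof -
        have "norm (integral {t..t + \<delta>} (force \<sigma> c)) \<le> (R1 + T) * (t + \<delta> - t)"
          by (rule integral_bound) (use t a \<delta> Da in \<open>auto intro: continuous_on_force[OF c]\<close>)
        also have "\<dots> \<le> (R1 + T) * 1" using \<delta> R1 T_pos by (intro mult_left_mono) auto
        finally have "\<bar>integral {t..t + \<delta>} (force \<sigma> c)\<bar> \<le> R1 + T" by simp
        moreover have "\<sigma> * q \<le> \<sigma> * (c (t + \<delta>) - c t)" using t(3) \<sigma>_pos by (intro mult_left_mono) auto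
        ultimately show ?thesis using angle_restart[OF c, of t "t + \<delta>" \<sigma>] t a \<delta> q(2) by auto
      qed
      show ?thesis
      proof (cases "2 * \<delta> \<le> norm (memory \<sigma> c a)")
        case True
        have "sign_change c a (a + \<delta>)"
          by (rule run_sign_change[OF c a \<delta>(1) True run]) (use fit \<kappa> \<delta> ne(2) in \<open>auto simp: a1_def\<close>)
        then show ?thesis by (rule sign_change_mono) (use fit \<kappa> \<delta> in auto)
      next
        case False
        have Z1: "norm (memory \<sigma> c a1) \<le> 3 * \<delta>"
          using abs_norm_memory_diff_le[OF c a a1(2)] False by (auto simp: a1_def)
        have "\<kappa> / 2 \<le> norm (memory \<sigma> c (a1 + \<kappa>) - memory \<sigma> c a1)"
        proof (rule stay_moves_memory[OF c a1(1) \<kappa>(1)])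
          have "\<kappa> * (norm (memory \<sigma> c a1) + \<kappa>) \<le> (1 / 8) * (3 / 80 + 1 / 8)"
            using Z1 \<delta> \<kappa> by (intro mult_mono) auto
          then show "\<kappa> * (norm (memory \<sigma> c a1) + \<kappa>) \<le> 1 / 4" by simp
        qed (use ne(3) in \<open>simp add: a2_def\<close>)
        then have Z2: "2 * \<delta> \<le> norm (memory \<sigma> c a2)"
          using norm_triangle_ineq4[of "memory \<sigma> c a2" "memory \<sigma> c a1"] Z1 by (simp add: a2_def \<kappa>_def)
        have "sign_change c a2 (a2 + \<delta>)"
          by (rule run_sign_change[OF c a2(1) \<delta>(1) Z2 run]) (use fit \<kappa> \<delta> ne(4) in \<open>auto simp: a1_def a2_def\<close>)
        then show ?thesis by (rule sign_change_mono) (use fit \<kappa> \<delta> in \<open>auto simp: a1_def a2_def\<close>)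
      qed
    qed
    have [measurable]: "Measurable.pred paths (\<lambda>c. sign_change c a (a + T))"
      using a T_pos by (intro measurable_sign_change) auto
    have "(\<integral>c. w c * of_bool (\<not> sign_change c a (a + T)) \<partial>W) \<le> (\<integral>c. w c - w3 c \<partial>W)"
    proof (rule integral_mono)
      show "integrable W (\<lambda>c. w c * of_bool (\<not> sign_change c a (a + T)))"
      proof (rule integrable_bounded)
        show "\<bar>w c * of_bool (\<not> sign_change c a (a + T))\<bar> \<le> Kw" if "c \<in> space paths" for c
          using abs(1)[OF that] by auto
      qed measurable
      fix c assume "c \<in> space W"
      then have c: "c \<in> space paths" by (simp add: space_W)
      show "w c * of_bool (\<not> sign_change c a (a + T)) \<le> w c - w3 c"
        using sc[OF c] w1b[OF c] w2b[OF c] w3b[OF c] by (cases "w3 c = 0") auto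
    qed (use i in auto)
    also have "\<dots> = (\<integral>c. w c \<partial>W) - (\<integral>c. w3 c \<partial>W)" using i by simp
    also have "\<dots> \<le> (\<integral>c. w c \<partial>W) - (\<integral>c. w c \<partial>W) * (\<pi> * \<pi> / 2)"
    proof -
      have "(\<integral>c. w1 c \<partial>W) / 2 * \<pi> \<le> (\<integral>c. w3 c \<partial>W)" unfolding E3 using E2 \<pi> by (intro mult_right_mono) auto
      then show ?thesis unfolding E1 by (simp add: mult_ac)
    qed
    finally show "(\<integral>c. w c * of_bool (\<not> sign_change c a (a + T)) \<partial>W) \<le> (1 - \<pi> * \<pi> / 2) * (\<integral>c. w c \<partial>W)"
      by (simp add: algebra_simps)
  qed
qed

end

text \<open>The discrete substitute for a stopping time: a path is assigned to the first index where
  \<open>P\<close> fails, or to none. Whether this index is \<open>j\<close> depends on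
  \<open>P\<close> up to \<open>j\<close> only.\<close>

lemma first_failure_partition:
  fixes P :: "nat \<Rightarrow> bool"
  shows "(\<Sum>j<k. of_bool (\<not> P j \<and> (\<forall>i<j. P i))) + of_bool (\<forall>i<k. P i) = (1::real)"
proof (induction k)
  case (Suc k)
  have "of_bool (\<not> P k \<and> (\<forall>i<k. P i)) + of_bool (\<forall>i<Suc k. P i) = (of_bool (\<forall>i<k. P i) :: real)"
    by (auto simp: less_Suc_eq)
  then show ?case unfolding sum.lessThan_Suc using Suc by linarith
qed simp

lemma eventually_grid_point_near:
  assumes ab: "a < b" and s: "s \<in> {a..b}" and d: "d > 0"
  shows "\<forall>\<^sub>F n in sequentially. \<exists>j\<le>n. \<bar>grid a b n j - s\<bar> < d"
proof -
  have "(\<lambda>n. (b - a) / real n) \<longlonglongrightarrow> 0" by (rule lim_const_over_n)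
  then have "\<forall>\<^sub>F n in sequentially. (b - a) / real n < d" using d by (simp add: order_tendstoD(2))
  moreover have "\<forall>\<^sub>F n in sequentially. n > (0::nat)" by (rule eventually_gt_at_top)
  ultimately show ?thesis
  proof eventually_elim
    case (elim n)
    define x where "x = (s - a) / (b - a) * n"
    have "(s - a) / (b - a) \<le> 1" "0 \<le> (s - a) / (b - a)" using s ab by auto
    then have x: "0 \<le> x" "x \<le> n"
      using mult_right_mono[of "(s - a) / (b - a)" 1 "real n"] mult_nonneg_nonneg[of "(s - a) / (b - a)" "real n"]
      unfolding x_def by auto
    define j where "j = nat \<lfloor>x\<rfloor>"
    have j: "real j \<le> x" "x < real j + 1" using x by (auto simp: j_def)
    have jn: "j \<le> n" using j(1) x(2) by linarith
    have "grid a b n j - s = (b - a) / n * (real j - x)"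
      using ab elim(2) by (simp add: grid_def x_def field_simps)
    then have "\<bar>grid a b n j - s\<bar> = (b - a) / n * \<bar>real j - x\<bar>" using ab by (simp add: abs_mult)
    also have "\<dots> \<le> (b - a) / n * 1" using j ab by (intro mult_left_mono) auto
    finally have "\<bar>grid a b n j - s\<bar> < d" using elim(1) by simp
    then show ?case using jn by blast
  qed
qed

context repelling
begin

text \<open>The probability of no sign change need not contract while the memory is long, and its
  \<open>V\<close>-weighted version need not while the memory is short. The combination
  \<open>q\<close> with weight \<open>K\<close> does contract: where the memory is at most
  \<open>R1\<close>, the chance \<open>p\<close> of a sign change pays for the additive
  \<open>C0\<close>; where it is longer, \<open>V\<close> is so large that its own contraction pays.
  The lower bound on \<open>\<gamma>\<close> makes its square root at least 1/2 in the correlation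
  estimate.\<close>

lemma sign_change_tail:
  obtains \<gamma> A :: real where "1 / 4 \<le> \<gamma>" "\<gamma> < 1" "0 \<le> A"
    "\<And>m l. (\<integral>c. of_bool (\<not> sign_change c (block_time m) (block_time (m + l))) \<partial>W) \<le> A * \<gamma> ^ l"
proof -
  have C0: "C0 \<ge> 1" using \<epsilon>_pos T_pos R0_ge by (simp add: C0_def)
  \<comment> \<open>Beyond \<open>R1\<close> the function \<open>V\<close> is at least
    \<open>v1\<close>. Half of its contraction 1/64, that is 1/128, then covers
    \<open>C0 + 1\<close>.\<close>
  define v1 where "v1 = 128 * (C0 + 1)"
  define R1 where "R1 = ln v1 / \<epsilon>"
  have v1: "v1 \<ge> 1" using C0 by (simp add: v1_def)
  have R1: "R1 \<ge> 0" using v1 \<epsilon>_pos by (simp add: R1_def)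
  show thesis
  proof (rule sign_change_likely[OF R1])
    fix p :: real assume p: "0 < p" "p \<le> 1"
      and hit: "\<And>a w Kw. 0 \<le> a \<Longrightarrow> known a w \<Longrightarrow> w \<in> borel_measurable paths \<Longrightarrow> (\<And>c. c \<in> space paths \<Longrightarrow> 0 \<le> w c) \<Longrightarrow>
        (\<And>c. c \<in> space paths \<Longrightarrow> w c \<le> Kw) \<Longrightarrow> (\<And>c. c \<in> space paths \<Longrightarrow> w c \<noteq> 0 \<Longrightarrow> norm (memory \<sigma> c a) \<le> R1) \<Longrightarrow>
        (\<integral>c. w c * of_bool (\<not> sign_change c a (a + T)) \<partial>W) \<le> (1 - p) * (\<integral>c. w c \<partial>W)"
    \<comment> \<open>Half of the gain \<open>K * p\<close> pays for \<open>C0\<close>, the other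
      half for the contraction of \<open>K\<close> itself.\<close>
    define K where "K = 2 * C0 / p"
    have K: "K \<ge> 1" "K * p = 2 * C0" using p C0 by (auto simp: K_def divide_simps)
    \<comment> \<open>The three bounds serve in turn the short memories, the share 1/128 of the
      contraction of \<open>V\<close>, and the contraction of \<open>K\<close> at long
      memories.\<close>
    define \<eta> where "\<eta> = min (p / 2) (min (1 / 128) (1 / K))"
    have \<eta>: "0 < \<eta>" "\<eta> \<le> p / 2" "\<eta> \<le> 1 / 128" "\<eta> * K \<le> 1"
    proof -
      show "0 < \<eta>" "\<eta> \<le> p / 2" "\<eta> \<le> 1 / 128" using p K(1) by (auto simp: \<eta>_def)
      have "\<eta> * K \<le> 1 / K * K" using K(1) by (intro mult_right_mono) (auto simp: \<eta>_def)
      then show "\<eta> * K \<le> 1" using K(1) by simp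
    qed
    define \<gamma> where "\<gamma> = 1 - \<eta>"
    have \<gamma>: "1 / 4 \<le> \<gamma>" "\<gamma> < 1" "63 / 64 \<le> \<gamma>" using \<eta> by (auto simp: \<gamma>_def)
    define N :: "nat \<Rightarrow> nat \<Rightarrow> (real \<Rightarrow> real) \<Rightarrow> real" where "N m l c = of_bool (\<not> sign_change c (block_time m) (block_time (m + l)))" for m l c
    have Nm[measurable]: "N m l \<in> borel_measurable paths" for m l
    proof (cases "l = 0")
      case True
      then have "N m l = (\<lambda>_. 1)" by (auto simp: N_def sign_change_def fun_eq_iff)
      then show ?thesis by simp
    next
      case False
      then have [measurable]: "Measurable.pred paths (\<lambda>c. sign_change c (block_time m) (block_time (m + l)))"
        using T_pos by (intro measurable_sign_change) (auto simp: block_time_def)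
      show ?thesis unfolding N_def by measurable
    qed
    have Nb: "0 \<le> N m l c" "N m l c \<le> 1" for m l c by (auto simp: N_def)
    have Nk: "known (block_time (m + l)) (N m l)" for m l
      unfolding N_def by (rule known_comp[OF known_sign_change]) auto
    have iN: "integrable W (N m l)" for m l
      by (rule integrable_bounded[where K = 1]) (use Nb in auto)
    have bV: "\<bar>N m l c * V c (block_time n)\<bar> \<le> exp (\<epsilon> * block_time n)" if "c \<in> space paths" for m l n c
      using V_le[OF that block_time_nonneg, of n] V_ge_1[of c "block_time n"] by (auto simp: N_def)
    have iNV: "integrable W (\<lambda>c. N m l c * V c (block_time n))" for m l n
      by (rule integrable_bounded[OF _ bV]) simp_all
    define q where "q m l = (\<integral>c. N m l c * V c (block_time (m + l)) \<partial>W) + K * (\<integral>c. N m l c \<partial>W)" for m l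
    have step: "q m (Suc l) \<le> \<gamma> * q m l" for m l
    proof -
      define a where "a = block_time (m + l)"
      have a: "0 \<le> a" by (simp add: a_def)
      have aT: "block_time (m + Suc l) = a + T" by (simp add: a_def block_time_Suc)
      define w where "w = N m l"
      define lo :: "(real \<Rightarrow> real) \<Rightarrow> real" where "lo c = w c * of_bool (norm (memory \<sigma> c a) \<le> R1)" for c
      define hi :: "(real \<Rightarrow> real) \<Rightarrow> real" where "hi c = w c * of_bool (\<not> norm (memory \<sigma> c a) \<le> R1)" for c
      have w: "known a w" "w \<in> borel_measurable paths" "0 \<le> w c" "w c \<le> 1" for c
        using Nk Nm Nb by (auto simp: w_def a_def)
      have [measurable]: "w \<in> borel_measurable paths" "(\<lambda>c. memory \<sigma> c a) \<in> borel_measurable paths" "(\<lambda>c. V c a) \<in> borel_measurable paths"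
        using w a by auto
      have [measurable]: "Measurable.pred paths (\<lambda>c. sign_change c a (a + T))"
        using a T_pos by (intro measurable_sign_change) auto
      have [measurable]: "lo \<in> borel_measurable paths" "hi \<in> borel_measurable paths"
        unfolding lo_def hi_def by measurable
      have lo: "known a lo" "0 \<le> lo c" "lo c \<le> 1" for c
      proof -
        show "known a lo" unfolding lo_def
          by (rule known_comp2[where f = "(*)", OF w(1) known_comp[OF known_memory, where f = "\<lambda>z. of_bool (norm z \<le> R1)"]]) simp
      qed (use w(3,4)[of c] in \<open>auto simp: lo_def\<close>)
      have split: "w c = lo c + hi c" for c by (simp add: lo_def hi_def)
      have hib: "0 \<le> hi c" "hi c \<le> 1" for c using w(3,4)[of c] by (auto simp: hi_def)
      have i: "integrable W lo" "integrable W hi" "integrable W w"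
        by (rule integrable_bounded[where K = 1]; use lo hib w in auto)+
      have ilV: "integrable W (\<lambda>c. lo c * V c a)"
      proof (rule integrable_bounded)
        show "\<bar>lo c * V c a\<bar> \<le> 1 * exp (\<epsilon> * a)" if "c \<in> space paths" for c
          unfolding abs_mult using lo(2,3)[of c] V_le[OF that a] V_ge_1[of c a] by (intro mult_mono) auto
      qed measurable
      have ihV: "integrable W (\<lambda>c. hi c * V c a)"
      proof (rule integrable_bounded)
        show "\<bar>hi c * V c a\<bar> \<le> 1 * exp (\<epsilon> * a)" if "c \<in> space paths" for c
          unfolding abs_mult using hib[of c] V_le[OF that a] V_ge_1[of c a] by (intro mult_mono) auto
      qed measurable
      have EwV: "(\<integral>c. w c * V c a \<partial>W) = (\<integral>c. lo c * V c a \<partial>W) + (\<integral>c. hi c * V c a \<partial>W)"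
        unfolding split distrib_right using ilV ihV by simp
      have Ew: "(\<integral>c. w c \<partial>W) = (\<integral>c. lo c \<partial>W) + (\<integral>c. hi c \<partial>W)"
        unfolding split using i by simp
      \<comment> \<open>No sign change up to the end of the next block means none so far and none
        inside the block; the latter is exploited only where the memory is short.\<close>
      have N_le: "N m (Suc l) c \<le> w c" "N m (Suc l) c \<le> lo c * of_bool (\<not> sign_change c a (a + T)) + hi c" for c
      proof -
        have sc: "sign_change c (block_time m) (block_time (m + Suc l))" if "sign_change c (block_time m) a \<or> sign_change c a (a + T)"
          using that unfolding aT
          by (rule disjE) (erule sign_change_mono; use T_pos block_time_mono[of m "m + l"] in \<open>simp add: a_def\<close>)+
        then show "N m (Suc l) c \<le> w c" by (auto simp: N_def w_def a_def)
        show "N m (Suc l) c \<le> lo c * of_bool (\<not> sign_change c a (a + T)) + hi c"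
          using sc by (auto simp: N_def w_def a_def lo_def hi_def)
      qed
      have VS: "(\<integral>c. N m (Suc l) c * V c (a + T) \<partial>W) \<le> 63 / 64 * (\<integral>c. w c * V c a \<partial>W) + C0 * (\<integral>c. w c \<partial>W)"
      proof -
        have "(\<integral>c. N m (Suc l) c * V c (a + T) \<partial>W) \<le> (\<integral>c. w c * V c (a + T) \<partial>W)"
        proof (rule integral_mono)
          show "integrable W (\<lambda>c. N m (Suc l) c * V c (a + T))" "integrable W (\<lambda>c. w c * V c (a + T))"
            unfolding w_def aT[symmetric] by (rule iNV)+
          show "N m (Suc l) c * V c (a + T) \<le> w c * V c (a + T)" for c
            using N_le(1)[of c] V_ge_1[of c "a + T"] by (intro mult_right_mono) auto
        qed
        also have "\<dots> \<le> 63 / 64 * (\<integral>c. w c * V c a \<partial>W) + C0 * (\<integral>c. w c \<partial>W)"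
          by (rule lyapunov_exp[OF a w(1,2), where Kw = 1]) (use w in auto)
        finally show ?thesis .
      qed
      have NS: "(\<integral>c. N m (Suc l) c \<partial>W) \<le> (1 - p) * (\<integral>c. lo c \<partial>W) + (\<integral>c. hi c \<partial>W)"
      proof -
        have ilo: "integrable W (\<lambda>c. lo c * of_bool (\<not> sign_change c a (a + T)))"
        proof (rule integrable_bounded)
          show "\<bar>lo c * of_bool (\<not> sign_change c a (a + T))\<bar> \<le> 1" for c using lo(2,3)[of c] by auto
        qed measurable
        have "(\<integral>c. N m (Suc l) c \<partial>W) \<le> (\<integral>c. lo c * of_bool (\<not> sign_change c a (a + T)) + hi c \<partial>W)"
          by (rule integral_mono[OF iN]) (use ilo i N_le(2) in auto)
        also have "\<dots> = (\<integral>c. lo c * of_bool (\<not> sign_change c a (a + T)) \<partial>W) + (\<integral>c. hi c \<partial>W)"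
          using ilo i by simp
        also have "(\<integral>c. lo c * of_bool (\<not> sign_change c a (a + T)) \<partial>W) \<le> (1 - p) * (\<integral>c. lo c \<partial>W)"
          by (rule hit[of a lo 1, OF a lo(1)]) (use lo(2,3) in \<open>auto simp: lo_def split: if_splits\<close>)
        finally show ?thesis by simp
      qed
      have hV: "v1 * (\<integral>c. hi c \<partial>W) \<le> (\<integral>c. hi c * V c a \<partial>W)"
      proof -
        have "(\<integral>c. v1 * hi c \<partial>W) \<le> (\<integral>c. hi c * V c a \<partial>W)"
        proof (rule integral_mono)
          fix c
          show "v1 * hi c \<le> hi c * V c a"
          proof (cases "norm (memory \<sigma> c a) \<le> R1")
            case False
            then have "ln v1 \<le> \<epsilon> * norm (memory \<sigma> c a)" using \<epsilon>_pos by (simp add: R1_def field_simps)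
            then have "exp (ln v1) \<le> V c a" unfolding V_def by simp
            then have "v1 \<le> V c a" using v1 by simp
            then show ?thesis using mult_right_mono[OF _ hib(1)[of c], of v1 "V c a"] by (simp add: mult.commute)
          qed (simp add: hi_def)
        qed (use i ihV in auto)
        then show ?thesis using i by simp
      qed
      have nn: "0 \<le> (\<integral>c. lo c \<partial>W)" "0 \<le> (\<integral>c. hi c \<partial>W)" "0 \<le> (\<integral>c. lo c * V c a \<partial>W)"
        using lo(2) hib(1) V_ge_1 by (auto intro!: integral_nonneg_AE AE_I2 mult_nonneg_nonneg intro: order_trans[OF zero_le_one])
      define L H LV HV where "L = (\<integral>c. lo c \<partial>W)" and "H = (\<integral>c. hi c \<partial>W)" and
        "LV = (\<integral>c. lo c * V c a \<partial>W)" and "HV = (\<integral>c. hi c * V c a \<partial>W)"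
      have "q m (Suc l) \<le> (63 / 64 * (LV + HV) + C0 * (L + H)) + K * ((1 - p) * L + H)"
        unfolding q_def aT using VS NS K(1) unfolding EwV Ew L_def H_def LV_def HV_def
        by (intro add_mono mult_left_mono) auto
      also have "\<dots> \<le> \<gamma> * (LV + HV) + \<gamma> * K * (L + H)"
      proof -
        have s1: "63 / 64 * LV \<le> \<gamma> * LV" using \<gamma> nn by (intro mult_right_mono) (auto simp: LV_def)
        have s2: "(C0 + K * (1 - p)) * L \<le> \<gamma> * K * L"
        proof (rule mult_right_mono)
          have "\<eta> * K \<le> p / 2 * K" using \<eta> K by (intro mult_right_mono) auto
          then show "C0 + K * (1 - p) \<le> \<gamma> * K" using K(2) by (simp add: \<gamma>_def algebra_simps)
        qed (use nn in \<open>auto simp: L_def\<close>)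
        have s3: "(C0 + K) * H \<le> \<gamma> * K * H + (\<gamma> - 63 / 64) * HV"
        proof -
          have "(C0 + 1) * H = 1 / 128 * (v1 * H)" by (simp add: v1_def)
          also have "\<dots> \<le> (\<gamma> - 63 / 64) * (v1 * H)"
            using \<eta> v1 nn by (intro mult_right_mono) (auto simp: \<gamma>_def H_def)
          also have "\<dots> \<le> (\<gamma> - 63 / 64) * HV" using hV \<gamma> by (intro mult_left_mono) (auto simp: H_def HV_def)
          finally have "(C0 + 1) * H \<le> (\<gamma> - 63 / 64) * HV" .
          moreover have "\<eta> * K * H \<le> 1 * H" using \<eta> nn by (intro mult_right_mono) (auto simp: H_def)
          ultimately show ?thesis by (simp add: \<gamma>_def algebra_simps)
        qed
        have e1: "(63 / 64 * (LV + HV) + C0 * (L + H)) + K * ((1 - p) * L + H)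
            = 63 / 64 * LV + (C0 + K * (1 - p)) * L + (C0 + K) * H + 63 / 64 * HV"
          by (simp add: algebra_simps add_divide_distrib)
        have e2: "\<gamma> * (LV + HV) + \<gamma> * K * (L + H)
            = \<gamma> * LV + \<gamma> * K * L + (\<gamma> * K * H + (\<gamma> - 63 / 64) * HV) + 63 / 64 * HV"
          by (simp add: algebra_simps)
        show ?thesis unfolding e1 e2 by (rule add_right_mono[OF add_mono[OF add_mono[OF s1 s2] s3]])
      qed
      also have "\<dots> = \<gamma> * q m l"
        unfolding q_def a_def[symmetric] w_def[symmetric] EwV Ew L_def H_def LV_def HV_def by (simp add: algebra_simps)
      finally show ?thesis .
    qed
    have q0: "q m 0 \<le> 1 + 64 * C0 + K" for m
    proof -
      have "N m 0 = (\<lambda>_. 1)" by (auto simp: N_def sign_change_def fun_eq_iff)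
      then show ?thesis using expectation_V_le[of m] by (simp add: q_def prob_space)
    qed
    have ql: "q m l \<le> (1 + 64 * C0 + K) * \<gamma> ^ l" for m l
    proof (induction l)
      case (Suc l)
      have "q m (Suc l) \<le> \<gamma> * ((1 + 64 * C0 + K) * \<gamma> ^ l)"
        using step[of m l] Suc \<gamma> by (meson mult_left_mono order_trans less_eq_real_def zero_le_divide_1_iff zero_le_numeral)
      then show ?case by (simp add: mult_ac)
    qed (use q0 in simp)
    show thesis
    proof (rule that[OF \<gamma>(1,2)])
      show "0 \<le> 1 + 64 * C0 + K" using C0 K by simp
      fix m l
      have nn: "0 \<le> (\<integral>c. N m l c * V c (block_time (m + l)) \<partial>W)" "0 \<le> (\<integral>c. N m l c \<partial>W)"
        using Nb(1) V_ge_1 by (auto intro!: integral_nonneg_AE AE_I2 mult_nonneg_nonneg intro: order_trans[OF zero_le_one])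
      have "(\<integral>c. N m l c \<partial>W) \<le> K * (\<integral>c. N m l c \<partial>W)" using K nn(2) mult_right_mono[of 1 K] by simp
      also have "\<dots> \<le> q m l" using nn(1) by (simp add: q_def)
      also have "\<dots> \<le> (1 + 64 * C0 + K) * \<gamma> ^ l" by (rule ql)
      finally show "(\<integral>c. of_bool (\<not> sign_change c (block_time m) (block_time (m + l))) \<partial>W) \<le> (1 + 64 * C0 + K) * \<gamma> ^ l"
        by (simp add: N_def)
    qed
  qed
qed

section \<open>Decay of correlations\<close>

text \<open>The reflection at \<open>t\<close> preserves the law and does not affect
  \<open>g\<close>, so \<open>J\<close> may be replaced by the mean of \<open>J\<close> and its
  reflected version, which is small when the drift at \<open>t\<close> is.\<close>

lemma reflection_bound:
  assumes t: "0 \<le> t" "t \<le> u" "u < u'"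
    and g: "known t g" "g \<in> borel_measurable paths" "\<And>c. c \<in> space paths \<Longrightarrow> \<bar>g c\<bar> \<le> Kg"
  shows "\<bar>\<integral>c. g c * integral {u..u'} (force \<sigma> c) \<partial>W\<bar> \<le> reflect_const u' * (u' - u) / 2 * (\<integral>c. \<bar>g c\<bar> * \<bar>force \<sigma> c t\<bar> \<partial>W)"
proof -
  define J where "J c = integral {u..u'} (force \<sigma> c)" for c
  define r where "r = reflect t"
  have u: "0 \<le> u" "0 \<le> u'" using t by auto
  have [measurable]: "g \<in> borel_measurable paths" "(\<lambda>c. force \<sigma> c t) \<in> borel_measurable paths" "r \<in> measurable paths paths"
    using g t by (auto simp: r_def)
  have [measurable]: "J \<in> borel_measurable paths"
    unfolding J_def using t by (intro borel_measurable_integral_path) (auto intro!: continuous_on_force)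
  have Kg: "Kg \<ge> 0" using g(3)[of "\<lambda>_. 0"] by (force simp: space_paths)
  have bJ: "\<bar>J c\<bar> \<le> u' * (u' - u)" if c: "c \<in> space paths" for c
  proof -
    have "norm (J c) \<le> u' * (u' - u)"
      unfolding J_def
    proof (rule integral_bound)
      show "norm (force \<sigma> c s) \<le> u'" if "s \<in> {u..u'}" for s using abs_force_le[OF c, of s] that u by simp
    qed (use t u c in \<open>auto intro: continuous_on_force\<close>)
    then show ?thesis by simp
  qed
  have r: "r c \<in> space paths" "g (r c) = g c" if "c \<in> space paths" for c
    using reflect_paths[OF that t(1)] known_reflect[OF g(1)] by (auto simp: r_def)
  have bgJ: "\<bar>g c * J c\<bar> \<le> Kg * (u' * (u' - u))" if "c \<in> space paths" for c
    unfolding abs_mult using g(3)[OF that] bJ[OF that] Kg by (intro mult_mono) auto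
  have i1: "integrable W (\<lambda>c. g c * J c)"
    by (rule integrable_bounded[OF _ bgJ]) measurable
  have i2: "integrable W (\<lambda>c. g c * J (r c))"
  proof (rule integrable_bounded)
    show "\<bar>g c * J (r c)\<bar> \<le> Kg * (u' * (u' - u))" if "c \<in> space paths" for c
      using bgJ[OF r(1)[OF that]] r(2)[OF that] by simp
  qed measurable
  have "(\<integral>c. g c * J c \<partial>W) = (\<integral>c. g c * J c \<partial>distr W paths r)"
    unfolding r_def distr_W_reflect[OF t(1)] ..
  also have "\<dots> = (\<integral>c. g (r c) * J (r c) \<partial>W)"
  proof (rule integral_distr)
    show "r \<in> measurable W paths" by (subst measurable_cong_sets[OF sets_W refl]) fact
  qed measurable
  also have "\<dots> = (\<integral>c. g c * J (r c) \<partial>W)"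
    by (rule Bochner_Integration.integral_cong) (auto simp: space_W r)
  finally have "2 * (\<integral>c. g c * J c \<partial>W) = (\<integral>c. g c * J c + g c * J (r c) \<partial>W)"
    using i1 i2 by simp
  then have "2 * \<bar>\<integral>c. g c * J c \<partial>W\<bar> = \<bar>\<integral>c. g c * J c + g c * J (r c) \<partial>W\<bar>" by linarith
  also have "\<dots> \<le> (\<integral>c. \<bar>g c * J c + g c * J (r c)\<bar> \<partial>W)" by (rule integral_abs_bound)
  also have "\<dots> \<le> (\<integral>c. reflect_const u' * (u' - u) * (\<bar>g c\<bar> * \<bar>force \<sigma> c t\<bar>) \<partial>W)"
  proof (rule integral_mono)
    have "integrable W (\<lambda>c. \<bar>g c\<bar> * \<bar>force \<sigma> c t\<bar>)"
    proof (rule integrable_bounded)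
      show "\<bar>\<bar>g c\<bar> * \<bar>force \<sigma> c t\<bar>\<bar> \<le> Kg * t" if "c \<in> space paths" for c
        using g(3)[OF that] abs_force_le[OF that t(1)] Kg by (auto simp: abs_mult intro!: mult_mono)
    qed measurable
    then show "integrable W (\<lambda>c. reflect_const u' * (u' - u) * (\<bar>g c\<bar> * \<bar>force \<sigma> c t\<bar>))" by simp
    show "integrable W (\<lambda>c. \<bar>g c * J c + g c * J (r c)\<bar>)" using i1 i2 by simp
    fix c assume "c \<in> space W"
    then have c: "c \<in> space paths" by (simp add: space_W)
    have int: "force \<sigma> c integrable_on {u..u'}" "force \<sigma> (r c) integrable_on {u..u'}"
      using continuous_on_force[OF c u(1)] continuous_on_force[OF r(1)[OF c] u(1)] by (auto intro: integrable_continuous_interval)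
    have "J c + J (r c) = integral {u..u'} (\<lambda>s. force \<sigma> c s + force \<sigma> (r c) s)"
      unfolding J_def using Henstock_Kurzweil_Integration.integral_add[OF int] by simp
    also have "norm \<dots> \<le> (reflect_const u' * \<bar>force \<sigma> c t\<bar>) * (u' - u)"
    proof (rule integral_bound)
      show "continuous_on {u..u'} (\<lambda>s. force \<sigma> c s + force \<sigma> (r c) s)"
        by (intro continuous_intros continuous_on_force c r u)
      show "norm (force \<sigma> c s + force \<sigma> (r c) s) \<le> reflect_const u' * \<bar>force \<sigma> c t\<bar>" if "s \<in> {u..u'}" for s
        using force_reflect[OF c t(1), of s u' \<sigma>] that t by (simp add: r_def add.commute)
    qed (use t in auto)
    finally have "\<bar>g c\<bar> * \<bar>J c + J (r c)\<bar> \<le> \<bar>g c\<bar> * ((reflect_const u' * \<bar>force \<sigma> c t\<bar>) * (u' - u))"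
      by (intro mult_left_mono) auto
    then have "\<bar>g c * (J c + J (r c))\<bar> \<le> reflect_const u' * (u' - u) * (\<bar>g c\<bar> * \<bar>force \<sigma> c t\<bar>)"
      unfolding abs_mult by (simp add: mult_ac)
    then show "\<bar>g c * J c + g c * J (r c)\<bar> \<le> reflect_const u' * (u' - u) * (\<bar>g c\<bar> * \<bar>force \<sigma> c t\<bar>)"
      by (simp only: distrib_left)
  qed
  finally show ?thesis by (simp add: J_def)
qed

text \<open>The solution is reflected at the first point of a fine grid where the sign of the drift has
  changed.  There the drift is small, so the reflection nearly turns the future drift into its
  negative, and only the paths without a sign change contribute.\<close>

lemma cancellation:
  assumes ab: "0 \<le> a" "a < b" "b \<le> u" "u < u'"
    and w: "known a w" "w \<in> borel_measurable paths" "\<And>c. c \<in> space paths \<Longrightarrow> \<bar>w c\<bar> \<le> Kw"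
  defines "J \<equiv> \<lambda>c. integral {u..u'} (force \<sigma> c)"
  shows "\<bar>\<integral>c. w c * J c \<partial>W\<bar> \<le> (\<integral>c. \<bar>w c * J c\<bar> * of_bool (\<not> sign_change c a b) \<partial>W)"
proof -
  have u: "0 \<le> u" "0 \<le> u'" using ab by auto
  have Kw: "Kw \<ge> 0" using w(3)[of "\<lambda>_. 0"] by (force simp: space_paths)
  define C where "C = reflect_const u' * (u' - u) / 2"
  have C: "C \<ge> 0" unfolding C_def reflect_const_def using ab u by (simp add: stab_const_nonneg)
  define t where "t n j = grid a b n j" for n j
  have t: "0 \<le> t n j" for n j using ab by (simp add: t_def grid_def)
  have tb: "t n j \<in> {a..b}" if "j \<le> n" for n j using grid_mem[of a b j n] that ab by (simp add: t_def)
  have tmono: "i \<le> j \<Longrightarrow> t n i \<le> t n j" for n i j using grid_mono[of a b i j n] ab by (simp add: t_def)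
  \<comment> \<open>The drift at grid point \<open>j\<close> has the same strict sign as at the
    start. If it vanishes at the start, \<open>P\<close> fails at once, at a point where the drift
    is 0.\<close>
  define P where "P n c j \<longleftrightarrow> force \<sigma> c (t n j) * force \<sigma> c (t n 0) > 0" for n c j
  define e :: "nat \<Rightarrow> nat \<Rightarrow> (real \<Rightarrow> real) \<Rightarrow> real" where "e n j c = of_bool (\<not> P n c j \<and> (\<forall>i<j. P n c i))" for n j c
  define G :: "nat \<Rightarrow> (real \<Rightarrow> real) \<Rightarrow> real" where "G n c = of_bool (\<forall>i<Suc n. P n c i)" for n c
  \<comment> \<open>Up to the factor \<open>C\<close>, this bounds the error of reflecting at the
    first failure; it is 0 on paths without failure.\<close>
  define Os where "Os n c = (\<Sum>j<Suc n. e n j c * \<bar>force \<sigma> c (t n j)\<bar>)" for n c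
  have part: "(\<Sum>j<Suc n. e n j c) + G n c = 1" for n c
    unfolding e_def G_def by (rule first_failure_partition)
  have part_le: "(\<Sum>j<Suc n. e n j c) \<le> 1" for n c
  proof -
    have "0 \<le> G n c" by (simp add: G_def)
    then show ?thesis using part[of n c] by linarith
  qed
  have e01: "0 \<le> e n j c" "e n j c \<le> 1" for n j c by (auto simp: e_def)
  have Dm[measurable]: "(\<lambda>c. force \<sigma> c (t n j)) \<in> borel_measurable paths" for n j using t by simp
  have [measurable]: "Measurable.pred paths (\<lambda>c. P n c j)" for n j unfolding P_def by measurable
  have em[measurable]: "e n j \<in> borel_measurable paths" for n j unfolding e_def by measurable
  have Gm[measurable]: "G n \<in> borel_measurable paths" for n unfolding G_def by measurable
  have Om[measurable]: "Os n \<in> borel_measurable paths" for n unfolding Os_def by measurable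
  have [measurable]: "w \<in> borel_measurable paths" by (rule w)
  have Jm[measurable]: "J \<in> borel_measurable paths"
    unfolding J_def using ab by (intro borel_measurable_integral_path) (auto intro!: continuous_on_force)
  have scm[measurable]: "Measurable.pred paths (\<lambda>c. sign_change c a b)"
    by (rule measurable_sign_change[OF ab(1,2)])
  have bJ: "\<bar>J c\<bar> \<le> u' * (u' - u)" if c: "c \<in> space paths" for c
  proof -
    have "norm (J c) \<le> u' * (u' - u)"
      unfolding J_def
    proof (rule integral_bound)
      show "norm (force \<sigma> c s) \<le> u'" if "s \<in> {u..u'}" for s using abs_force_le[OF c, of s] that u by simp
    qed (use ab u c in \<open>auto intro: continuous_on_force\<close>)
    then show ?thesis by simp
  qed
  define B where "B = Kw * (u' * (u' - u))"
  have bwJ: "\<bar>w c * J c\<bar> \<le> B" if "c \<in> space paths" for c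
    unfolding abs_mult B_def using w(3)[OF that] bJ[OF that] Kw by (intro mult_mono) auto
  have iwJ: "integrable W (\<lambda>c. w c * J c)" by (rule integrable_bounded[OF _ bwJ]) measurable
  have ke: "known (t n j) (\<lambda>c. w c * e n j c)" for n j
  proof (rule known_comp2[where f = "(*)"])
    show "known (t n j) w" using known_mono[OF w(1)] ab by (simp add: t_def grid_def)
    show "known (t n j) (e n j)"
      unfolding e_def P_def
    proof (rule knownI)
      fix c c' :: "real \<Rightarrow> real" assume eq: "\<And>s. 0 \<le> s \<Longrightarrow> s \<le> t n j \<Longrightarrow> c s = c' s"
      have D: "force \<sigma> c (t n i) = force \<sigma> c' (t n i)" if "i \<le> j" for i
        by (rule knownD[OF known_force[OF t, of n i "t n j"]]) (use tmono[OF that] eq in auto)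
      then show "of_bool (\<not> 0 < force \<sigma> c (t n j) * force \<sigma> c (t n 0) \<and> (\<forall>i<j. 0 < force \<sigma> c (t n i) * force \<sigma> c (t n 0))) =
        (of_bool (\<not> 0 < force \<sigma> c' (t n j) * force \<sigma> c' (t n 0) \<and> (\<forall>i<j. 0 < force \<sigma> c' (t n i) * force \<sigma> c' (t n 0))) :: real)"
        by simp
    qed
  qed
  have bwe: "\<bar>w c * e n j c\<bar> \<le> Kw" if "c \<in> space paths" for c n j
    using w(3)[OF that] e01[of n j c] mult_mono[of "\<bar>w c\<bar>" Kw "\<bar>e n j c\<bar>" 1] Kw by (simp add: abs_mult)
  have bO: "0 \<le> Os n c" "Os n c \<le> b" if c: "c \<in> space paths" for n c
  proof -
    show "0 \<le> Os n c" unfolding Os_def using e01 by (intro sum_nonneg) auto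
    have "Os n c \<le> (\<Sum>j<Suc n. e n j c * b)"
      unfolding Os_def
    proof (intro sum_mono mult_left_mono e01)
      show "\<bar>force \<sigma> c (t n j)\<bar> \<le> b" if "j \<in> {..<Suc n}" for j
        using abs_force_le[OF c t, of n j] tb[of j n] that by auto
    qed
    also have "\<dots> = (\<Sum>j<Suc n. e n j c) * b" by (rule sum_distrib_right[symmetric])
    also have "\<dots> \<le> 1 * b" using ab by (intro mult_right_mono part_le) auto
    finally show "Os n c \<le> b" by simp
  qed
  have iO: "integrable W (\<lambda>c. \<bar>w c\<bar> * Os n c)" for n
  proof (rule integrable_bounded)
    show "\<bar>\<bar>w c\<bar> * Os n c\<bar> \<le> Kw * b" if "c \<in> space paths" for c
      using w(3)[OF that] bO[OF that, of n] Kw by (auto simp: abs_mult intro!: mult_mono)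
  qed measurable
  have iG: "integrable W (\<lambda>c. w c * G n c * J c)" for n
  proof (rule integrable_bounded)
    show "\<bar>w c * G n c * J c\<bar> \<le> B" if "c \<in> space paths" for c
      using bwJ[OF that] Kw abs_ge_zero[of "w c * J c"] by (auto simp: G_def intro: order_trans)
  qed measurable
  have ieJ: "integrable W (\<lambda>c. w c * e n j c * J c)" for n j
  proof (rule integrable_bounded)
    show "\<bar>w c * e n j c * J c\<bar> \<le> B" if "c \<in> space paths" for c
      using bwJ[OF that] Kw abs_ge_zero[of "w c * J c"] by (auto simp: e_def intro: order_trans)
  qed measurable
  have ieD: "integrable W (\<lambda>c. \<bar>w c * e n j c\<bar> * \<bar>force \<sigma> c (t n j)\<bar>)" if "j < Suc n" for n j
  proof (rule integrable_bounded)
    show "\<bar>\<bar>w c * e n j c\<bar> * \<bar>force \<sigma> c (t n j)\<bar>\<bar> \<le> Kw * b" if c: "c \<in> space paths" for c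
      using bwe[OF c, of n j] abs_force_le[OF c t, of n j] tb[of j n] \<open>j < Suc n\<close> Kw
      by (auto simp: abs_mult intro!: mult_mono)
  qed measurable
  \<comment> \<open>Paths without failure on the grid either have no sign change at all, or have one
    that the grid misses; the latter part, \<open>S2\<close>, vanishes in the limit.\<close>
  define S1 where "S1 c = \<bar>w c * J c\<bar> * of_bool (\<not> sign_change c a b)" for c
  define S2 where "S2 n c = \<bar>w c * J c\<bar> * (of_bool (sign_change c a b) * G n c)" for n c
  have iS1: "integrable W S1"
  proof (rule integrable_bounded)
    show "\<bar>S1 c\<bar> \<le> B" if "c \<in> space paths" for c
      using bwJ[OF that] abs_ge_zero[of "w c * J c"] unfolding S1_def by (auto simp del: abs_ge_zero)
  qed (unfold S1_def, measurable)
  have bS2: "\<bar>S2 n c\<bar> \<le> B" if "c \<in> space paths" for n c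
    using bwJ[OF that] abs_ge_zero[of "w c * J c"] unfolding S2_def G_def by (auto simp del: abs_ge_zero)
  have S2m[measurable]: "S2 n \<in> borel_measurable paths" for n unfolding S2_def by measurable
  have iS2: "integrable W (S2 n)" for n by (rule integrable_bounded[OF S2m bS2])
  have bound: "\<bar>\<integral>c. w c * J c \<partial>W\<bar> \<le> C * (\<integral>c. \<bar>w c\<bar> * Os n c \<partial>W) + ((\<integral>c. S1 c \<partial>W) + (\<integral>c. S2 n c \<partial>W))" for n
  proof -
    have "w c * J c = (\<Sum>j<Suc n. w c * e n j c * J c) + w c * G n c * J c" for c
    proof -
      have "w c * J c = w c * ((\<Sum>j<Suc n. e n j c) + G n c) * J c" unfolding part by simp
      then show ?thesis by (simp add: distrib_left distrib_right sum_distrib_left sum_distrib_right del: sum.lessThan_Suc)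
    qed
    then have "(\<integral>c. w c * J c \<partial>W) = (\<integral>c. (\<Sum>j<Suc n. w c * e n j c * J c) + w c * G n c * J c \<partial>W)"
      by (simp del: sum.lessThan_Suc)
    also have "\<dots> = (\<Sum>j<Suc n. \<integral>c. w c * e n j c * J c \<partial>W) + (\<integral>c. w c * G n c * J c \<partial>W)"
    proof -
      have "(\<integral>c. (\<Sum>j<Suc n. w c * e n j c * J c) \<partial>W) = (\<Sum>j<Suc n. \<integral>c. w c * e n j c * J c \<partial>W)"
        by (rule Bochner_Integration.integral_sum) (rule ieJ)
      moreover have "integrable W (\<lambda>c. \<Sum>j<Suc n. w c * e n j c * J c)"
        by (rule Bochner_Integration.integrable_sum) (rule ieJ)
      note Bochner_Integration.integral_add[OF this iG[of n]]
      ultimately show ?thesis by (simp only:)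
    qed
    finally have "\<bar>\<integral>c. w c * J c \<partial>W\<bar> \<le> (\<Sum>j<Suc n. \<bar>\<integral>c. w c * e n j c * J c \<partial>W\<bar>) + \<bar>\<integral>c. w c * G n c * J c \<partial>W\<bar>"
      by (simp only:) (rule order_trans[OF abs_triangle_ineq add_right_mono[OF sum_abs]])
    also have "(\<Sum>j<Suc n. \<bar>\<integral>c. w c * e n j c * J c \<partial>W\<bar>) \<le> (\<Sum>j<Suc n. C * (\<integral>c. \<bar>w c * e n j c\<bar> * \<bar>force \<sigma> c (t n j)\<bar> \<partial>W))"
    proof (rule sum_mono)
      fix j assume "j \<in> {..<Suc n}"
      then have tj: "t n j \<le> u" using tb[of j n] ab by auto
      show "\<bar>\<integral>c. w c * e n j c * J c \<partial>W\<bar> \<le> C * (\<integral>c. \<bar>w c * e n j c\<bar> * \<bar>force \<sigma> c (t n j)\<bar> \<partial>W)"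
        unfolding C_def J_def
        by (rule reflection_bound[OF t tj ab(4) ke _ bwe]) measurable
    qed
    also have "\<dots> = C * (\<integral>c. (\<Sum>j<Suc n. \<bar>w c * e n j c\<bar> * \<bar>force \<sigma> c (t n j)\<bar>) \<partial>W)"
    proof -
      have "(\<integral>c. (\<Sum>j<Suc n. \<bar>w c * e n j c\<bar> * \<bar>force \<sigma> c (t n j)\<bar>) \<partial>W) = (\<Sum>j<Suc n. \<integral>c. \<bar>w c * e n j c\<bar> * \<bar>force \<sigma> c (t n j)\<bar> \<partial>W)"
        by (rule Bochner_Integration.integral_sum) (rule ieD, simp)
      then show ?thesis by (simp only: sum_distrib_left)
    qed
    also have "(\<lambda>c. \<Sum>j<Suc n. \<bar>w c * e n j c\<bar> * \<bar>force \<sigma> c (t n j)\<bar>) = (\<lambda>c. \<bar>w c\<bar> * Os n c)"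
      unfolding Os_def sum_distrib_left using e01 by (intro ext sum.cong) (auto simp: abs_mult mult_ac)
    also have "\<bar>\<integral>c. w c * G n c * J c \<partial>W\<bar> \<le> (\<integral>c. \<bar>w c * G n c * J c\<bar> \<partial>W)" by (rule integral_abs_bound)
    also have "\<dots> \<le> (\<integral>c. S1 c + S2 n c \<partial>W)"
    proof (rule integral_mono)
      show "\<bar>w c * G n c * J c\<bar> \<le> S1 c + S2 n c" for c
        unfolding S1_def S2_def by (cases "sign_change c a b") (auto simp: G_def abs_mult)
    qed (use iG iS1 iS2 in auto)
    also have "\<dots> = (\<integral>c. S1 c \<partial>W) + (\<integral>c. S2 n c \<partial>W)" using iS1 iS2 by simp
    finally show ?thesis by simp
  qed
  \<comment> \<open>Between the first failure and the grid point before it the drift changes sign or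
    reaches 0, so its size is at most its oscillation over one cell, which uniform continuity makes
    small.\<close>
  have limO: "(\<lambda>n. \<integral>c. \<bar>w c\<bar> * Os n c \<partial>W) \<longlonglongrightarrow> (\<integral>c. 0 \<partial>W)"
  proof (rule integral_dominated_convergence[where w = "\<lambda>_. Kw * b"])
    show "(\<lambda>c. \<bar>w c\<bar> * Os n c) \<in> borel_measurable W" for n unfolding measurable_W_iff by measurable
    show "AE c in W. norm (\<bar>w c\<bar> * Os n c) \<le> Kw * b" for n
      using w(3) bO Kw by (intro AE_I2) (auto simp: space_W abs_mult intro!: mult_mono)
    show "AE c in W. (\<lambda>n. \<bar>w c\<bar> * Os n c) \<longlonglongrightarrow> 0"
    proof (intro AE_I2 tendsto_mult_right_zero)
      fix c assume "c \<in> space W"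
      then have c: "c \<in> space paths" by (simp add: space_W)
      show "(\<lambda>n. Os n c) \<longlonglongrightarrow> 0"
      proof (rule LIMSEQ_I)
        fix r :: real assume r: "r > 0"
        have "uniformly_continuous_on {a..b} (force \<sigma> c)"
          by (intro compact_uniformly_continuous continuous_on_force c ab) auto
        then obtain d where d: "d > 0" "\<And>s s'. s \<in> {a..b} \<Longrightarrow> s' \<in> {a..b} \<Longrightarrow> dist s' s < d \<Longrightarrow> dist (force \<sigma> c s') (force \<sigma> c s) < r / 2"
          using half_gt_zero[OF r] unfolding uniformly_continuous_on_def by blast
        have "(\<lambda>n. (b - a) / real n) \<longlonglongrightarrow> 0" by (rule lim_const_over_n)
        from order_tendstoD(2)[OF this d(1)] obtain N where N: "\<And>n. n \<ge> N \<Longrightarrow> (b - a) / real n < d"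
          unfolding eventually_sequentially by blast
        show "\<exists>N. \<forall>n\<ge>N. norm (Os n c - 0) < r"
        proof (intro exI[of _ N] allI impI)
          fix n assume n: "n \<ge> N"
          have "e n j c * \<bar>force \<sigma> c (t n j)\<bar> \<le> e n j c * (r / 2)" if j: "j < Suc n" for j
          proof (cases "\<not> P n c j \<and> (\<forall>i<j. P n c i)")
            case True
            have "\<bar>force \<sigma> c (t n j)\<bar> \<le> r / 2"
            proof (cases j)
              case 0
              then have "force \<sigma> c (t n j) = 0" using True by (auto simp: P_def zero_less_mult_iff) 
              then show ?thesis using r by simp
            next
              case (Suc i)
              have Pi: "force \<sigma> c (t n i) * force \<sigma> c (t n 0) > 0" and nPj: "\<not> force \<sigma> c (t n j) * force \<sigma> c (t n 0) > 0"
                using True Suc by (auto simp: P_def)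
              have "dist (t n j) (t n i) < d"
                using N[OF n] ab by (simp add: t_def Suc grid_Suc dist_real_def)
              then have "\<bar>force \<sigma> c (t n j) - force \<sigma> c (t n i)\<bar> < r / 2"
                using d(2)[of "t n i" "t n j"] tb[of i n] tb[of j n] j Suc by (auto simp: dist_real_def)
              moreover have "\<bar>force \<sigma> c (t n j)\<bar> \<le> \<bar>force \<sigma> c (t n j) - force \<sigma> c (t n i)\<bar>"
                using Pi nPj by (auto simp: zero_less_mult_iff not_less abs_if)
              ultimately show ?thesis by linarith
            qed
            then show ?thesis using e01(1)[of n j c] by (rule mult_left_mono)
          next
            case False
            then have "e n j c = 0" by (auto simp: e_def)
            then show ?thesis by simp
          qed
          then have "Os n c \<le> (\<Sum>j<Suc n. e n j c * (r / 2))"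
            unfolding Os_def by (intro sum_mono) (simp del: sum.lessThan_Suc)
          also have "\<dots> = (\<Sum>j<Suc n. e n j c) * (r / 2)" by (rule sum_distrib_right[symmetric])
          also have "\<dots> \<le> 1 * (r / 2)" using r by (intro mult_right_mono part_le) auto
          finally show "norm (Os n c - 0) < r" using bO[OF c, of n] r by simp
        qed
      qed
    qed
  qed simp_all
  have limS: "(\<lambda>n. \<integral>c. S2 n c \<partial>W) \<longlonglongrightarrow> (\<integral>c. 0 \<partial>W)"
  proof (rule integral_dominated_convergence[where w = "\<lambda>_. B"])
    show "S2 n \<in> borel_measurable W" for n unfolding measurable_W_iff by measurable
    show "AE c in W. norm (S2 n c) \<le> B" for n using bS2 by (intro AE_I2) (auto simp: space_W)
    show "AE c in W. (\<lambda>n. S2 n c) \<longlonglongrightarrow> 0"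
    proof (rule AE_I2)
      fix c assume "c \<in> space W"
      then have c: "c \<in> space paths" by (simp add: space_W)
      have "\<forall>\<^sub>F n in sequentially. S2 n c = 0"
      proof (cases "sign_change c a b")
        case True
        then obtain s s' where s: "s \<in> {a..b}" "force \<sigma> c s > 0" "s' \<in> {a..b}" "force \<sigma> c s' < 0"
          by (auto simp: sign_change_def)
        have near: "\<exists>d>0. \<forall>r\<in>{a..b}. \<bar>r - x\<bar> < d \<longrightarrow> \<bar>force \<sigma> c r - force \<sigma> c x\<bar> < \<bar>force \<sigma> c x\<bar>"
          if "x \<in> {a..b}" "force \<sigma> c x \<noteq> 0" for x
        proof -
          have "continuous_on {a..b} (force \<sigma> c)" by (intro continuous_on_force c ab)
          from this[unfolded continuous_on_iff, rule_format, OF that(1), of "\<bar>force \<sigma> c x\<bar>"] that(2)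
          show ?thesis by (auto simp: dist_real_def)
        qed
        obtain d where d: "d > 0" "\<And>r. r \<in> {a..b} \<Longrightarrow> \<bar>r - s\<bar> < d \<Longrightarrow> \<bar>force \<sigma> c r - force \<sigma> c s\<bar> < \<bar>force \<sigma> c s\<bar>"
          using near[OF s(1)] s(2) by auto
        obtain d' where d': "d' > 0" "\<And>r. r \<in> {a..b} \<Longrightarrow> \<bar>r - s'\<bar> < d' \<Longrightarrow> \<bar>force \<sigma> c r - force \<sigma> c s'\<bar> < \<bar>force \<sigma> c s'\<bar>"
          using near[OF s(3)] s(4) by auto
        show ?thesis
          using eventually_grid_point_near[OF ab(2) s(1) d(1)] eventually_grid_point_near[OF ab(2) s(3) d'(1)]
        proof eventually_elim
          case (elim n)
          then obtain j j' where j: "j \<le> n" "\<bar>t n j - s\<bar> < d" "j' \<le> n" "\<bar>t n j' - s'\<bar> < d'"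
            unfolding t_def by blast
          have "force \<sigma> c (t n j) > 0" "force \<sigma> c (t n j') < 0"
            using d(2)[OF tb[OF j(1)] j(2)] d'(2)[OF tb[OF j(3)] j(4)] s by auto
          then have "\<not> (P n c j \<and> P n c j')" by (auto simp: P_def zero_less_mult_iff)
          then have "G n c = 0" using j unfolding G_def by (auto simp: less_Suc_eq_le)
          then show ?case by (simp add: S2_def)
        qed
      qed (simp add: S2_def)
      then show "(\<lambda>n. S2 n c) \<longlonglongrightarrow> 0" by (rule tendsto_eventually)
    qed
  qed simp_all
  have "(\<lambda>n. C * (\<integral>c. \<bar>w c\<bar> * Os n c \<partial>W) + ((\<integral>c. S1 c \<partial>W) + (\<integral>c. S2 n c \<partial>W))) \<longlonglongrightarrow> C * 0 + ((\<integral>c. S1 c \<partial>W) + 0)"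
    using limO limS by (intro tendsto_intros) auto
  then have "\<bar>\<integral>c. w c * J c \<partial>W\<bar> \<le> C * 0 + ((\<integral>c. S1 c \<partial>W) + 0)"
    by (rule LIMSEQ_le_const) (use bound in auto)
  then show ?thesis by (simp add: S1_def)
qed

end

section \<open>Laws of large numbers\<close>

lemma power_le_exp: "0 \<le> x \<Longrightarrow> k > 0 \<Longrightarrow> x ^ k \<le> real k ^ k * exp x" for x :: real
proof -
  assume x: "0 \<le> x" and k: "k > 0"
  have "x / k \<le> exp (x / k)" using exp_ge_add_one_self[of "x / k"] by linarith
  then have "(x / k) ^ k \<le> exp (x / k) ^ k" using x by (intro power_mono) auto
  also have "exp (x / k) ^ k = exp x" using k by (simp flip: exp_of_nat_mult)
  finally show ?thesis using k by (simp add: power_divide field_simps)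
qed

context wiener
begin

text \<open>Chebyshev's inequality and Borel-Cantelli, since the probabilities are at most
  \<open>C / n^2\<close>. The almost sure bounds below arise from it by scaling \<open>Q\<close>.
  Inside the proof the index is shifted by one to stay away from \<open>n = 0\<close>.\<close>

lemma eventually_less_square:
  fixes Q :: "nat \<Rightarrow> (real \<Rightarrow> real) \<Rightarrow> real"
  assumes int: "\<And>n. integrable W (Q n)" and nn: "\<And>n c. c \<in> space paths \<Longrightarrow> 0 \<le> Q n c"
    and le: "\<And>n. n > 0 \<Longrightarrow> (\<integral>c. Q n c \<partial>W) \<le> C"
  shows "AE c in W. \<forall>\<^sub>F n in sequentially. Q n c < (real n)^2"
proof -
  define A where "A n = {c \<in> space W. (real (Suc n))^2 \<le> Q (Suc n) c}" for n
  have A: "A n \<in> sets W" for n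
    unfolding A_def using borel_measurable_integrable[OF int] by measurable
  have "AE c in W. \<forall>\<^sub>F n in sequentially. c \<in> space W - A n"
  proof (rule borel_cantelli_AE1[OF A])
    show "emeasure W (A n) < \<infinity>" for n by (simp add: emeasure_eq_measure)
    show "summable (\<lambda>n. measure W (A n))"
    proof (rule summable_comparison_test')
      show "summable (\<lambda>n. C * (1 / (real (Suc n))^2))"
        using inverse_power_summable[of 2, where 'a = real]
        by (intro summable_mult) (subst summable_Suc_iff, simp add: inverse_eq_divide)
      fix n :: nat
      have pos: "(real (Suc n))^2 > 0" by simp
      have "measure W (A n) = (\<integral>c. indicator (A n) c \<partial>W)"
        using sets.sets_into_space[OF A[of n]] by (simp add: Int_absorb2)
      also have "\<dots> \<le> (\<integral>c. Q (Suc n) c / (real (Suc n))^2 \<partial>W)"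
      proof (rule integral_mono)
        show "integrable W (indicator (A n) :: _ \<Rightarrow> real)" using A[of n] by (simp add: emeasure_eq_measure)
        show "integrable W (\<lambda>c. Q (Suc n) c / (real (Suc n))^2)" using int by simp
        fix c assume c: "c \<in> space W"
        show "indicator (A n) c \<le> Q (Suc n) c / (real (Suc n))^2"
          using nn[of c "Suc n"] c pos by (auto simp: A_def indicator_def space_W simp del: of_nat_Suc)
      qed
      also have "\<dots> \<le> C / (real (Suc n))^2"
        using le[of "Suc n"] pos by (simp add: divide_right_mono del: of_nat_Suc)
      finally show "norm (measure W (A n)) \<le> C * (1 / (real (Suc n))^2)" by simp
    qed
  qed
  then show ?thesis
  proof eventually_elim
    case (elim c)
    then have "\<forall>\<^sub>F n in sequentially. Q (Suc n) c < (real (Suc n))^2"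
      by eventually_elim (auto simp: A_def)
    then show ?case by (subst (asm) eventually_sequentially_Suc)
  qed
qed

text \<open>Kolmogorov's inequality.  The increment rule needs bounded factors, so the square of the final
  value \<open>x\<close> is bounded below by \<open>2 * l * (sgn y * x) - l\<^sup>2\<close>, with \<open>y\<close> the value at the first exit.\<close>

lemma kolmogorov_grid:
  assumes ab: "0 \<le> a" "a < b" and l: "l > 0"
  shows "l^2 * (\<integral>c. of_bool (\<not> (\<forall>i<Suc n. \<bar>c (grid a b n i) - c a\<bar> \<le> l)) \<partial>W) \<le> b - a"
proof -
  define t where "t j = grid a b n j" for j
  define P where "P c j \<longleftrightarrow> \<bar>c (t j) - c a\<bar> \<le> l" for c :: "real \<Rightarrow> real" and j
  define e :: "nat \<Rightarrow> (real \<Rightarrow> real) \<Rightarrow> real" where "e j c = of_bool (\<not> P c j \<and> (\<forall>i<j. P c i))" for j c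
  have ta: "a \<le> t j" for j using ab by (simp add: t_def grid_def)
  have t0: "0 \<le> t j" for j using ta[of j] ab by simp
  have tb: "t j \<le> b" if "j < Suc n" for j using grid_mem[of a b j n] that ab by (simp add: t_def)
  have tmono: "i \<le> j \<Longrightarrow> t i \<le> t j" for i j using grid_mono[of a b i j n] ab by (simp add: t_def)
  have [measurable]: "Measurable.pred paths (\<lambda>c. P c j)" for j unfolding P_def by measurable
  have em[measurable]: "e j \<in> borel_measurable paths" for j unfolding e_def by measurable
  have e01: "0 \<le> e j c" "e j c \<le> 1" for j c by (auto simp: e_def)
  have ke: "known (t j) (\<lambda>c. e j c * sgn (c (t j) - c a))" for j
  proof (rule knownI)
    fix c c' :: "real \<Rightarrow> real" assume eq: "\<And>s. 0 \<le> s \<Longrightarrow> s \<le> t j \<Longrightarrow> c s = c' s"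
    have "c (t i) = c' (t i)" if "i \<le> j" for i using eq[OF t0 tmono[OF that]] .
    moreover have "c a = c' a" using eq[OF ab(1) ta] .
    ultimately show "e j c * sgn (c (t j) - c a) = e j c' * sgn (c' (t j) - c' a)"
      by (simp add: e_def P_def)
  qed
  have bg: "\<bar>e j c * sgn (c (t j) - c a)\<bar> \<le> 1" for j c by (auto simp: e_def sgn_if)
  have sq: "integrable W (\<lambda>c. (c b - c a)^2)" "(\<integral>c. (c b - c a)^2 \<partial>W) = b - a"
    using integrable_increment2[OF ab, of "\<lambda>_. 1" 1] expectation_increment2[OF ab, of "\<lambda>_. 1" 1] by (simp_all add: prob_space)
  have inc: "integrable W (\<lambda>c. c s - c a)" if "a \<le> s" for s
    using integrable_increment[OF ab(1), of s "\<lambda>_. 1" 1] that by (cases "s = a") auto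
  have ie: "integrable W (e j)" for j by (rule integrable_bounded[where K = 1]) (use e01 in auto)
  have iesq: "integrable W (\<lambda>c. e j c * (c b - c a)^2)" for j
    by (rule Bochner_Integration.integrable_bound[OF sq(1)])
       (use e01 in \<open>auto simp: measurable_W_iff abs_mult intro!: AE_I2 mult_left_le_one_le\<close>)
  have main: "l^2 * (\<integral>c. e j c \<partial>W) \<le> (\<integral>c. e j c * (c b - c a)^2 \<partial>W)" if j: "j < Suc n" for j
  proof -
    define g where "g c = e j c * sgn (c (t j) - c a)" for c
    have gm: "g \<in> borel_measurable paths" unfolding g_def by measurable
    have ig: "integrable W (\<lambda>c. g c * (c b - c (t j)))" "(\<integral>c. g c * (c b - c (t j)) \<partial>W) = 0"
    proof -
      have "integrable W (\<lambda>c. g c * (c b - c (t j))) \<and> (\<integral>c. g c * (c b - c (t j)) \<partial>W) = 0"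
      proof (cases "t j = b")
        case False
        then have "t j < b" using tb[OF j] by simp
        then show ?thesis
          using integrable_increment[OF t0, of j b g 1] expectation_increment[OF t0, of j b g 1] ke gm bg
          unfolding g_def by blast
      qed simp
      then show "integrable W (\<lambda>c. g c * (c b - c (t j)))" "(\<integral>c. g c * (c b - c (t j)) \<partial>W) = 0" by auto
    qed
    \<comment> \<open>The added term has mean zero: the sign and the event of first exit are known
      at \<open>t j\<close>, where the increment starts.\<close>
    have "(\<integral>c. l^2 * e j c \<partial>W) = (\<integral>c. l^2 * e j c + 2 * l * (g c * (c b - c (t j))) \<partial>W)"
      using ie ig by simp
    also have "\<dots> \<le> (\<integral>c. e j c * (c b - c a)^2 \<partial>W)"
    proof (rule integral_mono)
      fix c :: "real \<Rightarrow> real"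
      define y where "y = c (t j) - c a"
      define x where "x = c b - c a"
      show "l^2 * e j c + 2 * l * (g c * (c b - c (t j))) \<le> e j c * (c b - c a)^2"
      proof (cases "e j c = 0")
        case False
        then have e1: "e j c = 1" and y: "\<bar>y\<bar> > l" by (auto simp: e_def P_def y_def split: if_splits)
        have s: "sgn y * y = \<bar>y\<bar>" "(sgn y)^2 = 1" using y l by (auto simp: sgn_if abs_if)
        have "0 \<le> (x - l * sgn y)^2" by simp
        also have "\<dots> = x^2 - 2 * l * (sgn y * x) + l^2 * (sgn y)^2" by (simp add: power2_eq_square algebra_simps)
        finally have "2 * l * (sgn y * x) - l^2 \<le> x^2" using s by simp
        moreover have "2 * l * (sgn y * x) = 2 * l * (sgn y * (x - y)) + 2 * l * \<bar>y\<bar>"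
          unfolding s(1)[symmetric] by (simp add: algebra_simps)
        moreover have "2 * l * \<bar>y\<bar> \<ge> 2 * l * l" using y l by (intro mult_left_mono) auto
        ultimately have "l^2 + 2 * l * (sgn y * (x - y)) \<le> x^2" by (simp add: power2_eq_square)
        then show ?thesis by (simp add: g_def e1 x_def y_def)
      qed (simp add: g_def)
    qed (use ie ig iesq in auto)
    finally show ?thesis by simp
  qed
  have part: "(\<Sum>j<Suc n. e j c) + of_bool (\<forall>i<Suc n. P c i) = 1" for c
    unfolding e_def by (rule first_failure_partition)
  have fail: "of_bool (\<not> (\<forall>i<Suc n. P c i)) = (\<Sum>j<Suc n. e j c)" for c
    unfolding of_bool_not_iff by (rule diff_eq_eq[THEN iffD2, OF part[symmetric]])
  have "l^2 * (\<integral>c. of_bool (\<not> (\<forall>i<Suc n. P c i)) \<partial>W) = (\<Sum>j<Suc n. l^2 * (\<integral>c. e j c \<partial>W))"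
    unfolding fail sum_distrib_left[symmetric] by (subst Bochner_Integration.integral_sum) (auto intro: ie)
  also have "\<dots> \<le> (\<Sum>j<Suc n. \<integral>c. e j c * (c b - c a)^2 \<partial>W)"
    by (intro sum_mono main) simp
  also have "\<dots> = (\<integral>c. (\<Sum>j<Suc n. e j c * (c b - c a)^2) \<partial>W)"
    by (rule Bochner_Integration.integral_sum[symmetric]) (rule iesq)
  also have "\<dots> \<le> (\<integral>c. (c b - c a)^2 \<partial>W)"
  proof (rule integral_mono)
    show "(\<Sum>j<Suc n. e j c * (c b - c a)^2) \<le> (c b - c a)^2" for c
    proof -
      have "(\<Sum>j<Suc n. e j c) \<le> 1" unfolding fail[symmetric] by simp
      then have "(\<Sum>j<Suc n. e j c) * (c b - c a)^2 \<le> 1 * (c b - c a)^2" by (rule mult_right_mono) simp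
      then show ?thesis by (simp only: sum_distrib_right mult_1)
    qed
    show "integrable W (\<lambda>c. \<Sum>j<Suc n. e j c * (c b - c a)^2)"
      by (rule Bochner_Integration.integrable_sum) (rule iesq)
  qed (rule sq)
  finally show ?thesis unfolding sq by (simp only: P_def t_def)
qed

definition exceeds :: "real \<Rightarrow> real \<Rightarrow> real \<Rightarrow> (real \<Rightarrow> real) \<Rightarrow> bool" where
  "exceeds a b l c \<longleftrightarrow> (\<exists>s\<in>{a..b}. \<bar>c s - c a\<bar> > l)"

lemma measurable_exceeds:
  assumes ab: "0 \<le> a" "a < b"
  shows "Measurable.pred paths (exceeds a b l)"
proof -
  have "exceeds a b l c \<longleftrightarrow> integral {a..b} (\<lambda>s. max 0 (\<bar>c s - c a\<bar> - l)) \<noteq> 0" if c: "c \<in> space paths" for c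
    using integral_eq_0_iff[of a b "\<lambda>s. max 0 (\<bar>c s - c a\<bar> - l)"] ab continuous_on_path[OF c ab(1), of b]
    by (force simp: exceeds_def intro!: continuous_intros)
  moreover have [measurable]: "(\<lambda>c. integral {a..b} (\<lambda>s. max 0 (\<bar>c s - c a\<bar> - l))) \<in> borel_measurable paths"
  proof (rule borel_measurable_integral_path)
    show "continuous_on {a..b} (\<lambda>s. max 0 (\<bar>c s - c a\<bar> - l))" if "c \<in> space paths" for c
      by (intro continuous_intros continuous_on_path[OF that ab(1)])
  qed (use ab in auto)
  ultimately show ?thesis by (subst measurable_cong) (assumption, measurable)
qed

text \<open>Strict exceedance by a continuous path is seen by every sufficiently fine grid, so the
  grid inequality passes to the limit; the discrepancy \<open>E c * (1 - F n c)\<close> tends to 0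
  by dominated convergence.\<close>

lemma kolmogorov:
  assumes ab: "0 \<le> a" "a < b" and l: "l > 0"
  shows "l^2 * (\<integral>c. of_bool (exceeds a b l c) \<partial>W) \<le> b - a"
proof -
  define F :: "nat \<Rightarrow> (real \<Rightarrow> real) \<Rightarrow> real" where "F n c = of_bool (\<not> (\<forall>i<Suc n. \<bar>c (grid a b n i) - c a\<bar> \<le> l))" for n c
  define E :: "(real \<Rightarrow> real) \<Rightarrow> real" where "E c = of_bool (exceeds a b l c)" for c
  have [measurable]: "Measurable.pred paths (exceeds a b l)" by (rule measurable_exceeds[OF ab])
  have Fm[measurable]: "F n \<in> borel_measurable paths" for n unfolding F_def by measurable
  have Em[measurable]: "E \<in> borel_measurable paths" unfolding E_def by measurable
  have iE: "integrable W E" by (rule integrable_bounded[where K = 1]) (auto simp: E_def)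
  have iF: "integrable W (F n)" for n by (rule integrable_bounded[where K = 1]) (simp_all add: F_def)
  have iEF: "integrable W (\<lambda>c. E c * (1 - F n c))" for n
    by (rule integrable_bounded[where K = 1]) (measurable, simp add: F_def E_def)
  have "(\<lambda>n. \<integral>c. E c * (1 - F n c) \<partial>W) \<longlonglongrightarrow> (\<integral>c. 0 \<partial>W)"
  proof (rule integral_dominated_convergence[where w = "\<lambda>_. 1"])
    show "(\<lambda>c. E c * (1 - F n c)) \<in> borel_measurable W" for n unfolding measurable_W_iff by measurable
    show "AE c in W. norm (E c * (1 - F n c)) \<le> 1" for n by (simp add: F_def E_def)
    show "AE c in W. (\<lambda>n. E c * (1 - F n c)) \<longlonglongrightarrow> 0"
    proof (rule AE_I2)
      fix c assume "c \<in> space W"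
      then have c: "c \<in> space paths" by (simp add: space_W)
      have "\<forall>\<^sub>F n in sequentially. E c * (1 - F n c) = 0"
      proof (cases "exceeds a b l c")
        case True
        then obtain s where s: "s \<in> {a..b}" "\<bar>c s - c a\<bar> > l" by (auto simp: exceeds_def)
        have "continuous_on {a..b} c" by (rule continuous_on_path[OF c ab(1)])
        from this[unfolded continuous_on_iff, rule_format, OF s(1), of "\<bar>c s - c a\<bar> - l"] s(2)
        obtain d where d: "d > 0" "\<And>r. r \<in> {a..b} \<Longrightarrow> \<bar>r - s\<bar> < d \<Longrightarrow> \<bar>c r - c s\<bar> < \<bar>c s - c a\<bar> - l"
          by (auto simp: dist_real_def)
        show ?thesis
          using eventually_grid_point_near[OF ab(2) s(1) d(1)]
        proof eventually_elim
          case (elim n)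
          then obtain j where j: "j \<le> n" "\<bar>grid a b n j - s\<bar> < d" by blast
          have "\<bar>c (grid a b n j) - c s\<bar> < \<bar>c s - c a\<bar> - l"
            using d(2)[OF grid_mem[of a b j n] j(2)] j(1) ab by simp
          then have "\<not> \<bar>c (grid a b n j) - c a\<bar> \<le> l" by linarith
          then have "F n c = 1" using j(1) unfolding F_def by (auto simp: less_Suc_eq_le)
          then show ?case by simp
        qed
      qed (simp add: E_def)
      then show "(\<lambda>n. E c * (1 - F n c)) \<longlonglongrightarrow> 0" by (rule tendsto_eventually)
    qed
  qed simp_all
  then have lim: "(\<lambda>n. (b - a) + l^2 * (\<integral>c. E c * (1 - F n c) \<partial>W)) \<longlonglongrightarrow> (b - a) + l^2 * 0"
    by (intro tendsto_intros) simp
  have bound: "l^2 * (\<integral>c. E c \<partial>W) \<le> (b - a) + l^2 * (\<integral>c. E c * (1 - F n c) \<partial>W)" for n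
  proof -
    have "(\<integral>c. E c \<partial>W) \<le> (\<integral>c. F n c + E c * (1 - F n c) \<partial>W)"
    proof (rule integral_mono)
      show "E c \<le> F n c + E c * (1 - F n c)" for c by (simp add: E_def F_def)
    qed (use iE iF iEF in auto)
    also have "\<dots> = (\<integral>c. F n c \<partial>W) + (\<integral>c. E c * (1 - F n c) \<partial>W)" using iF iEF by simp
    finally have "l^2 * (\<integral>c. E c \<partial>W) \<le> l^2 * ((\<integral>c. F n c \<partial>W) + (\<integral>c. E c * (1 - F n c) \<partial>W))"
      by (rule mult_left_mono) simp
    moreover have "l^2 * (\<integral>c. F n c \<partial>W) \<le> b - a" unfolding F_def by (rule kolmogorov_grid[OF ab l])
    ultimately show ?thesis by (simp add: distrib_left)
  qed
  have "l^2 * (\<integral>c. E c \<partial>W) \<le> (b - a) + l^2 * 0"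
    by (rule LIMSEQ_le_const[OF lim]) (use bound in auto)
  then show ?thesis by (simp add: E_def)
qed

end

text \<open>The times \<open>\<tau> * k^2\<close> are sparse enough for Borel-Cantelli with second
  moments of linear growth, and their gaps are of smaller order than the times themselves. The
  tolerances \<open>1 / Suc j\<close> make it enough to combine countably many almost sure
  statements.\<close>

lemma tendsto_zero_over_t:
  fixes f :: "real \<Rightarrow> real"
  assumes \<tau>: "\<tau> > 0"
    and sk: "\<And>j::nat. \<forall>\<^sub>F k::nat in sequentially. \<bar>f (\<tau> * real k ^ 2)\<bar> \<le> real k ^ 2 / real (Suc j)"
    and osc: "\<And>j::nat. \<forall>\<^sub>F k::nat in sequentially. \<forall>t\<in>{\<tau> * real k ^ 2..\<tau> * real (Suc k) ^ 2}. \<bar>f t - f (\<tau> * real k ^ 2)\<bar> \<le> real k ^ 2 / real (Suc j)"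
  shows "((\<lambda>t. f t / t) \<longlongrightarrow> 0) at_top"
proof (rule tendstoI)
  fix r :: real assume r: "r > 0"
  obtain j :: nat where j: "2 / (\<tau> * r) < real (Suc j)"
    using reals_Archimedean2 by (metis of_nat_Suc less_trans lessI of_nat_less_iff)
  have "\<forall>\<^sub>F k::nat in sequentially. k > 0 \<and> (\<forall>t\<in>{\<tau> * real k ^ 2..\<tau> * real (Suc k) ^ 2}. \<bar>f t\<bar> \<le> 2 * real k ^ 2 / real (Suc j))"
    using sk[of j] osc[of j] eventually_gt_at_top[of 0]
  proof eventually_elim
    case (elim k)
    have "\<bar>f t\<bar> \<le> 2 * real k ^ 2 / real (Suc j)" if "t \<in> {\<tau> * real k ^ 2..\<tau> * real (Suc k) ^ 2}" for t
    proof -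
      have "\<bar>f t - f (\<tau> * real k ^ 2)\<bar> \<le> real k ^ 2 / real (Suc j)" using elim(2) that by blast
      then have "\<bar>f t\<bar> \<le> real k ^ 2 / real (Suc j) + real k ^ 2 / real (Suc j)" using elim(1) by linarith
      then show ?thesis by simp
    qed
    then show ?case using elim(3) by blast
  qed
  then obtain K where K: "\<And>k t. k \<ge> K \<Longrightarrow> t \<in> {\<tau> * real k ^ 2..\<tau> * real (Suc k) ^ 2} \<Longrightarrow> \<bar>f t\<bar> \<le> 2 * real k ^ 2 / real (Suc j)"
    unfolding eventually_sequentially by blast
  have "\<forall>\<^sub>F t in at_top. t \<ge> \<tau> * real (Suc K) ^ 2" by (rule eventually_ge_at_top)
  then show "\<forall>\<^sub>F t in at_top. dist (f t / t) 0 < r"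
  proof eventually_elim
    case (elim t)
    define k where "k = nat \<lfloor>sqrt (t / \<tau>)\<rfloor>"
    have tp: "t > 0" using elim \<tau> by (smt (verit) of_nat_Suc of_nat_0_le_iff mult_pos_pos zero_less_power)
    have sK: "real (Suc K) \<le> sqrt (t / \<tau>)"
      by (rule real_le_rsqrt) (use elim \<tau> in \<open>simp add: pos_le_divide_eq mult.commute\<close>)
    have k: "real k \<le> sqrt (t / \<tau>)" "sqrt (t / \<tau>) < real k + 1"
      using tp \<tau> unfolding k_def by (simp_all add: le_of_int_ceiling)
    have "k \<ge> K" using sK k(2) by simp
    have k2: "real k ^ 2 \<le> t / \<tau>" using power_mono[OF k(1), of 2] tp \<tau> by simp
    have k3: "t / \<tau> \<le> real (Suc k) ^ 2" using power_mono[of "sqrt (t / \<tau>)" "real (Suc k)" 2] k(2) tp \<tau> by simp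
    have "t \<in> {\<tau> * real k ^ 2..\<tau> * real (Suc k) ^ 2}"
      using k2 k3 \<tau> by (simp add: pos_le_divide_eq pos_divide_le_eq mult.commute del: of_nat_Suc)
    then have "\<bar>f t\<bar> \<le> 2 * real k ^ 2 / real (Suc j)" using K[OF \<open>k \<ge> K\<close>] by blast
    also have "\<dots> \<le> 2 * (t / \<tau>) / real (Suc j)" using k2 by (intro divide_right_mono mult_left_mono) auto
    also have "\<dots> < r * t"
    proof -
      have "2 < real (Suc j) * (\<tau> * r)" using j \<tau> r by (simp add: pos_divide_less_eq del: of_nat_Suc)
      then have "2 * t < real (Suc j) * (\<tau> * r) * t" using tp by (rule mult_strict_right_mono)
      then show ?thesis using \<tau> by (simp add: field_simps del: of_nat_Suc)
    qed
    finally show ?case using tp by (simp add: dist_real_def abs_divide pos_divide_less_eq)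
  qed
qed

section \<open>Block integrals of the drift and their correlations\<close>

context repelling
begin

definition J :: "nat \<Rightarrow> (real \<Rightarrow> real) \<Rightarrow> real" where
  "J n c = integral {block_time n..block_time (Suc n)} (force \<sigma> c)"

lemma J_measurable[measurable]: "J n \<in> borel_measurable paths"
  unfolding J_def using block_time_mono[of n "Suc n"]
  by (intro borel_measurable_integral_path) (auto intro!: continuous_on_force measurable_force intro: order_trans[OF block_time_nonneg])

lemma known_J: "known (block_time (Suc n)) (J n)"
  unfolding J_def
proof (rule knownI, rule integral_cong)
  fix c c' :: "real \<Rightarrow> real" and s
  assume eq: "\<And>s. 0 \<le> s \<Longrightarrow> s \<le> block_time (Suc n) \<Longrightarrow> c s = c' s" and s: "s \<in> {block_time n..block_time (Suc n)}"
  have "0 \<le> s" using s by (auto intro: order_trans[OF block_time_nonneg])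
  then show "force \<sigma> c s = force \<sigma> c' s"
    using s eq by (intro knownD[OF known_force[of s "block_time (Suc n)"]]) auto
qed

lemma abs_integral_force_le:
  assumes c: "c \<in> space paths" and t: "block_time n \<le> s" "s \<le> t" "t \<le> block_time (Suc n)"
  shows "\<bar>integral {s..t} (force \<sigma> c)\<bar> \<le> (norm (memory \<sigma> c (block_time n)) + T) * (t - s)"
proof -
  have s: "0 \<le> s" using t block_time_nonneg[of n] by linarith
  have "norm (integral {s..t} (force \<sigma> c)) \<le> (norm (memory \<sigma> c (block_time n)) + T) * (t - s)"
  proof (rule integral_bound[OF t(2) continuous_on_force[OF c s]])
    show "norm (force \<sigma> c r) \<le> norm (memory \<sigma> c (block_time n)) + T" if "r \<in> {s..t}" for r
      using abs_force_le_norm_memory[of \<sigma> c r] abs_norm_memory_diff_le[OF c block_time_nonneg[of n], of r] that t by (auto simp: block_time_Suc)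
  qed
  then show ?thesis by simp
qed

lemma abs_J_le: "c \<in> space paths \<Longrightarrow> \<bar>J n c\<bar> \<le> T * (norm (memory \<sigma> c (block_time n)) + T)"
  using abs_integral_force_le[of c n "block_time n" "block_time (Suc n)"] T_pos by (simp add: J_def block_time_Suc mult.commute)

lemma J_bounded: "c \<in> space paths \<Longrightarrow> \<bar>J n c\<bar> \<le> T * (block_time n + T)"
proof -
  assume c: "c \<in> space paths"
  have "T * (norm (memory \<sigma> c (block_time n)) + T) \<le> T * (block_time n + T)"
    using norm_memory_le[of c "block_time n" \<sigma>] c T_pos by (intro mult_left_mono) auto
  with abs_J_le[OF c, of n] show ?thesis by linarith
qed

text \<open>256 is the constant \<open>4^4\<close> of \<open>power_le_exp\<close>, and the last
  factor bounds the expectation of \<open>V\<close>.\<close>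

definition M4 :: real where "M4 = (T / \<epsilon>)^4 * (256 * exp (\<epsilon> * T)) * (1 + 64 * C0)"

lemma integrable_J4: "integrable W (\<lambda>c. (J n c)^4)"
proof (rule integrable_bounded)
  show "\<bar>(J n c)^4\<bar> \<le> (T * (block_time n + T))^4" if "c \<in> space paths" for c
    unfolding power_abs using J_bounded[OF that, of n] by (intro power_mono) auto
qed measurable

lemma expectation_J4_le: "(\<integral>c. (J n c)^4 \<partial>W) \<le> M4"
proof -
  define K where "K = (T / \<epsilon>)^4 * (256 * exp (\<epsilon> * T))"
  have K: "K \<ge> 0" using T_pos \<epsilon>_pos by (simp add: K_def)
  have "(\<integral>c. (J n c)^4 \<partial>W) \<le> (\<integral>c. K * V c (block_time n) \<partial>W)"
  proof (rule integral_mono[OF integrable_J4])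
    show "integrable W (\<lambda>c. K * V c (block_time n))" using integrable_V by simp
    fix c assume "c \<in> space W"
    then have c: "c \<in> space paths" by (simp add: space_W)
    define y where "y = \<epsilon> * (norm (memory \<sigma> c (block_time n)) + T)"
    have y: "y \<ge> 0" using \<epsilon>_pos T_pos by (simp add: y_def)
    have "(J n c)^4 = \<bar>J n c\<bar>^4" by simp
    also have "\<dots> \<le> (T * (norm (memory \<sigma> c (block_time n)) + T))^4" using abs_J_le[OF c, of n] by (intro power_mono) auto
    also have "\<dots> = (T / \<epsilon>)^4 * y^4" using \<epsilon>_pos by (simp add: y_def power_mult_distrib power_divide)
    also have "\<dots> \<le> (T / \<epsilon>)^4 * (256 * exp y)"
      using power_le_exp[OF y, of 4] T_pos \<epsilon>_pos by (intro mult_left_mono) auto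
    also have "\<dots> = K * V c (block_time n)" by (simp add: K_def V_def y_def exp_add distrib_left)
    finally show "(J n c)^4 \<le> K * V c (block_time n)" .
  qed
  also have "\<dots> = K * (\<integral>c. V c (block_time n) \<partial>W)" by simp
  also have "\<dots> \<le> K * (1 + 64 * C0)" using K expectation_V_le by (intro mult_left_mono) auto
  finally show ?thesis by (simp add: M4_def K_def)
qed

text \<open>Takes the place of Hoelder's inequality: the parameter \<open>\<eta>\<close> balances
  the fourth moments of \<open>x\<close> and \<open>y\<close> against the probability of
  \<open>b\<close>.\<close>

lemma weighted_young: "0 < \<eta> \<Longrightarrow> \<bar>x * y\<bar> * of_bool b \<le> \<eta> / 4 * (x^4 + y^4) + of_bool b / (2 * \<eta>)" for x y \<eta> :: real
proof (cases b)
  case True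
  assume \<eta>: "0 < \<eta>"
  have "0 \<le> (\<eta> * \<bar>x * y\<bar> - 1)^2" by simp
  then have "2 * \<eta> * \<bar>x * y\<bar> \<le> \<eta>^2 * (x * y)^2 + 1" by (simp add: power2_diff power_mult_distrib)
  then have 1: "\<bar>x * y\<bar> \<le> \<eta> / 2 * (x * y)^2 + 1 / (2 * \<eta>)" using \<eta> by (simp add: field_simps power2_eq_square)
  have "0 \<le> (x^2 - y^2)^2" by simp
  then have "2 * (x * y)^2 \<le> x^4 + y^4" by (simp add: power2_diff power_mult_distrib flip: power_mult)
  then have "\<eta> / 4 * (2 * (x * y)^2) \<le> \<eta> / 4 * (x^4 + y^4)" using \<eta> by (intro mult_left_mono) auto
  with 1 True show ?thesis by simp
qed simp

lemma integrable_JJ: "integrable W (\<lambda>c. J m c * J n c)"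
proof (rule integrable_bounded)
  show "\<bar>J m c * J n c\<bar> \<le> (T * (block_time m + T)) * (T * (block_time n + T))" if "c \<in> space paths" for c
    unfolding abs_mult using J_bounded[OF that] T_pos block_time_nonneg by (intro mult_mono) auto
qed measurable

text \<open>By \<open>cancellation\<close> only paths without a sign change between the two blocks
  contribute, an event of probability of order \<open>\<gamma> ^ l\<close>. With
  \<open>\<eta> = sqrt \<gamma> ^ l\<close> both terms of \<open>weighted_young\<close> are of order
  \<open>\<eta>\<close>, so half of the exponential rate survives.\<close>

lemma correlation_decay:
  obtains B \<rho> :: real where "0 \<le> B" "0 < \<rho>" "\<rho> < 1"
    "\<And>m n. m \<le> n \<Longrightarrow> \<bar>\<integral>c. J m c * J n c \<partial>W\<bar> \<le> B * \<rho> ^ (n - m)"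
proof (rule sign_change_tail)
  fix \<gamma> A :: real
  assume \<gamma>: "1 / 4 \<le> \<gamma>" "\<gamma> < 1" and A: "0 \<le> A"
    and tail: "\<And>m l. (\<integral>c. of_bool (\<not> sign_change c (block_time m) (block_time (m + l))) \<partial>W) \<le> A * \<gamma> ^ l"
  define \<rho> where "\<rho> = sqrt \<gamma>"
  have \<rho>: "1 / 2 \<le> \<rho>" "\<rho> < 1" "\<rho> * \<rho> = \<gamma>"
    using \<gamma> real_sqrt_le_mono[of "1/4" \<gamma>] by (auto simp: \<rho>_def real_sqrt_divide)
  have M4: "M4 \<ge> 0" using T_pos \<epsilon>_pos by (simp add: M4_def C0_def)
  define B where "B = M4 + A + 1"
  have pw: "\<bar>\<integral>c. J m c * J n c \<partial>W\<bar> \<le> B * \<rho> ^ (n - m)" if mn: "m \<le> n" for m n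
  proof (cases "n - m \<le> 1")
    case True
    have "\<bar>\<integral>c. J m c * J n c \<partial>W\<bar> \<le> (\<integral>c. \<bar>J m c * J n c\<bar> \<partial>W)" by (rule integral_abs_bound)
    also have "\<dots> \<le> (\<integral>c. 1 / 4 * ((J m c)^4 + (J n c)^4) + 1 / 2 \<partial>W)"
      by (rule integral_mono) (use weighted_young[of 1 _ _ True] integrable_JJ integrable_J4 in auto)
    also have "\<dots> = 1 / 4 * ((\<integral>c. (J m c)^4 \<partial>W) + (\<integral>c. (J n c)^4 \<partial>W)) + 1 / 2"
      using integrable_J4 by (simp add: prob_space)
    also have "\<dots> \<le> M4 / 2 + 1 / 2" using expectation_J4_le[of m] expectation_J4_le[of n] by simp
    also have "\<dots> \<le> B * (1 / 2)" using A by (simp add: B_def)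
    also have "\<dots> \<le> B * \<rho> ^ (n - m)"
      using True \<rho> A M4 by (intro mult_left_mono) (auto simp: B_def le_Suc_eq)
    finally show ?thesis .
  next
    case False
    \<comment> \<open>Sign changes are sought in the blocks strictly between the two. The missing
      power of \<open>\<rho>\<close> is made up for by \<open>1 / 2 \<le> \<rho>\<close>.\<close>
    define l where "l = n - m - 1"
    have l: "n = Suc m + l" "l > 0" using False by (auto simp: l_def)
    define N :: "(real \<Rightarrow> real) \<Rightarrow> real" where "N c = of_bool (\<not> sign_change c (block_time (Suc m)) (block_time (Suc m + l)))" for c
    have lt: "block_time (Suc m) < block_time n" using l T_pos by (simp add: block_time_def)
    have [measurable]: "Measurable.pred paths (\<lambda>c. sign_change c (block_time (Suc m)) (block_time (Suc m + l)))"
      using lt l by (intro measurable_sign_change) auto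
    have [measurable]: "N \<in> borel_measurable paths" unfolding N_def by measurable
    have iN: "integrable W N" by (rule integrable_bounded[where K = 1]) (auto simp: N_def)
    define \<eta> where "\<eta> = \<rho> ^ l"
    have \<eta>: "\<eta> > 0" using \<rho> by (simp add: \<eta>_def)
    have "\<bar>\<integral>c. J m c * integral {block_time n..block_time (Suc n)} (force \<sigma> c) \<partial>W\<bar>
        \<le> (\<integral>c. \<bar>J m c * integral {block_time n..block_time (Suc n)} (force \<sigma> c)\<bar> * of_bool (\<not> sign_change c (block_time (Suc m)) (block_time n)) \<partial>W)"
      by (rule cancellation[OF block_time_nonneg lt _ _ known_J J_measurable J_bounded]) (use T_pos in \<open>auto simp: block_time_Suc\<close>)
    then have "\<bar>\<integral>c. J m c * J n c \<partial>W\<bar> \<le> (\<integral>c. \<bar>J m c * J n c\<bar> * N c \<partial>W)"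
      unfolding J_def[symmetric] N_def l(1)[symmetric] .
    also have "\<dots> \<le> (\<integral>c. \<eta> / 4 * ((J m c)^4 + (J n c)^4) + N c / (2 * \<eta>) \<partial>W)"
    proof (rule integral_mono)
      show "integrable W (\<lambda>c. \<bar>J m c * J n c\<bar> * N c)"
      proof (rule integrable_bounded)
        show "\<bar>\<bar>J m c * J n c\<bar> * N c\<bar> \<le> (T * (block_time m + T)) * (T * (block_time n + T))" if "c \<in> space paths" for c
        proof -
          have "\<bar>J m c * J n c\<bar> \<le> (T * (block_time m + T)) * (T * (block_time n + T))"
            unfolding abs_mult using J_bounded[OF that] T_pos block_time_nonneg by (intro mult_mono) auto
          moreover have "0 \<le> (T * (block_time m + T)) * (T * (block_time n + T))" using T_pos by (simp add: add_nonneg_nonneg)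
          ultimately show ?thesis by (auto simp: N_def)
        qed
      qed measurable
      show "\<bar>J m c * J n c\<bar> * N c \<le> \<eta> / 4 * ((J m c)^4 + (J n c)^4) + N c / (2 * \<eta>)" for c
        unfolding N_def by (rule weighted_young[OF \<eta>])
    qed (use integrable_J4 iN in auto)
    also have "\<dots> = \<eta> / 4 * ((\<integral>c. (J m c)^4 \<partial>W) + (\<integral>c. (J n c)^4 \<partial>W)) + (\<integral>c. N c \<partial>W) / (2 * \<eta>)"
      using integrable_J4 iN by simp
    also have "\<dots> \<le> \<eta> / 4 * (M4 + M4) + (A * \<gamma> ^ l) / (2 * \<eta>)"
      using \<eta> tail[of "Suc m" l] unfolding N_def
      by (intro add_mono mult_left_mono divide_right_mono expectation_J4_le) auto
    also have "(A * \<gamma> ^ l) / (2 * \<eta>) = A * \<eta> / 2"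
      unfolding \<rho>(3)[symmetric] power_mult_distrib \<eta>_def[symmetric] using \<eta> by simp
    also have "\<eta> / 4 * (M4 + M4) + A * \<eta> / 2 = (M4 + A) * (1 / 2) * \<eta>" by (simp add: algebra_simps)
    also have "\<dots> \<le> B * \<rho> * \<eta>"
      using \<rho> A M4 \<eta> by (intro mult_right_mono mult_mono) (auto simp: B_def)
    also have "\<dots> = B * \<rho> ^ (n - m)" by (simp add: l(1) \<eta>_def)
    finally show ?thesis .
  qed
  show thesis by (rule that[OF _ _ \<rho>(2) pw]) (use \<rho> A M4 in \<open>auto simp: B_def\<close>)
qed

definition S :: "nat \<Rightarrow> (real \<Rightarrow> real) \<Rightarrow> real" where "S N c = (\<Sum>n<N. J n c)"

lemma S_eq_integral: "c \<in> space paths \<Longrightarrow> S N c = integral {0..block_time N} (force \<sigma> c)"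
proof (induction N)
  case (Suc N)
  have "integral {0..block_time N} (force \<sigma> c) + integral {block_time N..block_time (Suc N)} (force \<sigma> c) = integral {0..block_time (Suc N)} (force \<sigma> c)"
    using block_time_mono[of N "Suc N"] Suc.prems
    by (intro Henstock_Kurzweil_Integration.integral_combine integrable_continuous_interval continuous_on_force) auto
  then show ?case using Suc by (simp add: S_def J_def)
qed (simp add: S_def block_time_def)

text \<open>Each new block adds its second moment and twice its correlation with the sum of all
  earlier blocks, which a geometric series bounds uniformly.\<close>

lemma S_second_moment:
  obtains C :: real where "\<And>N. integrable W (\<lambda>c. (S N c)^2)" "\<And>N. (\<integral>c. (S N c)^2 \<partial>W) \<le> C * real N"
proof (rule correlation_decay)
  fix B \<rho> :: real
  assume B: "0 \<le> B" and \<rho>: "0 < \<rho>" "\<rho> < 1"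
    and corr: "\<And>m n. m \<le> n \<Longrightarrow> \<bar>\<integral>c. J m c * J n c \<partial>W\<bar> \<le> B * \<rho> ^ (n - m)"
  have iSJ: "integrable W (\<lambda>c. S N c * J N c)" for N
    unfolding S_def sum_distrib_right by (rule Bochner_Integration.integrable_sum) (rule integrable_JJ)
  have Suc_sq: "(S (Suc N) c)^2 = (S N c)^2 + (2 * (S N c * J N c) + J N c * J N c)" for N c
    by (simp add: S_def power2_sum power2_eq_square algebra_simps)
  have iS: "integrable W (\<lambda>c. (S N c)^2)" for N
  proof (induction N)
    case (Suc N)
    then show ?case unfolding Suc_sq using iSJ integrable_JJ by simp
  qed (simp add: S_def)
  have SJ: "(\<integral>c. S N c * J N c \<partial>W) \<le> B / (1 - \<rho>)" for N
  proof -
    have "(\<integral>c. S N c * J N c \<partial>W) = (\<Sum>m<N. \<integral>c. J m c * J N c \<partial>W)"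
      unfolding S_def sum_distrib_right by (rule Bochner_Integration.integral_sum) (rule integrable_JJ)
    \<comment> \<open>Lowering the exponent by one matches the index reversal that yields a
      geometric sum.\<close>
    also have "\<dots> \<le> (\<Sum>m<N. B * \<rho> ^ (N - Suc m))"
    proof (rule sum_mono)
      fix m assume "m \<in> {..<N}"
      then have m: "m < N" by simp
      have "(\<integral>c. J m c * J N c \<partial>W) \<le> B * \<rho> ^ (N - m)" using corr[of m N] m by simp
      also have "\<dots> \<le> B * \<rho> ^ (N - Suc m)"
        using B \<rho> m by (intro mult_left_mono power_decreasing) auto
      finally show "(\<integral>c. J m c * J N c \<partial>W) \<le> B * \<rho> ^ (N - Suc m)" .
    qed
    also have "\<dots> = B * (\<Sum>m<N. \<rho> ^ m)"
      unfolding sum_distrib_left[symmetric] by (subst sum.nat_diff_reindex) simp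
    also have "\<dots> \<le> B * (1 / (1 - \<rho>))"
    proof (rule mult_left_mono[OF _ B])
      have "(\<Sum>m<N. \<rho> ^ m) \<le> suminf (\<lambda>m. \<rho> ^ m)"
        using \<rho> by (intro sum_le_suminf summable_geometric) auto
      also have "\<dots> = 1 / (1 - \<rho>)" using \<rho> by (intro suminf_geometric) auto
      finally show "(\<Sum>m<N. \<rho> ^ m) \<le> 1 / (1 - \<rho>)" .
    qed
    finally show ?thesis by simp
  qed
  have "(\<integral>c. (S N c)^2 \<partial>W) \<le> (2 * (B / (1 - \<rho>)) + B) * real N" for N
  proof (induction N)
    case (Suc N)
    have "(\<integral>c. (S (Suc N) c)^2 \<partial>W) = (\<integral>c. (S N c)^2 \<partial>W) + (2 * (\<integral>c. S N c * J N c \<partial>W) + (\<integral>c. J N c * J N c \<partial>W))"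
      unfolding Suc_sq using iS iSJ integrable_JJ by simp
    also have "\<dots> \<le> (2 * (B / (1 - \<rho>)) + B) * real N + (2 * (B / (1 - \<rho>)) + B)"
      using Suc SJ[of N] corr[of N N] by simp
    finally show ?case by (simp add: algebra_simps add_divide_distrib)
  qed (simp add: S_def)
  with iS show thesis by (rule that)
qed

text \<open>The power 8 keeps the memory below \<open>n^(1/4)\<close> at block times. Around block
  \<open>k^2\<close> this is of order \<open>sqrt k\<close>, so the drift integrated over the
  \<open>2 * k + 1\<close> blocks up to \<open>(k + 1)^2\<close> is of order \<open>k^(3/2)\<close>,
  below \<open>k^2\<close>.\<close>

lemma AE_norm_memory: "AE c in W. \<forall>\<^sub>F n in sequentially. norm (memory \<sigma> c (block_time n)) ^ 8 < (real n)^2"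
proof (rule eventually_less_square)
  define K where "K = (1 / \<epsilon>)^8 * 8^8"
  have K: "K \<ge> 0" using \<epsilon>_pos by (simp add: K_def)
  have le: "norm (memory \<sigma> c (block_time n)) ^ 8 \<le> K * V c (block_time n)" for c n
  proof -
    have "(\<epsilon> * norm (memory \<sigma> c (block_time n)))^8 \<le> real 8 ^ 8 * exp (\<epsilon> * norm (memory \<sigma> c (block_time n)))"
      using \<epsilon>_pos by (intro power_le_exp) auto
    then have "(1 / \<epsilon>)^8 * (\<epsilon> * norm (memory \<sigma> c (block_time n)))^8 \<le> (1 / \<epsilon>)^8 * (8 ^ 8 * exp (\<epsilon> * norm (memory \<sigma> c (block_time n))))"
      using \<epsilon>_pos by (intro mult_left_mono) auto
    moreover have "(1 / \<epsilon>)^8 * (\<epsilon> * norm (memory \<sigma> c (block_time n)))^8 = norm (memory \<sigma> c (block_time n)) ^ 8"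
      using \<epsilon>_pos by (simp add: power_mult_distrib power_divide)
    ultimately show ?thesis by (simp add: K_def V_def)
  qed
  show int: "integrable W (\<lambda>c. norm (memory \<sigma> c (block_time n)) ^ 8)" for n
  proof (rule integrable_bounded)
    show "\<bar>norm (memory \<sigma> c (block_time n)) ^ 8\<bar> \<le> block_time n ^ 8" if "c \<in> space paths" for c
      using norm_memory_le[OF that, of "block_time n" \<sigma>] by (simp add: power_mono)
    show "(\<lambda>c. norm (memory \<sigma> c (block_time n)) ^ 8) \<in> borel_measurable paths"
      using measurable_memory[of "block_time n" \<sigma>] by simp
  qed
  show "(\<integral>c. norm (memory \<sigma> c (block_time n)) ^ 8 \<partial>W) \<le> K * (1 + 64 * C0)" for n
  proof -
    have "(\<integral>c. norm (memory \<sigma> c (block_time n)) ^ 8 \<partial>W) \<le> (\<integral>c. K * V c (block_time n) \<partial>W)"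
      by (rule integral_mono[OF int]) (use integrable_V le in auto)
    also have "\<dots> = K * (\<integral>c. V c (block_time n) \<partial>W)" by simp
    also have "\<dots> \<le> K * (1 + 64 * C0)" using K expectation_V_le by (intro mult_left_mono) auto
    finally show ?thesis .
  qed
qed simp

lemma AE_integral_force: "AE c in W. ((\<lambda>t. integral {0..t} (force \<sigma> c) / t) \<longlongrightarrow> 0) at_top"
proof -
  obtain C :: real where iS: "\<And>N. integrable W (\<lambda>c. (S N c)^2)" and CS: "\<And>N. (\<integral>c. (S N c)^2 \<partial>W) \<le> C * real N"
    using S_second_moment by blast
  have "AE c in W. \<forall>\<^sub>F k in sequentially. \<bar>S (k^2) c\<bar> \<le> real k ^ 2 / real (Suc j)" for j
  proof -
    \<comment> \<open>The second moment of \<open>S (k^2)\<close> is of order \<open>k^2\<close>, so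
      \<open>Q\<close> has bounded mean, and \<open>Q k c < k^2\<close> amounts to the required
      bound on \<open>S (k^2)\<close>.\<close>
    define Q where "Q k c = (real (Suc j))^2 * (S (k^2) c)^2 / (real k)^2" for k c
    have "AE c in W. \<forall>\<^sub>F k in sequentially. Q k c < (real k)^2"
    proof (rule eventually_less_square)
      show "integrable W (Q k)" for k unfolding Q_def using iS by simp
      show "0 \<le> Q k c" for k c by (simp add: Q_def)
      fix k :: nat assume k: "k > 0"
      have "(\<integral>c. Q k c \<partial>W) = (real (Suc j))^2 * (\<integral>c. (S (k^2) c)^2 \<partial>W) / (real k)^2"
        unfolding Q_def by simp
      also have "\<dots> \<le> (real (Suc j))^2 * (C * real (k^2)) / (real k)^2"
        by (intro divide_right_mono mult_left_mono CS) auto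
      also have "\<dots> = (real (Suc j))^2 * C" using k by simp
      finally show "(\<integral>c. Q k c \<partial>W) \<le> (real (Suc j))^2 * C" .
    qed
    then show ?thesis
    proof eventually_elim
      case (elim c)
      show ?case using elim eventually_gt_at_top[of 0]
      proof eventually_elim
        case (elim k)
        have "(real (Suc j) * \<bar>S (k^2) c\<bar>)^2 = (real (Suc j))^2 * (S (k^2) c)^2"
          by (simp add: power_mult_distrib del: of_nat_Suc)
        also have "\<dots> < (real k)^2 * (real k)^2"
          using elim by (simp add: Q_def pos_divide_less_eq del: of_nat_Suc)
        finally have "(real (Suc j) * \<bar>S (k^2) c\<bar>)^2 < ((real k)^2)^2"
          by (simp only: power2_eq_square[of "(real k)^2"])
        then have "real (Suc j) * \<bar>S (k^2) c\<bar> < (real k)^2" by (rule power2_less_imp_less) simp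
        then show ?case by (simp add: pos_le_divide_eq mult.commute del: of_nat_Suc)
      qed
    qed
  qed
  then have "AE c in W. \<forall>j. \<forall>\<^sub>F k in sequentially. \<bar>S (k^2) c\<bar> \<le> real k ^ 2 / real (Suc j)"
    by (simp add: AE_all_countable)
  with AE_norm_memory AE_space show ?thesis
  proof eventually_elim
    case (elim c)
    then have c: "c \<in> space paths" by (simp add: space_W)
    obtain N where N: "\<And>n. n \<ge> N \<Longrightarrow> norm (memory \<sigma> c (block_time n)) ^ 8 < (real n)^2"
      using elim(1) unfolding eventually_sequentially by blast
    have tmk: "block_time (k^2) = T * real k ^ 2" for k by (simp add: block_time_def mult.commute)
    show ?case
    proof (rule tendsto_zero_over_t[OF T_pos])
      fix j :: nat
      show "\<forall>\<^sub>F k in sequentially. \<bar>integral {0..T * real k ^ 2} (force \<sigma> c)\<bar> \<le> real k ^ 2 / real (Suc j)"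
        using elim(3) unfolding tmk[symmetric] S_eq_integral[OF c, symmetric] by blast
      \<comment> \<open>Length of the interval from \<open>T * k^2\<close> to
        \<open>T * (k + 1)^2\<close> times a bound for the drift on it: the length of the memory at
        the last block time plus \<open>T\<close>.\<close>
      define h where "h k = T * (2 * real k + 1) * (sqrt (real k + 1) + T)" for k :: nat
      have "(\<lambda>k. h k / real k ^ 2) \<longlonglongrightarrow> 0" unfolding h_def by real_asymp
      then have ev: "\<forall>\<^sub>F k in sequentially. h k / real k ^ 2 < 1 / real (Suc j)"
        by (rule order_tendstoD) simp
      show "\<forall>\<^sub>F k in sequentially. \<forall>t\<in>{T * real k ^ 2..T * real (Suc k) ^ 2}.
          \<bar>integral {0..t} (force \<sigma> c) - integral {0..T * real k ^ 2} (force \<sigma> c)\<bar> \<le> real k ^ 2 / real (Suc j)"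
        using ev eventually_ge_at_top[of N] eventually_gt_at_top[of 0]
      proof eventually_elim
        case (elim k)
        show ?case
        proof
          fix t assume t: "t \<in> {T * real k ^ 2..T * real (Suc k) ^ 2}"
          have Nk: "N \<le> k^2" using elim(2,3) by (simp add: power2_eq_square) (metis le_trans mult_le_mono1 mult_1 Suc_leI One_nat_def)
          have a0: "0 \<le> T * real k ^ 2" using T_pos by simp
          have Dle: "\<bar>force \<sigma> c s\<bar> \<le> sqrt (real k + 1) + T" if s: "s \<in> {T * real k ^ 2..t}" for s
          proof -
            define n where "n = nat \<lfloor>s / T\<rfloor>"
            have "0 \<le> s" using s a0 by simp
            then have s0: "0 \<le> s / T" using T_pos by simp
            have sk: "real k ^ 2 \<le> s / T" "s / T \<le> real (Suc k) ^ 2"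
              using s t T_pos by (auto simp: pos_le_divide_eq pos_divide_le_eq mult.commute simp del: of_nat_Suc)
            have n: "real n \<le> s / T" "s / T < real n + 1" using s0 unfolding n_def by linarith+
            have "real (k^2) < real (n + 1)" using sk n by simp
            then have nk: "k^2 \<le> n" by linarith
            have "norm (memory \<sigma> c (block_time n)) ^ 8 < (real n)^2" using N nk Nk by simp
            also have "\<dots> \<le> (real (Suc k) ^ 2)^2" using n sk by (intro power_mono) auto
            also have "\<dots> = sqrt (real k + 1) ^ 8"
            proof -
              have "sqrt (real k + 1) ^ 8 = ((sqrt (real k + 1))^2)^4"
                unfolding power_mult[symmetric] by simp
              also have "(sqrt (real k + 1))^2 = real (Suc k)" by simp
              also have "real (Suc k) ^ 4 = (real (Suc k) ^ 2)^2"
                unfolding power_mult[symmetric] by simp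
              finally show ?thesis ..
            qed
            finally have "norm (memory \<sigma> c (block_time n)) < sqrt (real k + 1)" by (rule power_less_imp_less_base) simp
            moreover have "block_time n \<le> s" "s \<le> block_time n + T"
              using n T_pos by (auto simp: block_time_def pos_le_divide_eq pos_divide_less_eq algebra_simps)
            ultimately show ?thesis
              using abs_force_le_norm_memory[of \<sigma> c s] abs_norm_memory_diff_le[OF c block_time_nonneg[of n], of s] by auto
          qed
          have "integral {0..T * real k ^ 2} (force \<sigma> c) + integral {T * real k ^ 2..t} (force \<sigma> c) = integral {0..t} (force \<sigma> c)"
            using t a0 by (intro Henstock_Kurzweil_Integration.integral_combine integrable_continuous_interval continuous_on_force c) auto
          then have "\<bar>integral {0..t} (force \<sigma> c) - integral {0..T * real k ^ 2} (force \<sigma> c)\<bar> = norm (integral {T * real k ^ 2..t} (force \<sigma> c))"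
            by simp
          also have "\<dots> \<le> (sqrt (real k + 1) + T) * (t - T * real k ^ 2)"
            by (rule integral_bound) (use t a0 Dle in \<open>auto intro: continuous_on_force[OF c]\<close>)
          also have "\<dots> \<le> (sqrt (real k + 1) + T) * (T * (2 * real k + 1))"
            using t T_pos by (intro mult_left_mono) (auto simp: power2_eq_square algebra_simps intro!: add_nonneg_nonneg)
          also have "\<dots> = h k" by (simp add: h_def mult_ac)
          also have "\<dots> \<le> real k ^ 2 / real (Suc j)"
            using elim(1,3) by (simp add: pos_divide_less_eq del: of_nat_Suc)
          finally show "\<bar>integral {0..t} (force \<sigma> c) - integral {0..T * real k ^ 2} (force \<sigma> c)\<bar> \<le> real k ^ 2 / real (Suc j)" .
        qed
      qed
    qed
  qed
qed

text \<open>The law of large numbers for Brownian motion by the same scheme, with Kolmogorov's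
  inequality for the oscillation between square times. The increment rule of \<open>wiener\<close>
  leaves the starting value open, hence the subtraction of \<open>c 0\<close>.\<close>

lemma AE_path: "AE c in W. ((\<lambda>t. (c t - c 0) / t) \<longlongrightarrow> 0) at_top"
proof -
  have sk: "AE c in W. \<forall>\<^sub>F k::nat in sequentially. \<bar>c (real k ^ 2) - c 0\<bar> \<le> real k ^ 2 / real (Suc j)" for j
  proof -
    define Q where "Q k c = (real (Suc j))^2 * (c (real k ^ 2) - c 0)^2 / (real k)^2" for k and c :: "real \<Rightarrow> real"
    have sq: "integrable W (\<lambda>c. (c (real k ^ 2) - c 0)^2)" "(\<integral>c. (c (real k ^ 2) - c 0)^2 \<partial>W) = real k ^ 2" for k
      using integrable_increment2[of 0 "real k ^ 2" "\<lambda>_. 1" 1] expectation_increment2[of 0 "real k ^ 2" "\<lambda>_. 1" 1]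
      by (cases "k = 0"; simp add: prob_space)+
    have "AE c in W. \<forall>\<^sub>F k in sequentially. Q k c < (real k)^2"
    proof (rule eventually_less_square)
      show "integrable W (Q k)" for k unfolding Q_def using sq by simp
      show "0 \<le> Q k c" for k c by (simp add: Q_def)
      show "(\<integral>c. Q k c \<partial>W) \<le> (real (Suc j))^2" if "k > 0" for k
        unfolding Q_def using sq[of k] that by simp
    qed
    then show ?thesis
    proof eventually_elim
      case (elim c)
      show ?case using elim eventually_gt_at_top[of 0]
      proof eventually_elim
        case (elim k)
        have "(real (Suc j) * \<bar>c (real k ^ 2) - c 0\<bar>)^2 = (real (Suc j))^2 * (c (real k ^ 2) - c 0)^2"
          by (simp add: power_mult_distrib del: of_nat_Suc)
        also have "\<dots> < (real k)^2 * (real k)^2"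
          using elim by (simp add: Q_def pos_divide_less_eq del: of_nat_Suc)
        finally have "(real (Suc j) * \<bar>c (real k ^ 2) - c 0\<bar>)^2 < ((real k)^2)^2"
          by (simp only: power2_eq_square[of "(real k)^2"])
        then have "real (Suc j) * \<bar>c (real k ^ 2) - c 0\<bar> < (real k)^2" by (rule power2_less_imp_less) simp
        then show ?case by (simp add: pos_le_divide_eq mult.commute del: of_nat_Suc)
      qed
    qed
  qed
  have osc: "AE c in W. \<forall>\<^sub>F k::nat in sequentially. \<forall>t\<in>{real k ^ 2..real (Suc k) ^ 2}. \<bar>c t - c (real k ^ 2)\<bar> \<le> real k ^ 2 / real (Suc j)" for j
  proof -
    define l where "l k = real k ^ 2 / real (Suc j)" for k
    define A where "A k = exceeds (real k ^ 2) (real (Suc k) ^ 2) (l k)" for k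
    have lt: "real k ^ 2 < real (Suc k) ^ 2" for k by (intro power_strict_mono) auto
    have [measurable]: "Measurable.pred paths (A k)" for k unfolding A_def by (intro measurable_exceeds lt) simp
    \<comment> \<open>For positive \<open>k\<close>, \<open>Q k c < k^2\<close> says just that
      \<open>A k\<close> fails; the factor \<open>k^2\<close> turns a probability of order
      \<open>1 / k^2\<close> into a bounded mean.\<close>
    define Q :: "nat \<Rightarrow> (real \<Rightarrow> real) \<Rightarrow> real" where "Q k c = (real k)^2 * of_bool (A k c)" for k c
    have "AE c in W. \<forall>\<^sub>F k in sequentially. Q k c < (real k)^2"
    proof (rule eventually_less_square)
      show "integrable W (Q k)" for k
      proof (rule integrable_bounded)
        show "\<bar>Q k c\<bar> \<le> (real k)^2" for c by (simp add: Q_def)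
      qed (unfold Q_def, measurable)
      show "0 \<le> Q k c" for k c by (simp add: Q_def)
      fix k :: nat assume k: "k > 0"
      have "(l k)^2 * (\<integral>c. of_bool (A k c) \<partial>W) \<le> real (Suc k) ^ 2 - real k ^ 2"
        unfolding A_def by (rule kolmogorov[OF _ lt]) (use k in \<open>auto simp: l_def\<close>)
      also have "\<dots> = 2 * real k + 1" by (simp add: power2_eq_square algebra_simps)
      also have "\<dots> \<le> 3 * real k ^ 2" using k by (cases k) (auto simp: power2_eq_square algebra_simps)
      finally have "real k ^ 2 * ((real k ^ 2 / (real (Suc j))^2) * (\<integral>c. of_bool (A k c) \<partial>W)) \<le> real k ^ 2 * 3"
        by (simp add: l_def power2_eq_square mult_ac del: of_nat_Suc)
      then have "(real k ^ 2 / (real (Suc j))^2) * (\<integral>c. of_bool (A k c) \<partial>W) \<le> 3"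
        by (rule mult_left_le_imp_le) (use k in simp)
      then show "(\<integral>c. Q k c \<partial>W) \<le> 3 * (real (Suc j))^2"
        unfolding Q_def by (simp add: pos_divide_le_eq del: of_nat_Suc)
    qed
    then show ?thesis
    proof eventually_elim
      case (elim c)
      then show ?case
      proof eventually_elim
        case (elim k)
        then have "\<not> A k c" by (auto simp: Q_def)
        then show ?case by (auto simp: A_def exceeds_def l_def not_less simp del: of_nat_Suc)
      qed
    qed
  qed
  have "AE c in W. \<forall>j. \<forall>\<^sub>F k::nat in sequentially. \<bar>c (real k ^ 2) - c 0\<bar> \<le> real k ^ 2 / real (Suc j)"
    using sk by (simp add: AE_all_countable)
  moreover have "AE c in W. \<forall>j. \<forall>\<^sub>F k::nat in sequentially. \<forall>t\<in>{real k ^ 2..real (Suc k) ^ 2}. \<bar>c t - c (real k ^ 2)\<bar> \<le> real k ^ 2 / real (Suc j)"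
    using osc by (simp add: AE_all_countable)
  ultimately show ?thesis
  proof eventually_elim
    case (elim c)
    show ?case
      by (rule tendsto_zero_over_t[of 1]) (use elim in auto)
  qed
qed

lemma AE_angle_over_t: "AE c in W. ((\<lambda>t. angle \<sigma> c t / t) \<longlongrightarrow> 0) at_top"
  using AE_path AE_integral_force AE_space
proof eventually_elim
  case (elim c)
  then have c: "c \<in> space paths" by (simp add: space_W)
  have "((\<lambda>t. angle \<sigma> c 0 / t + \<sigma> * ((c t - c 0) / t) + integral {0..t} (force \<sigma> c) / t) \<longlongrightarrow> 0 + \<sigma> * 0 + 0) at_top"
    by (intro tendsto_intros elim(1,2) real_tendsto_divide_at_top[OF tendsto_const filterlim_ident])
  moreover have "\<forall>\<^sub>F t in at_top. angle \<sigma> c 0 / t + \<sigma> * ((c t - c 0) / t) + integral {0..t} (force \<sigma> c) / t = angle \<sigma> c t / t"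
    using eventually_ge_at_top[of 0]
    by eventually_elim (subst angle_restart[OF c, of 0], auto simp: add_divide_distrib)
  ultimately show ?case by (simp add: tendsto_cong)
qed

text \<open>A limit of the position forces the memory, its time integral, to grow linearly, whereas
  \<open>AE_norm_memory\<close> allows only the power 1/4 of time along the block times.\<close>

lemma AE_cis_angle_no_limit: "AE c in W. \<not> (\<exists>z. ((\<lambda>t. cis (angle \<sigma> c t)) \<longlongrightarrow> z) at_top)"
  using AE_norm_memory AE_space
proof eventually_elim
  case (elim c)
  then have c: "c \<in> space paths" by (simp add: space_W)
  show ?case
  proof
    assume "\<exists>z. ((\<lambda>t. cis (angle \<sigma> c t)) \<longlongrightarrow> z) at_top"
    then obtain z where z: "((\<lambda>t. cis (angle \<sigma> c t)) \<longlongrightarrow> z) at_top" by blast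
    have "norm z = 1"
      using tendsto_unique[OF _ tendsto_norm[OF z] ] by (simp add: tendsto_const_iff)
    from tendstoD[OF z, of "1/4"] obtain t0 where t0: "\<And>t. t \<ge> t0 \<Longrightarrow> dist (cis (angle \<sigma> c t)) z < 1 / 4"
      by (auto simp: eventually_at_top_linorder)
    define t1 where "t1 = max 0 t0"
    \<comment> \<open>From \<open>t1\<close> on the velocity is within 1/4 of the unit vector
      \<open>z\<close>, which gives speed at least 3/4 in its direction; the time before
      \<open>t1\<close> can cancel at most \<open>t1\<close> of this.\<close>
    have grow: "norm (memory \<sigma> c t) \<ge> 3 / 4 * t - 2 * t1" if t: "t \<ge> t1" for t
    proof -
      have tt: "0 \<le> t1" "t1 \<le> t" using t by (auto simp: t1_def)
      define w where "w = of_real (t - t1) * z"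
      have int: "(\<lambda>s. cis (angle \<sigma> c s)) integrable_on {t1..t}"
        by (intro integrable_continuous_interval continuous_intros continuous_on_angle c tt)
      have le: "norm (integral {t1..t} (\<lambda>s. cis (angle \<sigma> c s) - z)) \<le> 1 / 4 * (t - t1)"
      proof (rule integral_bound[OF tt(2)])
        show "continuous_on {t1..t} (\<lambda>s. cis (angle \<sigma> c s) - z)" by (intro continuous_intros continuous_on_angle c tt)
        show "norm (cis (angle \<sigma> c s) - z) \<le> 1 / 4" if "s \<in> {t1..t}" for s
          using t0[of s] that by (auto simp: t1_def dist_norm)
      qed
      have eq: "integral {t1..t} (\<lambda>s. cis (angle \<sigma> c s) - z) = (memory \<sigma> c t - memory \<sigma> c t1) - w"
        unfolding w_def using memory_diff_eq[OF c tt, of \<sigma>] tt int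
        by (subst Henstock_Kurzweil_Integration.integral_diff) (auto simp: scaleR_conv_of_real)
      note le[unfolded eq]
      moreover have "norm w = t - t1" unfolding w_def using tt \<open>norm z = 1\<close> by (simp add: norm_mult del: of_real_diff)
      moreover have "norm (memory \<sigma> c t1) \<le> t1" by (rule norm_memory_le[OF c tt(1)])
      ultimately have "t - t1 - 1 / 4 * (t - t1) \<le> norm (memory \<sigma> c t - memory \<sigma> c t1)"
        using norm_triangle_ineq3[of "memory \<sigma> c t - memory \<sigma> c t1" w] by linarith
      moreover have "norm (memory \<sigma> c t - memory \<sigma> c t1) \<le> norm (memory \<sigma> c t) + t1"
        using norm_triangle_ineq4[of "memory \<sigma> c t" "memory \<sigma> c t1"] norm_memory_le[OF c tt(1), of \<sigma>] by linarith
      ultimately have "t - t1 - 1 / 4 * (t - t1) \<le> norm (memory \<sigma> c t) + t1" by (rule order_trans)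
      then show "3 / 4 * t - 2 * t1 \<le> norm (memory \<sigma> c t)" using tt(1) by (simp add: field_simps)
    qed
    have "\<forall>\<^sub>F n::nat in sequentially. (real n)^2 \<le> (3 / 4 * (real n * T) - 2 * t1) ^ 8"
      using T_pos by real_asymp
    moreover have "\<forall>\<^sub>F n::nat in sequentially. t1 \<le> real n * T" using T_pos by real_asymp
    moreover have "\<forall>\<^sub>F n::nat in sequentially. 0 \<le> 3 / 4 * (real n * T) - 2 * t1" using T_pos by real_asymp
    ultimately have "\<forall>\<^sub>F n::nat in sequentially. False"
      using elim(1)
    proof eventually_elim
      case (elim n)
      have "(3 / 4 * (real n * T) - 2 * t1) ^ 8 \<le> norm (memory \<sigma> c (block_time n)) ^ 8"
        using grow[of "block_time n"] elim by (intro power_mono) (auto simp: block_time_def)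
      then show ?case using elim by linarith
    qed
    then show False by simp
  qed
qed

end

section \<open>Transfer from path space to a given solution\<close>

theorem theorem1p2:
  fixes M :: "'a measure"
    and B X U V :: "real \<Rightarrow> 'a \<Rightarrow> real"
    and \<sigma> :: real
  assumes sigma_pos: "\<sigma> > 0"
    and BM: "brownian_motion M B"
    and sol: "AE \<omega> in M.
        continuous_on {0..} (\<lambda>t. X t \<omega>) \<and>
        (\<forall>t\<ge>0. U t \<omega> = integral {0..t} (\<lambda>s. cos (X s \<omega>))) \<and>
        (\<forall>t\<ge>0. V t \<omega> = integral {0..t} (\<lambda>s. sin (X s \<omega>))) \<and>
        (\<forall>t\<ge>0. X t \<omega> = \<sigma> * B t \<omega> +
            integral {0..t} (\<lambda>s. sin (X s \<omega>) * U s \<omega> - cos (X s \<omega>) * V s \<omega>))"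
  shows "AE \<omega> in M.
           \<not> (\<exists>z. ((\<lambda>t. cis (X t \<omega>)) \<longlongrightarrow> z) at_top) \<and>
           ((\<lambda>t. X t \<omega> / t) \<longlongrightarrow> 0) at_top"
proof -
  interpret brownian M B
    using BM by (simp add: brownian_def brownian_axioms_def brownian_motion_def)
  interpret R: repelling "distr M paths bpath" \<sigma>
    by (intro repelling.intro repelling_axioms.intro wiener_bpath sigma_pos)
  show ?thesis
    using sol AE_distrD[OF bpath_measurable R.AE_cis_angle_no_limit] AE_distrD[OF bpath_measurable R.AE_angle_over_t] AE_space
  proof eventually_elim
    case (elim \<omega>)
    define x where "x t = X t \<omega>" for t
    have x: "continuous_on {0..t} x" for t
      using elim(1) unfolding x_def by (auto intro: continuous_on_subset)
    have mem: "mem 0 0 x s = Complex (U s \<omega>) (V s \<omega>)" if "s \<ge> 0" for s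
    proof -
      have int: "(\<lambda>r. cis (x r)) integrable_on {0..s}"
        by (intro integrable_continuous_interval continuous_intros x)
      have "integral {0..s} (\<lambda>r. cos (x r)) = Re (integral {0..s} (\<lambda>r. cis (x r)))"
        "integral {0..s} (\<lambda>r. sin (x r)) = Im (integral {0..s} (\<lambda>r. cis (x r)))"
        using integral_linear[OF int bounded_linear_Re] integral_linear[OF int bounded_linear_Im]
        by (simp_all add: o_def)
      then show ?thesis using elim(1) that by (simp add: mem_def x_def complex_eq_iff)
    qed
    have drift: "drift 0 0 x s = sin (X s \<omega>) * U s \<omega> - cos (X s \<omega>) * V s \<omega>" if "s \<ge> 0" for s
      by (simp add: drift_def mem[OF that] x_def)
    have eq: "x t = \<sigma> * bpath \<omega> t + integral {0..t} (drift 0 0 x)" if "t \<ge> 0" for t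
    proof -
      have "integral {0..t} (drift 0 0 x) = integral {0..t} (\<lambda>s. sin (X s \<omega>) * U s \<omega> - cos (X s \<omega>) * V s \<omega>)"
        by (rule integral_cong) (simp add: drift)
      then show ?thesis using elim(1) that by (simp add: x_def bpath_def)
    qed
    \<comment> \<open>Pathwise uniqueness identifies the given solution with the functional of the
      Brownian path, so the almost sure statements on path space apply to it.\<close>
    have "x t = angle \<sigma> (bpath \<omega>) t" if "t \<ge> 0" for t
      unfolding angle_def
      by (rule sol_unique[OF continuous_on_scaled_path[OF bpath_paths[OF elim(4)]] x eq]) (use that in auto)
    then have ev: "\<forall>\<^sub>F t in at_top. angle \<sigma> (bpath \<omega>) t = X t \<omega>"
      by (intro eventually_mono[OF eventually_ge_at_top[of 0]]) (simp add: x_def)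
    have "((\<lambda>t. cis (angle \<sigma> (bpath \<omega>) t)) \<longlongrightarrow> z) at_top \<longleftrightarrow> ((\<lambda>t. cis (X t \<omega>)) \<longlongrightarrow> z) at_top" for z
      by (rule tendsto_cong) (use ev in \<open>auto elim!: eventually_mono\<close>)
    moreover have "((\<lambda>t. angle \<sigma> (bpath \<omega>) t / t) \<longlongrightarrow> 0) at_top \<longleftrightarrow> ((\<lambda>t. X t \<omega> / t) \<longlongrightarrow> 0) at_top"
      by (rule tendsto_cong) (use ev in \<open>auto elim!: eventually_mono\<close>)
    ultimately show ?case using elim(2,3) by simp
  qed
qed

end
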